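(* Let $M$ be a smooth manifold. For a smooth map $\phi:\mathbb{R}^p\times\mathbb{R}^p\to M$ let $\Phi:\mathbb{R}^p\to J_p^1M$ be the smooth map $\Phi(u)=j^1(\phi_u)$, where $\phi_u:\mathbb{R}^p\to M$, $\phi_u(v)=\phi(u,v)$. Then $J_p^1(J_p^1M)$ is a quotient manifold of $J_{2p}^2M$, with quotient map $$\Lambda:J_{2p}^2M\to J_p^1(J_p^1M),\qquad \Lambda(j^2\phi)=j^1\Phi .$$
   Context: Fix $p\ge1$. For a smooth manifold $N$, two smooth maps $\phi,\xi:\mathbb{R}^p\to N$ have the same 1-jet, $j^1\phi=j^1\xi$, if $\phi(0)=\xi(0)$ and, in local coordinates, their first partial derivatives at $0$ agree; $J_p^1N$ is the set of all 1-jets. For a chart $(U,x_1,\dots,x_n)$ of $N$, $J_p^1U=\{j^1\phi:\phi(0)\in U\}$ has the chart $x_i(j^1\phi)=x_i(\phi(0))$, $x^i_\alpha(j^1\phi)=\partial(x_i\circ\phi)/\partial u_\alpha|_0$ ($1\le\alpha\le p$), and these charts make $J_p^1N$ a smooth manifold. $J_p^1(J_p^1M)$ is this construction applied to $N=J_p^1M$. Identify $\mathbb{R}^{2p}=\mathbb{R}^p\times\mathbb{R}^p$. Two smooth maps $\phi,\phi':\mathbb{R}^{2p}\to M$ have the same 2-jet, $j^2\phi=j^2\phi'$, if $\phi(0,0)=\phi'(0,0)$ and, in local coordinates, all their first and second partial derivatives at $(0,0)$ agree; $J_{2p}^2M$ is the set of all 2-jets. It is a smooth manifold with charts given, over a chart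 of $M$, by the value at $(0,0)$, the first partial derivatives (an element of $L(\mathbb{R}^{2p},\mathbb{R}^m)$) and the second partial derivatives (an element of the space $S_2(\mathbb{R}^{2p};\mathbb{R}^m)$ of symmetric bilinear maps) of $\phi$ at $(0,0)$, where $m=\dim M$. A manifold $Q$ is a quotient manifold of a manifold $N$ with quotient map $q:N\to Q$ if $q$ is a (well-defined) surjective submersion. *)

theory Defs
  imports "HOL-Analysis.Analysis"
begin

text \<open>
  Smoothness is used only for finite-dimensional spaces, where a map on an open set is of class
  \<open>C\<^sup>k\<^sup>+\<^sup>1\<close> iff it is differentiable and all its directional derivatives are of class \<open>C\<^sup>k\<close>.
  Models of manifolds range over finite-dimensional normed spaces rather than over
  \<open>euclidean_space\<close> for two reasons: the spaces of linear and of symmetric bilinear maps, which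
  occur as models of jet manifolds, are then covered, and so are manifolds of dimension \<open>0\<close>.
\<close>

definition finite_dim :: "'e::real_normed_vector itself \<Rightarrow> bool" where
  "finite_dim _ \<longleftrightarrow> (\<exists>B::'e set. finite B \<and> span B = UNIV)"

definition partial :: "'u \<Rightarrow> ('u::real_normed_vector \<Rightarrow> 'e::real_normed_vector) \<Rightarrow> 'u \<Rightarrow> 'e" where
  "partial v f z = frechet_derivative f (at z) v"

primrec Ck_on :: "nat \<Rightarrow> 'u::real_normed_vector set \<Rightarrow> ('u \<Rightarrow> 'e::real_normed_vector) \<Rightarrow> bool" where
  "Ck_on 0 S f \<longleftrightarrow> continuous_on S f"
| "Ck_on (Suc k) S f \<longleftrightarrow> (\<forall>z\<in>S. f differentiable (at z)) \<and> (\<forall>v. Ck_on k S (partial v f))"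

definition smooth_on :: "'u::real_normed_vector set \<Rightarrow> ('u \<Rightarrow> 'e::real_normed_vector) \<Rightarrow> bool" where
  "smooth_on S f \<longleftrightarrow> (\<forall>k. Ck_on k S f)"

text \<open>
  A manifold is given by its points and by an atlas, not necessarily maximal; a chart is a
  domain together with a coordinate map, whose values outside the domain are irrelevant.
\<close>

record ('a, 'e) manifold =
  points :: "'a set"
  atlas :: "('a set \<times> ('a \<Rightarrow> 'e)) set"

definition mtopology_of :: "('a, 'e::real_normed_vector) manifold \<Rightarrow> 'a topology" where
  "mtopology_of N = topology (\<lambda>W. W \<subseteq> points N \<and> (\<forall>(U, x)\<in>atlas N. open (x ` (W \<inter> U))))"

definition smooth_manifold :: "('a, 'e::real_normed_vector) manifold \<Rightarrow> bool" where
  "smooth_manifold N \<longleftrightarrow>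
     finite_dim TYPE('e) \<and>
     (\<Union>(U, x)\<in>atlas N. U) = points N \<and>
     (\<forall>(U, x)\<in>atlas N. inj_on x U \<and> open (x ` U)) \<and>
     (\<forall>(U, x)\<in>atlas N. \<forall>(V, y)\<in>atlas N.
        open (x ` (U \<inter> V)) \<and> smooth_on (x ` (U \<inter> V)) (y \<circ> inv_into U x)) \<and>
     Hausdorff_space (mtopology_of N) \<and>
     second_countable (mtopology_of N)"

text \<open>The family of sets in \<open>mtopology_of\<close> is a topology as soon as coordinate maps are injective.\<close>

lemma openin_mtopology_of:
  fixes N :: "('a, 'e::real_normed_vector) manifold"
  assumes "\<forall>(U, x)\<in>atlas N. inj_on x U"
  shows "openin (mtopology_of N) W \<longleftrightarrow>
         W \<subseteq> points N \<and> (\<forall>(U, x)\<in>atlas N. open (x ` (W \<inter> U)))"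
proof -
  have "istopology (\<lambda>W. W \<subseteq> points N \<and> (\<forall>(U, x)\<in>atlas N. open (x ` (W \<inter> U))))"
    unfolding istopology_def
  proof (intro conjI allI impI ballI)
    fix S T
    assume S: "S \<subseteq> points N \<and> (\<forall>(U, x)\<in>atlas N. open (x ` (S \<inter> U)))"
       and T: "T \<subseteq> points N \<and> (\<forall>(U, x)\<in>atlas N. open (x ` (T \<inter> U)))"
    show "S \<inter> T \<subseteq> points N" using S by blast
    fix c assume c: "c \<in> atlas N"
    obtain U x where cU: "c = (U, x)" by (cases c)
    have "x ` (S \<inter> T \<inter> U) = x ` ((S \<inter> U) \<inter> (T \<inter> U))"
      by (rule arg_cong[where f = "image x"]) blast
    also have "\<dots> = x ` (S \<inter> U) \<inter> x ` (T \<inter> U)"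
      using assms c cU by (intro inj_on_image_Int[of x U]) auto
    finally have "x ` (S \<inter> T \<inter> U) = x ` (S \<inter> U) \<inter> x ` (T \<inter> U)" .
    then show "case c of (U, x) \<Rightarrow> open (x ` (S \<inter> T \<inter> U))"
      using S T c cU by (auto intro!: open_Int)
  next
    fix K
    assume K: "\<forall>W\<in>K. W \<subseteq> points N \<and> (\<forall>(U, x)\<in>atlas N. open (x ` (W \<inter> U)))"
    show "\<Union>K \<subseteq> points N" using K by blast
    fix c assume c: "c \<in> atlas N"
    obtain U x where cU: "c = (U, x)" by (cases c)
    have "x ` (\<Union>K \<inter> U) = (\<Union>W\<in>K. x ` (W \<inter> U))" by blast
    then show "case c of (U, x) \<Rightarrow> open (x ` (\<Union>K \<inter> U))"
      using K c cU by (auto intro!: open_UN)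
  qed
  then show ?thesis
    by (simp add: mtopology_of_def topology_inverse')
qed

definition vector_space_manifold :: "('u, 'u::real_normed_vector) manifold" where
  "vector_space_manifold = \<lparr>points = UNIV, atlas = {(UNIV, id)}\<rparr>"

definition smooth_map ::
  "('a, 'e::real_normed_vector) manifold \<Rightarrow> ('b, 'f::real_normed_vector) manifold \<Rightarrow> ('a \<Rightarrow> 'b) \<Rightarrow> bool"
where
  "smooth_map N Q f \<longleftrightarrow>
     continuous_map (mtopology_of N) (mtopology_of Q) f \<and>
     (\<forall>(U, x)\<in>atlas N. \<forall>(V, y)\<in>atlas Q.
        smooth_on (x ` (U \<inter> f -` V)) (y \<circ> f \<circ> inv_into U x))"

text \<open>Surjectivity of the differential is expressed through its coordinate representations.\<close>

definition submersion ::
  "('a, 'e::real_normed_vector) manifold \<Rightarrow> ('b, 'f::real_normed_vector) manifold \<Rightarrow> ('a \<Rightarrow> 'b) \<Rightarrow> bool"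
where
  "submersion N Q f \<longleftrightarrow>
     smooth_map N Q f \<and>
     (\<forall>(U, x)\<in>atlas N. \<forall>(V, y)\<in>atlas Q. \<forall>a \<in> U \<inter> f -` V.
        surj (frechet_derivative (y \<circ> f \<circ> inv_into U x) (at (x a))))"

definition quotient_manifold ::
  "('a, 'e::real_normed_vector) manifold \<Rightarrow> ('b, 'f::real_normed_vector) manifold \<Rightarrow> ('a \<Rightarrow> 'b) \<Rightarrow> bool"
where
  "quotient_manifold N Q q \<longleftrightarrow>
     smooth_manifold N \<and> smooth_manifold Q \<and> submersion N Q q \<and> q ` points N = points Q"

abbreviation smooth_param :: "('a, 'e::real_normed_vector) manifold \<Rightarrow> ('u::euclidean_space \<Rightarrow> 'a) \<Rightarrow> bool"
  where "smooth_param N \<equiv> smooth_map vector_space_manifold N"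

definition same_1jet ::
  "('a, 'e::real_normed_vector) manifold \<Rightarrow> (real^'p \<Rightarrow> 'a) \<Rightarrow> (real^'p \<Rightarrow> 'a) \<Rightarrow> bool"
where
  "same_1jet N \<phi> \<xi> \<longleftrightarrow>
     \<phi> 0 = \<xi> 0 \<and>
     (\<forall>(U, x)\<in>atlas N. \<phi> 0 \<in> U \<longrightarrow>
        (\<forall>\<alpha>. partial (axis \<alpha> 1) (x \<circ> \<phi>) 0 = partial (axis \<alpha> 1) (x \<circ> \<xi>) 0))"

definition jet1 :: "('a, 'e::real_normed_vector) manifold \<Rightarrow> (real^'p \<Rightarrow> 'a) \<Rightarrow> (real^'p \<Rightarrow> 'a) set" where
  "jet1 N \<phi> = {\<xi>. smooth_param N \<xi> \<and> same_1jet N \<phi> \<xi>}"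

text \<open>Coordinates of a jet are computed from an arbitrary representative.\<close>

definition jet1_coord ::
  "('a \<Rightarrow> 'e::real_normed_vector) \<Rightarrow> (real^'p \<Rightarrow> 'a) set \<Rightarrow> 'e \<times> ('e^'p)"
where
  "jet1_coord x J =
     (let \<phi> = (SOME \<phi>. \<phi> \<in> J) in (x (\<phi> 0), \<chi> \<alpha>. partial (axis \<alpha> 1) (x \<circ> \<phi>) 0))"

definition J1 :: "('a, 'e::real_normed_vector) manifold \<Rightarrow> ((real^'p \<Rightarrow> 'a) set, 'e \<times> ('e^'p)) manifold"
where
  "J1 N =
     \<lparr>points = {jet1 N \<phi> | \<phi>. smooth_param N \<phi>},
      atlas = {({jet1 N \<phi> | \<phi>. smooth_param N \<phi> \<and> \<phi> 0 \<in> U}, jet1_coord x) | U x. (U, x) \<in> atlas N}\<rparr>"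

typedef (overloaded) ('u, 'e) sym_bilinear =
  "{B :: 'u::real_normed_vector \<Rightarrow>\<^sub>L 'u \<Rightarrow>\<^sub>L 'e::real_normed_vector. \<forall>v w. B v w = B w v}"
  by (rule exI[of _ 0]) simp

setup_lifting type_definition_sym_bilinear

instantiation sym_bilinear :: (real_normed_vector, real_normed_vector) real_vector
begin

lift_definition zero_sym_bilinear :: "('a, 'b) sym_bilinear" is 0
  by simp

lift_definition plus_sym_bilinear ::
  "('a, 'b) sym_bilinear \<Rightarrow> ('a, 'b) sym_bilinear \<Rightarrow> ('a, 'b) sym_bilinear" is "(+)"
  by (simp add: blinfun.add_left)

lift_definition minus_sym_bilinear ::
  "('a, 'b) sym_bilinear \<Rightarrow> ('a, 'b) sym_bilinear \<Rightarrow> ('a, 'b) sym_bilinear" is "(-)"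
  by (simp add: blinfun.diff_left)

lift_definition uminus_sym_bilinear :: "('a, 'b) sym_bilinear \<Rightarrow> ('a, 'b) sym_bilinear" is uminus
  by (simp add: blinfun.minus_left)

lift_definition scaleR_sym_bilinear ::
  "real \<Rightarrow> ('a, 'b) sym_bilinear \<Rightarrow> ('a, 'b) sym_bilinear" is "(*\<^sub>R)"
  by (simp add: blinfun.scaleR_left)

instance
  by standard (transfer, simp add: scaleR_add_left scaleR_add_right)+

end

instantiation sym_bilinear :: (real_normed_vector, real_normed_vector) real_normed_vector
begin

lift_definition norm_sym_bilinear :: "('a, 'b) sym_bilinear \<Rightarrow> real" is norm .

definition dist_sym_bilinear :: "('a, 'b) sym_bilinear \<Rightarrow> ('a, 'b) sym_bilinear \<Rightarrow> real" where
  "dist_sym_bilinear A B = norm (A - B)"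

definition sgn_sym_bilinear :: "('a, 'b) sym_bilinear \<Rightarrow> ('a, 'b) sym_bilinear" where
  "sgn_sym_bilinear A = A /\<^sub>R norm A"

definition uniformity_sym_bilinear :: "(('a, 'b) sym_bilinear \<times> ('a, 'b) sym_bilinear) filter" where
  "uniformity_sym_bilinear = (INF e\<in>{0<..}. principal {(A, B). dist A B < e})"

definition open_sym_bilinear :: "('a, 'b) sym_bilinear set \<Rightarrow> bool" where
  "open_sym_bilinear S \<longleftrightarrow> (\<forall>A\<in>S. \<forall>\<^sub>F (A', B) in uniformity. A' = A \<longrightarrow> B \<in> S)"

instance
proof
  fix A B :: "('a, 'b) sym_bilinear" and r :: real and S :: "('a, 'b) sym_bilinear set"
  show "dist A B = norm (A - B)" by (rule dist_sym_bilinear_def)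
  show "sgn A = A /\<^sub>R norm A" by (rule sgn_sym_bilinear_def)
  show "uniformity = (INF e\<in>{0<..}. principal {(A, B :: ('a, 'b) sym_bilinear). dist A B < e})"
    by (rule uniformity_sym_bilinear_def)
  show "open S \<longleftrightarrow> (\<forall>A\<in>S. \<forall>\<^sub>F (A', B) in uniformity. A' = A \<longrightarrow> B \<in> S)"
    by (rule open_sym_bilinear_def)
  show "norm A = 0 \<longleftrightarrow> A = 0" by transfer simp
  show "norm (A + B) \<le> norm A + norm B" by transfer (rule norm_triangle_ineq)
  show "norm (r *\<^sub>R A) = \<bar>r\<bar> * norm A" by transfer simp
qed

end

definition same_2jet ::
  "('a, 'e::real_normed_vector) manifold \<Rightarrow> ('u::euclidean_space \<Rightarrow> 'a) \<Rightarrow> ('u \<Rightarrow> 'a) \<Rightarrow> bool"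
where
  "same_2jet N \<phi> \<xi> \<longleftrightarrow>
     \<phi> 0 = \<xi> 0 \<and>
     (\<forall>(U, x)\<in>atlas N. \<phi> 0 \<in> U \<longrightarrow>
        (\<forall>i\<in>Basis. partial i (x \<circ> \<phi>) 0 = partial i (x \<circ> \<xi>) 0) \<and>
        (\<forall>i\<in>Basis. \<forall>j\<in>Basis.
           partial i (partial j (x \<circ> \<phi>)) 0 = partial i (partial j (x \<circ> \<xi>)) 0))"

definition jet2 :: "('a, 'e::real_normed_vector) manifold \<Rightarrow> ('u::euclidean_space \<Rightarrow> 'a) \<Rightarrow> ('u \<Rightarrow> 'a) set"
where
  "jet2 N \<phi> = {\<xi>. smooth_param N \<xi> \<and> same_2jet N \<phi> \<xi>}"

definition first_deriv ::
  "('u::real_normed_vector \<Rightarrow> 'e::real_normed_vector) \<Rightarrow> 'u \<Rightarrow> ('u \<Rightarrow>\<^sub>L 'e)"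
where
  "first_deriv f z = Blinfun (\<lambda>v. partial v f z)"

definition second_deriv ::
  "('u::real_normed_vector \<Rightarrow> 'e::real_normed_vector) \<Rightarrow> 'u \<Rightarrow> ('u, 'e) sym_bilinear"
where
  "second_deriv f z =
     Abs_sym_bilinear (Blinfun (\<lambda>v. Blinfun (\<lambda>w. partial v (partial w f) z)))"

definition jet2_coord ::
  "('a \<Rightarrow> 'e::real_normed_vector) \<Rightarrow> ('u::euclidean_space \<Rightarrow> 'a) set \<Rightarrow>
   'e \<times> ('u \<Rightarrow>\<^sub>L 'e) \<times> ('u, 'e) sym_bilinear"
where
  "jet2_coord x J =
     (let \<phi> = (SOME \<phi>. \<phi> \<in> J) in (x (\<phi> 0), first_deriv (x \<circ> \<phi>) 0, second_deriv (x \<circ> \<phi>) 0))"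

definition J2 ::
  "('a, 'e::real_normed_vector) manifold \<Rightarrow>
   (('u::euclidean_space \<Rightarrow> 'a) set, 'e \<times> ('u \<Rightarrow>\<^sub>L 'e) \<times> ('u, 'e) sym_bilinear) manifold"
where
  "J2 N =
     \<lparr>points = {jet2 N \<phi> | \<phi>. smooth_param N \<phi>},
      atlas = {({jet2 N \<phi> | \<phi>. smooth_param N \<phi> \<and> \<phi> 0 \<in> U}, jet2_coord x) | U x. (U, x) \<in> atlas N}\<rparr>"

definition partial_jet ::
  "('a, 'e::real_normed_vector) manifold \<Rightarrow> ((real^'p) \<times> (real^'p) \<Rightarrow> 'a) \<Rightarrow>
   real^'p \<Rightarrow> (real^'p \<Rightarrow> 'a) set"
where
  "partial_jet M \<phi> u = jet1 M (\<lambda>v. \<phi> (u, v))"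

end

theory Submission
  imports Defs
begin

text \<open>
  Fix a chart \<open>x\<close> of \<open>M\<close> around \<open>\<phi>(0,0)\<close> and write \<open>e\<close>, \<open>L\<close>, \<open>B\<close> for the value, the first and the
  second derivative of \<open>x \<circ> \<phi>\<close> at the origin. The coordinates of \<open>j\<^sup>1\<Phi>\<close> induced by \<open>x\<close> are \<open>e\<close>, the
  derivatives \<open>L(0,\<alpha>)\<close> of the slice \<open>\<phi>\<^sub>0\<close>, the derivatives \<open>L(\<beta>,0)\<close> of \<open>u \<mapsto> \<phi>(u,0)\<close> and the mixed
  second derivatives \<open>B((\<beta>,0),(0,\<alpha>))\<close> (\<open>jet1_at_0_partial_jet\<close>). So over a single chart of \<open>M\<close> the map
  \<open>\<Lambda>\<close> is the linear map \<open>iterated_coords\<close>, which forgets exactly the unmixed second derivatives. It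
  is surjective, because no symmetry relates the mixed derivatives to each other. In two different
  charts of \<open>M\<close> the representation of \<open>\<Lambda>\<close> is \<open>iterated_coords\<close> after a transition map of \<open>J2 M\<close>, which
  is a diffeomorphism; hence \<open>\<Lambda>\<close> is smooth with surjective differential everywhere. It is well
  defined because a 1-jet is determined by its coordinates in one chart, and surjective because
  every coordinate vector over a point of the chart belongs to a 2-jet.

  The remaining work is to see that the jet spaces are manifolds. The two orders are treated
  together: a \<open>jet_functor\<close> is a rule that assigns coordinates to maps near the origin, transforms
  under a change of coordinates of the target by a smooth prolongation of that change, and takes
  every value on maps with arbitrarily small image. The last property is needed since jets are
  represented by maps defined on the whole parameter space that have to stay inside a chart; it
  comes from damping a polynomial by a rational function
  (\<open>exists_small_map_with_derivatives\<close>). From these properties alone \<open>jet_bundle\<close> produces charts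
  with image \<open>x(U) \<times> fibre\<close>, smooth transition maps, and a Hausdorff second countable topology.
  For 2-jets the prolongation is the chain rule of second order, and symmetry of second derivatives
  (\<open>partial_commute\<close>) makes the second-order coordinate a symmetric bilinear map.

  The models are finite-dimensional normed spaces without a preferred basis. They enter the calculus
  only through a finite expansion \<open>x = \<Sum>\<^sub>b c\<^sub>b(x) b\<close> with bounded functionals \<open>c\<^sub>b\<close>
  (\<open>finite_dim_coordinates\<close>), which writes a derivative along a varying direction as a sum of products
  of smooth functions.
\<close>

section \<open>Finite-dimensional normed spaces\<close>

text \<open>
  Compactness is available for the coefficients, which are real numbers, and carries over to their
  linear combinations by continuity.
\<close>

lemma compact_coefficient_box:
  fixes B :: "'e::real_normed_vector set"
  assumes "finite B"
  shows "compact {\<Sum>b\<in>B. u b *\<^sub>R b | u. \<forall>b\<in>B. \<bar>u b\<bar> \<le> R}"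
  using assms
proof (induction B)
  case empty
  then show ?case by simp
next
  case (insert a B)
  let ?K = "{\<Sum>b\<in>B. u b *\<^sub>R b | u. \<forall>b\<in>B. \<bar>u b\<bar> \<le> R}"
  let ?L = "(\<lambda>t. t *\<^sub>R a) ` {-R..R}"
  have "compact ?L"
    by (intro compact_continuous_image continuous_intros compact_Icc)
  then have "compact {x + y | x y. x \<in> ?L \<and> y \<in> ?K}"
    by (rule compact_sums) (rule insert.IH)
  moreover have "{\<Sum>b\<in>insert a B. u b *\<^sub>R b | u. \<forall>b\<in>insert a B. \<bar>u b\<bar> \<le> R} = {x + y | x y. x \<in> ?L \<and> y \<in> ?K}"
    (is "?A = ?C")
  proof
    show "?A \<subseteq> ?C"
    proof
      fix x assume "x \<in> ?A"
      then obtain u where u: "x = (\<Sum>b\<in>insert a B. u b *\<^sub>R b)" "\<forall>b\<in>insert a B. \<bar>u b\<bar> \<le> R" by blast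
      have "x = u a *\<^sub>R a + (\<Sum>b\<in>B. u b *\<^sub>R b)" using u insert.hyps by simp
      moreover have "u a *\<^sub>R a \<in> ?L" using u by (auto simp: abs_le_iff)
      moreover have "(\<Sum>b\<in>B. u b *\<^sub>R b) \<in> ?K" using u by blast
      ultimately show "x \<in> ?C" by blast
    qed
    show "?C \<subseteq> ?A"
    proof
      fix x assume "x \<in> ?C"
      then obtain t u where u: "x = t *\<^sub>R a + (\<Sum>b\<in>B. u b *\<^sub>R b)" "t \<in> {-R..R}" "\<forall>b\<in>B. \<bar>u b\<bar> \<le> R"
        by blast
      have "x = (\<Sum>b\<in>insert a B. (u(a := t)) b *\<^sub>R b)"
        using u insert.hyps by (auto simp: intro!: sum.cong)
      moreover have "\<forall>b\<in>insert a B. \<bar>(u(a := t)) b\<bar> \<le> R" using u by auto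
      ultimately show "x \<in> ?A" by blast
    qed
  qed
  ultimately show ?case by simp
qed

text \<open>
  Equivalence of norms on the span of \<open>B\<close>. In the induction step the new vector \<open>a\<close> has positive
  distance from the span of the old ones: by the induction hypothesis the vectors of this span
  within distance \<open>1\<close> of \<open>a\<close> have bounded coefficients, hence lie in a compact set, which misses \<open>a\<close>.
  The distance bounds the coefficient of \<open>a\<close>, and then the others by the induction hypothesis.
\<close>

lemma independent_coefficients_bound:
  fixes B :: "'e::real_normed_vector set"
  assumes "finite B" "independent B"
  shows "\<exists>C>0. \<forall>u. (\<Sum>b\<in>B. \<bar>u b\<bar>) \<le> C * norm (\<Sum>b\<in>B. u b *\<^sub>R b)"
  using assms
proof (induction B)
  case empty
  then show ?case by (auto intro: exI[of _ 1])
next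
  case (insert a B)
  then have "independent B" and a: "a \<notin> span B"
    by (auto simp: independent_insert)
  then obtain C where C: "C > 0" "\<And>u. (\<Sum>b\<in>B. \<bar>u b\<bar>) \<le> C * norm (\<Sum>b\<in>B. u b *\<^sub>R b)"
    using insert.IH by blast
  define R where "R = C * (norm a + 1)"
  define K where "K = {\<Sum>b\<in>B. u b *\<^sub>R b | u. \<forall>b\<in>B. \<bar>u b\<bar> \<le> R}"
  have "closed K"
    unfolding K_def by (intro compact_imp_closed compact_coefficient_box insert.hyps)
  have "K \<subseteq> span B" unfolding K_def by (auto intro: span_sum span_scale span_base)
  with a have "a \<notin> K" by blast
  with \<open>closed K\<close> obtain d0 where d0: "d0 > 0" "ball a d0 \<subseteq> - K"
    using openE[of "- K" a] by blast
  define d where "d = min d0 1"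
  have "d > 0" using d0 by (simp add: d_def)
  \<comment> \<open>The positive distance of \<open>a\<close> from the span of \<open>B\<close>.\<close>
  have dist_span: "d \<le> norm (a + (\<Sum>b\<in>B. u b *\<^sub>R b))" for u
  proof (rule ccontr)
    assume "\<not> ?thesis"
    then have n: "norm (a + (\<Sum>b\<in>B. u b *\<^sub>R b)) < d" by simp
    define s where "s = (\<Sum>b\<in>B. (- u b) *\<^sub>R b)"
    have s: "s = - (\<Sum>b\<in>B. u b *\<^sub>R b)" unfolding s_def by (simp add: sum_negf)
    have n': "norm (a - s) < d" using n s by simp
    have "norm s \<le> norm a + norm (a - s)" by (metis norm_minus_commute norm_triangle_sub)
    then have "norm s \<le> norm a + 1" using n' by (simp add: d_def)
    moreover have "\<bar>- u b\<bar> \<le> C * norm s" if "b \<in> B" for b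
    proof -
      have "\<bar>- u b\<bar> \<le> (\<Sum>b\<in>B. \<bar>- u b\<bar>)"
        using that insert.hyps(1) by (intro member_le_sum) auto
      also have "\<dots> \<le> C * norm s" unfolding s_def by (rule C(2))
      finally show ?thesis .
    qed
    ultimately have "\<forall>b\<in>B. \<bar>- u b\<bar> \<le> R"
      unfolding R_def using C(1) by (meson mult_left_mono less_imp_le order_trans)
    then have "s \<in> K" unfolding K_def s_def by (intro CollectI exI[of _ "\<lambda>b. - u b"] conjI refl)
    then have "s \<notin> ball a d0" using d0 by blast
    then have "d0 \<le> norm (a - s)" by (simp add: dist_norm)
    then show False using n' by (simp add: d_def)
  qed
  have bound: "\<bar>t\<bar> * d \<le> norm (t *\<^sub>R a + (\<Sum>b\<in>B. u b *\<^sub>R b))" for t u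
  proof (cases "t = 0")
    case False
    have "t *\<^sub>R a + (\<Sum>b\<in>B. u b *\<^sub>R b) = t *\<^sub>R (a + (\<Sum>b\<in>B. (u b / t) *\<^sub>R b))"
      using False by (simp add: scaleR_add_right scaleR_sum_right)
    then have "norm (t *\<^sub>R a + (\<Sum>b\<in>B. u b *\<^sub>R b)) = \<bar>t\<bar> * norm (a + (\<Sum>b\<in>B. (u b / t) *\<^sub>R b))"
      by simp
    then show ?thesis using dist_span[of "\<lambda>b. u b / t"] by (simp add: mult_left_mono)
  qed simp
  define C' where "C' = 1 / d + C * (1 + norm a / d)"
  have "C' > 0" unfolding C'_def using C(1) \<open>d > 0\<close> by (simp add: add_pos_nonneg)
  moreover have "(\<Sum>b\<in>insert a B. \<bar>u b\<bar>) \<le> C' * norm (\<Sum>b\<in>insert a B. u b *\<^sub>R b)" for u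
  proof -
    define n where "n = norm (\<Sum>b\<in>insert a B. u b *\<^sub>R b)"
    have n: "n = norm (u a *\<^sub>R a + (\<Sum>b\<in>B. u b *\<^sub>R b))" using insert.hyps by (simp add: n_def)
    have ua: "\<bar>u a\<bar> \<le> n / d" using bound[of "u a" u] \<open>d > 0\<close> n by (simp add: field_simps)
    have "norm (\<Sum>b\<in>B. u b *\<^sub>R b) \<le> n + \<bar>u a\<bar> * norm a"
      using norm_triangle_ineq4[of "u a *\<^sub>R a + (\<Sum>b\<in>B. u b *\<^sub>R b)" "u a *\<^sub>R a"] n by simp
    also have "\<dots> \<le> n + n / d * norm a"
      using mult_right_mono[OF ua norm_ge_zero[of a]] by simp
    finally have "(\<Sum>b\<in>B. \<bar>u b\<bar>) \<le> C * (n + n / d * norm a)"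
      using C by (meson mult_left_mono less_imp_le order_trans)
    then have "(\<Sum>b\<in>insert a B. \<bar>u b\<bar>) \<le> n / d + C * (n + n / d * norm a)"
      using insert.hyps ua by simp
    also have "\<dots> = C' * n" by (simp add: C'_def algebra_simps)
    finally show ?thesis by (simp add: n_def)
  qed
  ultimately show ?case by blast
qed

lemma finite_dim_coordinates:
  assumes "finite_dim TYPE('e::real_normed_vector)"
  obtains B :: "'e::real_normed_vector set" and c :: "'e::real_normed_vector \<Rightarrow> 'e::real_normed_vector \<Rightarrow> real"
  where "finite B" "\<And>b. bounded_linear (c b)" "\<And>x. (\<Sum>b\<in>B. c b x *\<^sub>R b) = x"
proof -
  obtain B0 :: "'e set" where B0: "finite B0" "span B0 = UNIV"
    using assms unfolding finite_dim_def by blast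
  obtain B where B: "B \<subseteq> B0" "independent B" "B0 \<subseteq> span B"
    using maximal_independent_subset[of B0] by blast
  have fin: "finite B" using B(1) B0(1) finite_subset by blast
  have sp: "span B = UNIV" using B0(2) B(3) by (metis span_eq_iff span_mono subspace_span top.extremum_unique)
  define c where "c b x = representation B x b" for b x
  have sum: "(\<Sum>b\<in>B. c b x *\<^sub>R b) = x" for x
    unfolding c_def using B(2) fin sp by (subst sum_representation_eq) auto
  obtain C where C: "C > 0" "\<And>u. (\<Sum>b\<in>B. \<bar>u b\<bar>) \<le> C * norm (\<Sum>b\<in>B. u b *\<^sub>R b)"
    using independent_coefficients_bound[OF fin B(2)] by blast
  have "bounded_linear (c b)" for b
  proof (rule bounded_linear_intro[of _ C])
    show "c b (x + y) = c b x + c b y" for x y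
      unfolding c_def using sp by (simp add: representation_add[OF B(2)])
    show "c b (r *\<^sub>R x) = r *\<^sub>R c b x" for r x
      unfolding c_def using sp by (simp add: representation_scale[OF B(2)])
    show "norm (c b x) \<le> norm x * C" for x
    proof (cases "b \<in> B")
      case True
      then have "\<bar>c b x\<bar> \<le> (\<Sum>b\<in>B. \<bar>c b x\<bar>)" using fin by (intro member_le_sum) auto
      also have "\<dots> \<le> C * norm x" using C(2)[of "\<lambda>b. c b x"] sum[of x] by simp
      finally show ?thesis by (simp add: mult.commute)
    next
      case False
      then have "c b x = 0" unfolding c_def using representation_ne_zero by blast
      then show ?thesis using C(1) by simp
    qed
  qed
  then show ?thesis using that fin sum by blast
qed

lemma finite_dimI:
  fixes e :: "'i \<Rightarrow> 'e::real_normed_vector"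
  assumes "finite I" "\<And>x. \<exists>c. x = (\<Sum>i\<in>I. c i *\<^sub>R e i)"
  shows "finite_dim TYPE('e)"
  unfolding finite_dim_def
proof (intro exI conjI)
  show "finite (e ` I)" using assms(1) by simp
  have "x \<in> span (e ` I)" for x
    using assms(2)[of x] by (auto intro: span_sum span_scale span_base)
  then show "span (e ` I) = UNIV" by blast
qed

lemma finite_dim_linear_bounded:
  fixes f :: "'e::real_normed_vector \<Rightarrow> 'f::real_normed_vector"
  assumes "finite_dim TYPE('e)" "linear f"
  shows "bounded_linear f"
proof -
  obtain B :: "'e set" and c where B: "finite B" "\<And>b. bounded_linear (c b)" "\<And>x. (\<Sum>b\<in>B. c b x *\<^sub>R b) = x"
    using finite_dim_coordinates[OF assms(1)] by blast
  have "f = (\<lambda>x. \<Sum>b\<in>B. c b x *\<^sub>R f b)"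
  proof
    fix x
    have "f x = f (\<Sum>b\<in>B. c b x *\<^sub>R b)" by (simp only: B(3))
    also have "\<dots> = (\<Sum>b\<in>B. c b x *\<^sub>R f b)"
      by (simp add: linear_sum[OF assms(2)] linear_scale[OF assms(2)])
    finally show "f x = (\<Sum>b\<in>B. c b x *\<^sub>R f b)" .
  qed
  moreover have "bounded_linear (\<lambda>x. \<Sum>b\<in>B. c b x *\<^sub>R f b)"
    by (intro bounded_linear_sum bounded_linear_compose[OF bounded_linear_scaleR_left] B)
  ultimately show ?thesis by simp
qed

text \<open>
  The base consists of the balls of rational radius around rational combinations of a basis.
\<close>

lemma finite_dim_countable_basis:
  assumes "finite_dim TYPE('e::real_normed_vector)"
  obtains \<D> :: "'e::real_normed_vector set set" where "countable \<D>" "\<And>D. D \<in> \<D> \<Longrightarrow> open D"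
    "\<And>S x. open S \<Longrightarrow> x \<in> S \<Longrightarrow> \<exists>D\<in>\<D>. x \<in> D \<and> D \<subseteq> S"
proof -
  obtain B :: "'e set" and c where B: "finite B" "\<And>b. bounded_linear (c b)" "\<And>x. (\<Sum>b\<in>B. c b x *\<^sub>R b) = x"
    using finite_dim_coordinates[OF assms] by blast
  define Q where "Q = (\<lambda>q. \<Sum>b\<in>B. q b *\<^sub>R b) ` (PiE B (\<lambda>_. \<rat>))"
  have "countable Q"
    unfolding Q_def by (intro countable_image countable_PiE B countable_rat)
  have dense: "\<exists>q\<in>Q. dist q x < \<epsilon>" if "\<epsilon> > 0" for x \<epsilon>
  proof -
    define \<delta> where "\<delta> = \<epsilon> / (1 + (\<Sum>b\<in>B. norm b))"
    have S: "(\<Sum>b\<in>B. norm b) \<ge> 0" by (simp add: sum_nonneg)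
    have "\<delta> > 0" using that S by (simp add: \<delta>_def)
    have "\<exists>q. q \<in> \<rat> \<and> \<bar>q - c b x\<bar> < \<delta>" for b
    proof -
      obtain q where "q \<in> \<rat>" "c b x < q" "q < c b x + \<delta>"
        using Rats_dense_in_real[of "c b x" "c b x + \<delta>"] \<open>\<delta> > 0\<close> by auto
      then show ?thesis by (intro exI[of _ q]) auto
    qed
    then obtain q where q: "\<And>b. q b \<in> \<rat>" "\<And>b. \<bar>q b - c b x\<bar> < \<delta>" by metis
    define y where "y = (\<Sum>b\<in>B. (restrict q B) b *\<^sub>R b)"
    have "y \<in> Q" unfolding Q_def y_def using q(1) by (intro imageI) auto
    have y: "y = (\<Sum>b\<in>B. q b *\<^sub>R b)" unfolding y_def by (intro sum.cong) auto
    have "y - x = (\<Sum>b\<in>B. (q b - c b x) *\<^sub>R b)"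
      by (simp add: y scaleR_diff_left sum_subtractf B(3))
    then have "norm (y - x) \<le> (\<Sum>b\<in>B. norm ((q b - c b x) *\<^sub>R b))"
      by (simp only: norm_sum)
    also have "\<dots> \<le> (\<Sum>b\<in>B. \<delta> * norm b)"
      using q(2) by (intro sum_mono) (simp add: mult_right_mono less_imp_le)
    also have "\<dots> = \<delta> * (\<Sum>b\<in>B. norm b)" by (simp add: sum_distrib_left)
    also have "\<dots> < \<delta> * (1 + (\<Sum>b\<in>B. norm b))" using \<open>\<delta> > 0\<close> by simp
    also have "\<dots> = \<epsilon>" unfolding \<delta>_def using S by simp
    finally show ?thesis using \<open>y \<in> Q\<close> by (auto simp: dist_norm)
  qed
  define \<D> where "\<D> = (\<lambda>(q, r). ball q r) ` (Q \<times> \<rat>)"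
  show ?thesis
  proof
    show "countable \<D>"
      unfolding \<D>_def using \<open>countable Q\<close> countable_rat by (intro countable_image countable_SIGMA) auto
    show "open D" if "D \<in> \<D>" for D using that by (auto simp: \<D>_def)
    fix S :: "'e set" and x assume "open S" "x \<in> S"
    then obtain \<epsilon> where \<epsilon>: "\<epsilon> > 0" "ball x \<epsilon> \<subseteq> S" by (meson openE)
    obtain r where r: "r \<in> \<rat>" "0 < r" "r < \<epsilon> / 2" using Rats_dense_in_real[of 0 "\<epsilon>/2"] \<epsilon> by auto
    obtain q where q: "q \<in> Q" "dist q x < r" using dense[OF r(2)] by blast
    have "ball q r \<subseteq> ball x \<epsilon>"
    proof
      fix y assume "y \<in> ball q r"
      then show "y \<in> ball x \<epsilon>"
        using q(2) r(3) dist_triangle[of x y q] by (simp add: dist_commute)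
    qed
    then show "\<exists>D\<in>\<D>. x \<in> D \<and> D \<subseteq> S"
      using q r \<epsilon> by (intro bexI[of _ "ball q r"]) (auto simp: \<D>_def)
  qed
qed

lemma finite_dim_euclidean: "finite_dim TYPE('u::euclidean_space)"
  unfolding finite_dim_def by (intro exI[of _ Basis]) auto

lemma finite_dim_prod:
  assumes "finite_dim TYPE('e::real_normed_vector)" "finite_dim TYPE('f::real_normed_vector)"
  shows "finite_dim TYPE('e \<times> 'f)"
proof -
  obtain B :: "'e set" and c where B: "finite B" "\<And>x. (\<Sum>b\<in>B. c b x *\<^sub>R b) = x"
    using finite_dim_coordinates[OF assms(1)] by metis
  obtain D :: "'f set" and d where D: "finite D" "\<And>x. (\<Sum>b\<in>D. d b x *\<^sub>R b) = x"
    using finite_dim_coordinates[OF assms(2)] by metis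
  show ?thesis
  proof (rule finite_dimI[of "B <+> D" "case_sum (\<lambda>b. (b, 0)) (\<lambda>b. (0, b))"])
    show "finite (B <+> D)" using B D by simp
    fix x :: "'e \<times> 'f"
    have "x = (\<Sum>b\<in>B. c b (fst x) *\<^sub>R (b, 0)) + (\<Sum>b\<in>D. d b (snd x) *\<^sub>R (0, b))"
      by (simp add: prod_eq_iff fst_sum snd_sum B(2) D(2))
    then show "\<exists>k. x = (\<Sum>i\<in>B <+> D. k i *\<^sub>R (case_sum (\<lambda>b. (b, 0)) (\<lambda>b. (0, b)) i))"
      using B(1) D(1)
      by (intro exI[of _ "case_sum (\<lambda>b. c b (fst x)) (\<lambda>b. d b (snd x))"]) (simp add: sum.Plus)
  qed
qed

lemma sum_axis: "(\<Sum>\<alpha>\<in>UNIV. axis \<alpha> (w $ \<alpha>)) = w" for w :: "'e::real_normed_vector ^ 'p"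
  by (simp add: vec_eq_iff axis_def if_distrib cong: if_cong)

lemma linear_axis: "linear (axis \<alpha> :: 'e::real_normed_vector \<Rightarrow> 'e ^ 'p)"
  by (rule linearI) (auto simp: vec_eq_iff axis_def)

text \<open>
  Covers all the spaces of coefficients below: families, linear maps and symmetric bilinear maps are
  sums of ``matrix units'' with coefficients in the target space.
\<close>

lemma finite_dim_if_sum_of_images:
  fixes T :: "'i \<Rightarrow> 'e::real_normed_vector \<Rightarrow> 'x::real_normed_vector"
  assumes "finite_dim TYPE('e)" "finite I" "\<And>i. linear (T i)" "\<And>X. \<exists>x. (\<Sum>i\<in>I. T i (x i)) = X"
  shows "finite_dim TYPE('x)"
proof -
  obtain B :: "'e set" and c where B: "finite B" "\<And>x. (\<Sum>b\<in>B. c b x *\<^sub>R b) = x"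
    using finite_dim_coordinates[OF assms(1)] by metis
  show ?thesis
  proof (rule finite_dimI[of "I \<times> B" "\<lambda>(i, b). T i b"])
    show "finite (I \<times> B)" using assms(2) B by simp
    fix X :: 'x
    obtain x where x: "(\<Sum>i\<in>I. T i (x i)) = X" using assms(4) by blast
    have "X = (\<Sum>i\<in>I. T i (\<Sum>b\<in>B. c b (x i) *\<^sub>R b))" by (simp only: B(2) x)
    also have "\<dots> = (\<Sum>i\<in>I. \<Sum>b\<in>B. c b (x i) *\<^sub>R T i b)"
      by (simp add: linear_sum[OF assms(3)] linear_scale[OF assms(3)])
    finally show "\<exists>k. X = (\<Sum>p\<in>I \<times> B. k p *\<^sub>R (case p of (i, b) \<Rightarrow> T i b))"
      by (intro exI[of _ "\<lambda>(i, b). c b (x i)"]) (simp add: sum.cartesian_product case_prod_unfold)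
  qed
qed

lemma finite_dim_vec:
  assumes "finite_dim TYPE('e::real_normed_vector)"
  shows "finite_dim TYPE('e ^ 'p)"
  by (rule finite_dim_if_sum_of_images[where I = UNIV and T = axis, OF assms finite linear_axis])
     (rule exI, rule sum_axis)

section \<open>Calculus of smooth maps\<close>

lemma partial_has_derivative:
  "f differentiable (at z) \<Longrightarrow> (f has_derivative (\<lambda>v. partial v f z)) (at z)"
  unfolding partial_def by (simp add: frechet_derivative_works)

lemma partial_eqI: "(f has_derivative D) (at z) \<Longrightarrow> partial v f z = D v"
  unfolding partial_def using frechet_derivative_at by metis

lemma linear_partial: "f differentiable (at z) \<Longrightarrow> linear (\<lambda>v. partial v f z)"
  unfolding partial_def by (simp add: linear_frechet_derivative)

text \<open>
  Coordinate representations are meaningful only on open subsets of the model; the local congruences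
  allow them to be replaced there by explicit formulas.
\<close>

lemma has_derivative_cong_open:
  assumes "open S" "z \<in> S" "\<And>x. x \<in> S \<Longrightarrow> f x = g x"
  shows "(f has_derivative D) (at z) \<longleftrightarrow> (g has_derivative D) (at z)"
  using assms by (metis has_derivative_transform_within_open)

lemma partial_cong_open:
  assumes "open S" "z \<in> S" "\<And>x. x \<in> S \<Longrightarrow> f x = g x"
  shows "partial v f z = partial v g z"
  unfolding partial_def frechet_derivative_def
  using has_derivative_cong_open[OF assms] by simp

lemma differentiable_cong_open:
  assumes "open S" "z \<in> S" "\<And>x. x \<in> S \<Longrightarrow> f x = g x"
  shows "f differentiable (at z) \<longleftrightarrow> g differentiable (at z)"
  unfolding differentiable_def using has_derivative_cong_open[OF assms] by simp

lemma Ck_on_cong: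
  assumes "open S" "\<And>x. x \<in> S \<Longrightarrow> f x = g x"
  shows "Ck_on k S f \<longleftrightarrow> Ck_on k S g"
  using assms(2)
proof (induction k arbitrary: f g)
  case 0
  then show ?case by (auto cong: continuous_on_cong)
next
  case (Suc k)
  have "Ck_on k S (partial v f) \<longleftrightarrow> Ck_on k S (partial v g)" for v
    by (rule Suc.IH) (rule partial_cong_open[OF assms(1) _ Suc.prems])
  moreover have "f differentiable (at z) \<longleftrightarrow> g differentiable (at z)" if "z \<in> S" for z
    by (rule differentiable_cong_open[OF assms(1) that Suc.prems])
  ultimately show ?case by simp
qed

lemma Ck_on_subset: "Ck_on k S f \<Longrightarrow> T \<subseteq> S \<Longrightarrow> Ck_on k T f"
  by (induction k arbitrary: f) (auto intro: continuous_on_subset)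

lemma Ck_on_Suc_imp: "Ck_on (Suc k) S f \<Longrightarrow> Ck_on k S f"
proof (induction k arbitrary: f)
  case 0
  then show ?case
    by (auto intro!: continuous_at_imp_continuous_on differentiable_imp_continuous_within)
next
  case (Suc k)
  then show ?case by (metis Ck_on.simps(2))
qed

lemma Ck_on_const: "Ck_on k S (\<lambda>_. c)"
proof (induction k arbitrary: c)
  case (Suc k)
  have "partial v (\<lambda>_. c) = (\<lambda>_. 0)" for v :: 'a by (simp add: partial_def fun_eq_iff)
  then show ?case using Suc by simp
qed simp

lemma partial_bounded_linear:
  assumes "bounded_linear T" "f differentiable (at z)"
  shows "partial v (\<lambda>z. T (f z)) z = T (partial v f z)"
  by (rule partial_eqI) (rule bounded_linear.has_derivative[OF assms(1) partial_has_derivative[OF assms(2)]])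

lemma partial_bilinear:
  assumes "bounded_bilinear P" "f differentiable (at z)" "g differentiable (at z)"
  shows "partial v (\<lambda>z. P (f z) (g z)) z = P (f z) (partial v g z) + P (partial v f z) (g z)"
  by (rule partial_eqI)
     (rule bounded_bilinear.FDERIV[OF assms(1) partial_has_derivative[OF assms(2)] partial_has_derivative[OF assms(3)]])

lemma partial_add:
  assumes "f differentiable (at z)" "g differentiable (at z)"
  shows "partial v (\<lambda>z. f z + g z) z = partial v f z + partial v g z"
  by (rule partial_eqI) (intro has_derivative_add partial_has_derivative assms)

lemma partial_sum:
  assumes "\<And>i. i \<in> I \<Longrightarrow> f i differentiable (at z)"
  shows "partial v (\<lambda>z. \<Sum>i\<in>I. f i z) z = (\<Sum>i\<in>I. partial v (f i) z)"
  by (rule partial_eqI) (intro has_derivative_sum partial_has_derivative assms)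

lemma partial_compose:
  assumes "f differentiable (at z)" "g differentiable (at (f z))"
  shows "partial v (\<lambda>z. g (f z)) z = partial (partial v f z) g (f z)"
  by (rule partial_eqI)
     (rule has_derivative_compose[OF partial_has_derivative[OF assms(1)] partial_has_derivative[OF assms(2)]])

lemma differentiable_bounded_linear:
  "bounded_linear T \<Longrightarrow> f differentiable (at z) \<Longrightarrow> (\<lambda>z. T (f z)) differentiable (at z)"
  by (rule differentiableI[OF bounded_linear.has_derivative[OF _ partial_has_derivative]])

lemma differentiable_bilinear:
  "bounded_bilinear P \<Longrightarrow> f differentiable (at z) \<Longrightarrow> g differentiable (at z) \<Longrightarrow>
   (\<lambda>z. P (f z) (g z)) differentiable (at z)"
  by (rule differentiableI[OF bounded_bilinear.FDERIV[OF _ partial_has_derivative partial_has_derivative]])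

lemma differentiable_compose:
  "f differentiable (at z) \<Longrightarrow> g differentiable (at (f z)) \<Longrightarrow> (\<lambda>z. g (f z)) differentiable (at z)"
  by (rule differentiableI[OF has_derivative_compose[OF partial_has_derivative partial_has_derivative]])

lemma Ck_on_bounded_linear:
  assumes "bounded_linear T" "open S"
  shows "Ck_on k S f \<Longrightarrow> Ck_on k S (\<lambda>z. T (f z))"
proof (induction k arbitrary: f)
  case 0
  then show ?case using assms(1) by (auto intro: bounded_linear.continuous_on)
next
  case (Suc k)
  have "Ck_on k S (partial v (\<lambda>z. T (f z)))" for v
  proof (subst Ck_on_cong[OF assms(2)])
    show "partial v (\<lambda>z. T (f z)) z = T (partial v f z)" if "z \<in> S" for z
      using that Suc.prems by (simp add: partial_bounded_linear[OF assms(1)])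
    show "Ck_on k S (\<lambda>z. T (partial v f z))"
      using Suc.prems by (intro Suc.IH) auto
  qed
  then show ?case using Suc.prems by (auto intro: differentiable_bounded_linear[OF assms(1)])
qed

lemma Ck_on_add:
  assumes "open S"
  shows "Ck_on k S f \<Longrightarrow> Ck_on k S g \<Longrightarrow> Ck_on k S (\<lambda>z. f z + g z)"
proof (induction k arbitrary: f g)
  case 0
  then show ?case by (auto intro: continuous_on_add)
next
  case (Suc k)
  have "Ck_on k S (partial v (\<lambda>z. f z + g z))" for v
  proof (subst Ck_on_cong[OF assms])
    show "partial v (\<lambda>z. f z + g z) z = partial v f z + partial v g z" if "z \<in> S" for z
      using that Suc.prems by (simp add: partial_add)
    show "Ck_on k S (\<lambda>z. partial v f z + partial v g z)"
      using Suc.prems by (intro Suc.IH) auto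
  qed
  then show ?case using Suc.prems by auto
qed

lemma Ck_on_bilinear:
  assumes "bounded_bilinear P" "open S"
  shows "Ck_on k S f \<Longrightarrow> Ck_on k S g \<Longrightarrow> Ck_on k S (\<lambda>z. P (f z) (g z))"
proof (induction k arbitrary: f g)
  case 0
  then show ?case using bounded_bilinear.continuous_on[OF assms(1)] by simp
next
  case (Suc k)
  have fg: "Ck_on k S f" "Ck_on k S g" using Suc.prems Ck_on_Suc_imp by blast+
  have "Ck_on k S (partial v (\<lambda>z. P (f z) (g z)))" for v
  proof (subst Ck_on_cong[OF assms(2)])
    show "partial v (\<lambda>z. P (f z) (g z)) z = P (f z) (partial v g z) + P (partial v f z) (g z)" if "z \<in> S" for z
      using that Suc.prems by (simp add: partial_bilinear[OF assms(1)])
    show "Ck_on k S (\<lambda>z. P (f z) (partial v g z) + P (partial v f z) (g z))"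
      using Suc.prems fg by (intro Ck_on_add[OF assms(2)] Suc.IH) auto
  qed
  then show ?case using Suc.prems by (auto intro: differentiable_bilinear[OF assms(1)])
qed

lemma Ck_on_sum:
  assumes "open S" "\<And>i. i \<in> I \<Longrightarrow> Ck_on k S (f i)"
  shows "Ck_on k S (\<lambda>z. \<Sum>i\<in>I. f i z)"
  using assms(2) by (induction I rule: infinite_finite_induct) (auto intro: Ck_on_const Ck_on_add[OF assms(1)])

lemma Ck_on_inverse:
  fixes f :: "'u::real_normed_vector \<Rightarrow> real"
  assumes "open S" "\<And>z. z \<in> S \<Longrightarrow> f z \<noteq> 0"
  shows "Ck_on k S f \<Longrightarrow> Ck_on k S (\<lambda>z. inverse (f z))"
proof (induction k)
  case 0
  then show ?case using assms by (auto intro: continuous_on_inverse)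
next
  case (Suc k)
  have D: "((\<lambda>z. inverse (f z)) has_derivative (\<lambda>v. - (inverse (f z) * partial v f z * inverse (f z)))) (at z)"
    if "z \<in> S" for z
    using that Suc.prems assms by (intro Deriv.has_derivative_inverse partial_has_derivative) auto
  have "Ck_on k S (partial v (\<lambda>z. inverse (f z)))" for v
  proof (subst Ck_on_cong[OF assms(1)])
    show "partial v (\<lambda>z. inverse (f z)) z = - (inverse (f z) * partial v f z * inverse (f z))" if "z \<in> S" for z
      by (rule partial_eqI[OF D[OF that]])
    show "Ck_on k S (\<lambda>z. - (inverse (f z) * partial v f z * inverse (f z)))"
      using Suc.prems Suc.IH[OF Ck_on_Suc_imp[OF Suc.prems]]
      by (intro Ck_on_bounded_linear[OF bounded_linear_minus[OF bounded_linear_ident] assms(1)]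
          Ck_on_bilinear[OF bounded_bilinear_mult assms(1)]) auto
  qed
  then show ?case using D by (auto simp: differentiable_def)
qed

text \<open>
  Expanding the direction in a basis leaves only derivatives along fixed directions, the ones that
  the definition of \<open>Ck_on\<close> speaks about.
\<close>

lemma partial_coordinates:
  assumes "(\<Sum>b\<in>B. c b w *\<^sub>R b) = w" "f differentiable (at z)"
  shows "partial w f z = (\<Sum>b\<in>B. c b w *\<^sub>R partial b f z)"
proof -
  have "partial w f z = partial (\<Sum>b\<in>B. c b w *\<^sub>R b) f z" using assms(1) by simp
  also have "\<dots> = (\<Sum>b\<in>B. c b w *\<^sub>R partial b f z)"
    by (simp add: linear_sum[OF linear_partial[OF assms(2)]] linear_scale[OF linear_partial[OF assms(2)]])
  finally show ?thesis .
qed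

text \<open>
  The chain rule expresses a directional derivative of \<open>g \<circ> f\<close> by the derivative of \<open>g\<close> along the
  varying direction \<open>partial v f z\<close>. After expanding this direction in a basis of the middle space, the
  result is a sum of products of \<open>C\<^sup>k\<close> functions, and the induction hypothesis applies to the
  derivatives of \<open>g\<close> along basis vectors.
\<close>

lemma Ck_on_compose:
  fixes f :: "'u::real_normed_vector \<Rightarrow> 'v::real_normed_vector" and g :: "'v \<Rightarrow> 'w::real_normed_vector"
  assumes "finite_dim TYPE('v)" "open S" "open T" "f ` S \<subseteq> T"
  shows "Ck_on k S f \<Longrightarrow> Ck_on k T g \<Longrightarrow> Ck_on k S (\<lambda>z. g (f z))"
proof (induction k arbitrary: g)
  case 0
  then show ?case using assms(4) by (auto intro: continuous_on_compose2)
next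
  case (Suc k)
  obtain B :: "'v set" and c where B: "finite B" "\<And>b. bounded_linear (c b)" "\<And>x. (\<Sum>b\<in>B. c b x *\<^sub>R b) = x"
    using finite_dim_coordinates[OF assms(1)] by blast
  have df: "f differentiable (at z)" "g differentiable (at (f z))" if "z \<in> S" for z
    using that Suc.prems assms(4) by auto
  have "Ck_on k S (partial v (\<lambda>z. g (f z)))" for v
  proof (subst Ck_on_cong[OF assms(2)])
    show "partial v (\<lambda>z. g (f z)) z = (\<Sum>b\<in>B. c b (partial v f z) *\<^sub>R partial b g (f z))" if "z \<in> S" for z
      by (rule trans[OF partial_compose[OF df[OF that]] partial_coordinates[where B=B and c=c, OF B(3) df(2)[OF that]]])
    show "Ck_on k S (\<lambda>z. \<Sum>b\<in>B. c b (partial v f z) *\<^sub>R partial b g (f z))"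
    proof (rule Ck_on_sum[OF assms(2)], rule Ck_on_bilinear[OF bounded_bilinear_scaleR assms(2)])
      fix b
      show "Ck_on k S (\<lambda>z. c b (partial v f z))"
        using Suc.prems by (intro Ck_on_bounded_linear[OF B(2) assms(2)]) simp
      show "Ck_on k S (\<lambda>z. partial b g (f z))"
        using Suc.prems(2) by (intro Suc.IH Ck_on_Suc_imp[OF Suc.prems(1)]) simp
    qed
  qed
  moreover have "(\<lambda>z. g (f z)) differentiable (at z)" if "z \<in> S" for z
    by (rule differentiable_compose[OF df[OF that]])
  ultimately show ?case by simp
qed

lemma smooth_on_cong:
  assumes "open S" "\<And>x. x \<in> S \<Longrightarrow> f x = g x"
  shows "smooth_on S f \<longleftrightarrow> smooth_on S g"
  unfolding smooth_on_def using Ck_on_cong[OF assms] by simp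

lemma smooth_on_subset: "smooth_on S f \<Longrightarrow> T \<subseteq> S \<Longrightarrow> smooth_on T f"
  unfolding smooth_on_def using Ck_on_subset by blast

lemma smooth_on_differentiable: "smooth_on S f \<Longrightarrow> z \<in> S \<Longrightarrow> f differentiable (at z)"
  unfolding smooth_on_def using Ck_on.simps(2) by blast

lemma smooth_on_partial: "smooth_on S f \<Longrightarrow> smooth_on S (partial v f)"
  unfolding smooth_on_def using Ck_on.simps(2) by blast

lemma smooth_on_continuous_on: "smooth_on S f \<Longrightarrow> continuous_on S f"
  unfolding smooth_on_def using Ck_on.simps(1) by blast

lemma smooth_on_const: "smooth_on S (\<lambda>_. c)"
  by (simp add: smooth_on_def Ck_on_const)

lemma smooth_on_bounded_linear:
  "bounded_linear T \<Longrightarrow> open S \<Longrightarrow> smooth_on S f \<Longrightarrow> smooth_on S (\<lambda>z. T (f z))"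
  by (simp add: smooth_on_def Ck_on_bounded_linear)

lemma smooth_on_add:
  "open S \<Longrightarrow> smooth_on S f \<Longrightarrow> smooth_on S g \<Longrightarrow> smooth_on S (\<lambda>z. f z + g z)"
  by (simp add: smooth_on_def Ck_on_add)

lemma smooth_on_bilinear:
  "bounded_bilinear P \<Longrightarrow> open S \<Longrightarrow> smooth_on S f \<Longrightarrow> smooth_on S g \<Longrightarrow> smooth_on S (\<lambda>z. P (f z) (g z))"
  by (simp add: smooth_on_def Ck_on_bilinear)

lemma smooth_on_sum:
  "open S \<Longrightarrow> (\<And>i. i \<in> I \<Longrightarrow> smooth_on S (f i)) \<Longrightarrow> smooth_on S (\<lambda>z. \<Sum>i\<in>I. f i z)"
  by (simp add: smooth_on_def Ck_on_sum)

lemma smooth_on_inverse: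
  fixes f :: "'u::real_normed_vector \<Rightarrow> real"
  shows "open S \<Longrightarrow> (\<And>z. z \<in> S \<Longrightarrow> f z \<noteq> 0) \<Longrightarrow> smooth_on S f \<Longrightarrow> smooth_on S (\<lambda>z. inverse (f z))"
  by (simp add: smooth_on_def Ck_on_inverse)

lemma smooth_on_id: "smooth_on S (\<lambda>z. z)"
proof -
  have "partial v (\<lambda>z. z) = (\<lambda>_. v)" for v :: 'a
    by (simp add: partial_def fun_eq_iff)
  then have "Ck_on k S (\<lambda>z. z)" for k
    by (cases k) (auto simp: Ck_on_const continuous_on_id)
  then show ?thesis by (simp add: smooth_on_def)
qed

lemma smooth_on_linear: "bounded_linear T \<Longrightarrow> open S \<Longrightarrow> smooth_on S T"
  by (rule smooth_on_bounded_linear[of T S "\<lambda>z. z"]) (auto intro: smooth_on_id)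

lemma smooth_on_compose:
  fixes f :: "'u::real_normed_vector \<Rightarrow> 'v::real_normed_vector" and g :: "'v \<Rightarrow> 'w::real_normed_vector"
  assumes "finite_dim TYPE('v)" "open S" "open T" "f ` S \<subseteq> T" "smooth_on S f" "smooth_on T g"
  shows "smooth_on S (\<lambda>z. g (f z))"
  using assms by (simp add: smooth_on_def Ck_on_compose[OF assms(1-4)])

lemma smooth_on_Pair:
  assumes "open S" "smooth_on S f" "smooth_on S g"
  shows "smooth_on S (\<lambda>z. (f z, g z))"
proof -
  have "smooth_on S (\<lambda>z. (f z, 0) + (0, g z))"
    by (intro smooth_on_add smooth_on_bounded_linear[of "\<lambda>x. (x, 0)"] smooth_on_bounded_linear[of "\<lambda>x. (0, x)"]
          bounded_linear_Pair bounded_linear_ident bounded_linear_zero assms)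
  then show ?thesis by simp
qed

lemma bounded_linear_axis: "bounded_linear (axis \<alpha> :: 'e::real_normed_vector \<Rightarrow> 'e ^ 'p)"
proof (rule bounded_linear_intro[of _ 1])
  show "norm (axis \<alpha> x :: 'e ^ 'p) \<le> norm x * 1" for x :: 'e
  proof -
    have "(\<Sum>i\<in>UNIV. (norm ((axis \<alpha> x :: 'e ^ 'p) $ i))\<^sup>2) = (\<Sum>i\<in>UNIV. if i = \<alpha> then (norm x)\<^sup>2 else 0)"
      by (intro sum.cong) (auto simp: axis_def)
    then show ?thesis by (simp add: norm_vec_def L2_set_def)
  qed
qed (auto simp: vec_eq_iff axis_def)

lemma smooth_on_vec:
  fixes f :: "'p::finite \<Rightarrow> 'u::real_normed_vector \<Rightarrow> 'e::real_normed_vector"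
  assumes "open S" "\<And>\<alpha>. smooth_on S (f \<alpha>)"
  shows "smooth_on S (\<lambda>z. \<chi> \<alpha>. f \<alpha> z)"
proof -
  have "smooth_on S (\<lambda>z. \<Sum>\<alpha>\<in>UNIV. axis \<alpha> (f \<alpha> z))"
    by (intro smooth_on_sum smooth_on_bounded_linear[OF bounded_linear_axis] assms)
  moreover have "(\<Sum>\<alpha>\<in>UNIV. axis \<alpha> (f \<alpha> z)) = (\<chi> \<alpha>. f \<alpha> z)" for z
    using sum_axis[of "\<chi> \<alpha>. f \<alpha> z"] by simp
  ultimately show ?thesis by simp
qed

lemma smooth_on_partial_along:
  fixes \<tau> :: "'v::real_normed_vector \<Rightarrow> 'w::real_normed_vector"
  assumes "finite_dim TYPE('v)" "open S" "open T" "smooth_on T \<tau>"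
    and "smooth_on S a" "a ` S \<subseteq> T" "smooth_on S w"
  shows "smooth_on S (\<lambda>z. partial (w z) \<tau> (a z))"
proof -
  obtain B :: "'v set" and c where B: "finite B" "\<And>b. bounded_linear (c b)" "\<And>x. (\<Sum>b\<in>B. c b x *\<^sub>R b) = x"
    using finite_dim_coordinates[OF assms(1)] by blast
  have "partial (w z) \<tau> (a z) = (\<Sum>b\<in>B. c b (w z) *\<^sub>R partial b \<tau> (a z))" if "z \<in> S" for z
  proof (rule partial_coordinates[where B=B and c=c, OF B(3)])
    show "\<tau> differentiable (at (a z))"
      using smooth_on_differentiable[OF assms(4)] assms(6) that by blast
  qed
  moreover have "smooth_on S (\<lambda>z. \<Sum>b\<in>B. c b (w z) *\<^sub>R partial b \<tau> (a z))"
    by (rule smooth_on_sum[OF assms(2)], rule smooth_on_bilinear[OF bounded_bilinear_scaleR assms(2)])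
       (rule smooth_on_bounded_linear[OF B(2) assms(2,7)]
         smooth_on_compose[OF assms(1,2,3,6,5) smooth_on_partial[OF assms(4)]])+
  ultimately show ?thesis by (subst smooth_on_cong[OF assms(2)])
qed

lemma partial_partial_coordinates:
  assumes "(\<Sum>b\<in>B. c b w *\<^sub>R b) = w" "open T" "smooth_on T f" "z \<in> T"
  shows "partial v (partial w f) z = (\<Sum>b\<in>B. c b w *\<^sub>R partial v (partial b f) z)"
proof -
  have "partial v (partial w f) z = partial v (\<lambda>y. \<Sum>b\<in>B. c b w *\<^sub>R partial b f y) z"
    by (rule partial_cong_open[OF assms(2,4)])
       (rule partial_coordinates[where B=B and c=c, OF assms(1) smooth_on_differentiable[OF assms(3)]])
  also have "\<dots> = (\<Sum>b\<in>B. partial v (\<lambda>y. c b w *\<^sub>R partial b f y) z)"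
    by (rule partial_sum)
       (intro differentiable_bounded_linear[OF bounded_linear_scaleR_right]
          smooth_on_differentiable[OF smooth_on_partial[OF assms(3)]] assms(4))
  also have "\<dots> = (\<Sum>b\<in>B. c b w *\<^sub>R partial v (partial b f) z)"
    by (intro sum.cong refl partial_bounded_linear[OF bounded_linear_scaleR_right]
          smooth_on_differentiable[OF smooth_on_partial[OF assms(3)]] assms(4))
  finally show ?thesis .
qed

lemma linear_partial_partial:
  assumes "open T" "smooth_on T f" "z \<in> T"
  shows "linear (\<lambda>w. partial v (partial w f) z)"
proof (rule linearI)
  have d: "partial w f differentiable (at z)" for w
    using smooth_on_differentiable[OF smooth_on_partial[OF assms(2)]] assms(3) .
  fix w w' :: 'a and r :: real
  have "partial v (partial (w + w') f) z = partial v (\<lambda>y. partial w f y + partial w' f y) z"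
    by (rule partial_cong_open[OF assms(1,3)])
       (use linear_add[OF linear_partial] smooth_on_differentiable[OF assms(2)] in blast)
  then show "partial v (partial (w + w') f) z = partial v (partial w f) z + partial v (partial w' f) z"
    by (simp add: partial_add d)
  have "partial v (partial (r *\<^sub>R w) f) z = partial v (\<lambda>y. r *\<^sub>R partial w f y) z"
    by (rule partial_cong_open[OF assms(1,3)])
       (use linear_scale[OF linear_partial] smooth_on_differentiable[OF assms(2)] in blast)
  then show "partial v (partial (r *\<^sub>R w) f) z = r *\<^sub>R partial v (partial w f) z"
    by (simp add: partial_bounded_linear[OF bounded_linear_scaleR_right] d)
qed

lemma smooth_on_partial_partial_along:
  fixes \<tau> :: "'v::real_normed_vector \<Rightarrow> 'w::real_normed_vector"
  assumes "finite_dim TYPE('v)" "open S" "open T" "smooth_on T \<tau>"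
    and "smooth_on S a" "a ` S \<subseteq> T" "smooth_on S v" "smooth_on S w"
  shows "smooth_on S (\<lambda>z. partial (v z) (partial (w z) \<tau>) (a z))"
proof -
  obtain B :: "'v set" and c where B: "finite B" "\<And>b. bounded_linear (c b)" "\<And>x. (\<Sum>b\<in>B. c b x *\<^sub>R b) = x"
    using finite_dim_coordinates[OF assms(1)] by blast
  have "partial (v z) (partial (w z) \<tau>) (a z) = (\<Sum>b\<in>B. c b (w z) *\<^sub>R partial (v z) (partial b \<tau>) (a z))"
    if "z \<in> S" for z
  proof (rule partial_partial_coordinates[where B=B and c=c, OF B(3) assms(3,4)])
    show "a z \<in> T" using assms(6) that by blast
  qed
  moreover have "smooth_on S (\<lambda>z. \<Sum>b\<in>B. c b (w z) *\<^sub>R partial (v z) (partial b \<tau>) (a z))"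
    by (rule smooth_on_sum[OF assms(2)], rule smooth_on_bilinear[OF bounded_bilinear_scaleR assms(2)])
       (rule smooth_on_bounded_linear[OF B(2) assms(2,8)]
         smooth_on_partial_along[OF assms(1,2,3) smooth_on_partial[OF assms(4)] assms(5,6,7)])+
  ultimately show ?thesis by (subst smooth_on_cong[OF assms(2)])
qed

text \<open>
  Chain rule of second order. The first-order rule is differentiated after the basis expansion,
  which separates the dependence on the point from the dependence on the direction.
\<close>

lemma partial_partial_compose:
  fixes f :: "'u::real_normed_vector \<Rightarrow> 'v::real_normed_vector" and g :: "'v \<Rightarrow> 'w::real_normed_vector"
  assumes "finite_dim TYPE('v)" "open S" "z \<in> S" "smooth_on S f" "open T" "f z \<in> T" "smooth_on T g"
  shows "partial v (partial w (\<lambda>z. g (f z))) z =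
         partial (partial v (partial w f) z) g (f z) + partial (partial v f z) (partial (partial w f z) g) (f z)"
proof -
  obtain B :: "'v set" and c where B: "finite B" "\<And>b. bounded_linear (c b)" "\<And>x. (\<Sum>b\<in>B. c b x *\<^sub>R b) = x"
    using finite_dim_coordinates[OF assms(1)] by blast
  define S' where "S' = S \<inter> f -` T"
  have S': "open S'" "z \<in> S'"
    unfolding S'_def using continuous_open_preimage[OF smooth_on_continuous_on[OF assms(4)] assms(2,5)] assms by auto
  have df: "f differentiable (at y)" "g differentiable (at (f y))" "partial b g differentiable (at (f y))"
    "partial w f differentiable (at y)" if "y \<in> S'" for y b
    using that assms smooth_on_differentiable smooth_on_partial unfolding S'_def by blast+
  note dz = df[OF S'(2)]
  have dcomp: "(\<lambda>y. partial b g (f y)) differentiable (at z)" for b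
    by (rule differentiable_compose[OF dz(1,3)])
  have dcoord: "(\<lambda>y. c b (partial w f y)) differentiable (at z)" for b
    by (intro differentiable_bounded_linear[OF B(2)] dz)
  have "partial v (partial w (\<lambda>z. g (f z))) z
      = partial v (\<lambda>y. \<Sum>b\<in>B. c b (partial w f y) *\<^sub>R partial b g (f y)) z"
    by (rule partial_cong_open[OF S'])
       (rule trans[OF partial_compose[OF df(1,2)] partial_coordinates[where B=B and c=c, OF B(3) df(2)]])
  also have "\<dots> = (\<Sum>b\<in>B. partial v (\<lambda>y. c b (partial w f y) *\<^sub>R partial b g (f y)) z)"
    by (rule partial_sum) (intro differentiable_bilinear[OF bounded_bilinear_scaleR] dcomp dcoord)
  also have "\<dots> = (\<Sum>b\<in>B. c b (partial w f z) *\<^sub>R partial (partial v f z) (partial b g) (f z)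
                        + c b (partial v (partial w f) z) *\<^sub>R partial b g (f z))"
    by (simp add: partial_bilinear[OF bounded_bilinear_scaleR dcoord dcomp]
        partial_compose[OF dz(1,3)] partial_bounded_linear[OF B(2) dz(4)])
  also have "\<dots> = partial (partial v (partial w f) z) g (f z) + partial (partial v f z) (partial (partial w f z) g) (f z)"
    by (simp only: sum.distrib add.commute
        partial_partial_coordinates[where B=B and c=c and w="partial w f z", OF B(3) assms(5,7,6)]
        partial_coordinates[where B=B and c=c and w="partial v (partial w f) z", OF B(3) dz(2)])
  finally show ?thesis .
qed

section \<open>Symmetry of second derivatives\<close>

text \<open>
  The mean value theorem, applied first along \<open>v\<close> and then along \<open>w\<close>. The left-hand side is symmetric
  in \<open>v\<close> and \<open>w\<close>, the right-hand side is not; this is the source of the symmetry of second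
  derivatives.
\<close>

lemma second_difference_mean_value:
  fixes f :: "'u::real_normed_vector \<Rightarrow> real"
  assumes "smooth_on S f" "ball z r \<subseteq> S" "h > 0" "h * (norm v + norm w) < r"
  shows "\<exists>s t. 0 < s \<and> s < h \<and> 0 < t \<and> t < h \<and>
    f (z + h *\<^sub>R v + h *\<^sub>R w) - f (z + h *\<^sub>R v) - f (z + h *\<^sub>R w) + f z
      = h * h * partial w (partial v f) (z + s *\<^sub>R v + t *\<^sub>R w)"
proof -
  have inS: "z + s *\<^sub>R v + t *\<^sub>R w \<in> S" if "0 \<le> s" "s \<le> h" "0 \<le> t" "t \<le> h" for s t
  proof -
    have "norm (s *\<^sub>R v + t *\<^sub>R w) \<le> norm (s *\<^sub>R v) + norm (t *\<^sub>R w)" by (rule norm_triangle_ineq)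
    also have "\<dots> \<le> h * norm v + h * norm w"
      using that by (auto intro!: add_mono mult_right_mono)
    also have "\<dots> < r" using assms(4) by (simp add: algebra_simps)
    finally have "z + s *\<^sub>R v + t *\<^sub>R w \<in> ball z r"
      using norm_minus_cancel[of "s *\<^sub>R v + t *\<^sub>R w"] by (simp add: dist_norm add.assoc)
    then show ?thesis using assms(2) by blast
  qed
  have line: "((\<lambda>s. g (a + s *\<^sub>R d)) has_real_derivative partial d g (a + s *\<^sub>R d)) (at s)"
    if "g differentiable (at (a + s *\<^sub>R d))" for g :: "'u \<Rightarrow> real" and a d s
  proof -
    have "((\<lambda>s. a + s *\<^sub>R d) has_derivative (\<lambda>t. t *\<^sub>R d)) (at s)"
      by (auto intro!: derivative_eq_intros)
    from has_derivative_compose[OF this partial_has_derivative[OF that]]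
    have "((\<lambda>s. g (a + s *\<^sub>R d)) has_derivative (\<lambda>t. partial (t *\<^sub>R d) g (a + s *\<^sub>R d))) (at s)" .
    then show ?thesis
      using linear_scale[OF linear_partial[OF that], of _ d]
      by (simp add: has_field_derivative_def mult_commute_abs)
  qed
  have D1: "((\<lambda>s. f ((z + h *\<^sub>R w) + s *\<^sub>R v) - f (z + s *\<^sub>R v)) has_real_derivative
      (partial v f ((z + h *\<^sub>R w) + s *\<^sub>R v) - partial v f (z + s *\<^sub>R v))) (at s)" if "0 \<le> s" "s \<le> h" for s
  proof (intro DERIV_diff line)
    show "f differentiable (at (z + h *\<^sub>R w + s *\<^sub>R v))"
      using inS[of s h] that assms(3) smooth_on_differentiable[OF assms(1)] by (simp add: ac_simps)
    show "f differentiable (at (z + s *\<^sub>R v))"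
      using inS[of s 0] that assms(3) smooth_on_differentiable[OF assms(1)] by simp
  qed
  obtain s where s: "0 < s" "s < h" and
    eq1: "(f ((z + h *\<^sub>R w) + h *\<^sub>R v) - f (z + h *\<^sub>R v)) - (f ((z + h *\<^sub>R w) + 0 *\<^sub>R v) - f (z + 0 *\<^sub>R v))
        = (h - 0) * (partial v f ((z + h *\<^sub>R w) + s *\<^sub>R v) - partial v f (z + s *\<^sub>R v))"
    using MVT2[OF assms(3) D1] by blast
  have D2: "((\<lambda>t. partial v f ((z + s *\<^sub>R v) + t *\<^sub>R w)) has_real_derivative
      partial w (partial v f) ((z + s *\<^sub>R v) + t *\<^sub>R w)) (at t)" if "0 \<le> t" "t \<le> h" for t
    using inS[of s t] that s smooth_on_differentiable[OF smooth_on_partial[OF assms(1)]]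
    by (intro line) simp
  obtain t where t: "0 < t" "t < h" and
    eq2: "partial v f ((z + s *\<^sub>R v) + h *\<^sub>R w) - partial v f ((z + s *\<^sub>R v) + 0 *\<^sub>R w)
        = (h - 0) * partial w (partial v f) ((z + s *\<^sub>R v) + t *\<^sub>R w)"
    using MVT2[OF assms(3) D2] by blast
  have "f (z + h *\<^sub>R v + h *\<^sub>R w) - f (z + h *\<^sub>R v) - f (z + h *\<^sub>R w) + f z
      = h * (partial v f ((z + s *\<^sub>R v) + h *\<^sub>R w) - partial v f (z + s *\<^sub>R v))"
    using eq1 by (simp add: ac_simps)
  also have "\<dots> = h * h * partial w (partial v f) (z + s *\<^sub>R v + t *\<^sub>R w)"
    using eq2 by simp
  finally show ?thesis using s t by blast
qed

text \<open>
  If the two mixed derivatives differed at \<open>z\<close>, by continuity their values at any two points close to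
  \<open>z\<close> would differ too; but the second difference over a small parallelogram is equal to both of them,
  at suitable points.
\<close>

lemma partial_commute_real:
  fixes f :: "'u::real_normed_vector \<Rightarrow> real"
  assumes "smooth_on S f" "open S" "z \<in> S"
  shows "partial v (partial w f) z = partial w (partial v f) z"
proof (rule ccontr)
  define A where "A = partial v (partial w f)"
  define B where "B = partial w (partial v f)"
  assume "partial v (partial w f) z \<noteq> partial w (partial v f) z"
  then have ne: "A z \<noteq> B z" by (simp add: A_def B_def)
  define \<epsilon> where "\<epsilon> = \<bar>A z - B z\<bar> / 2"
  have "\<epsilon> > 0" using ne by (simp add: \<epsilon>_def)
  have near_value: "\<exists>d>0. \<forall>y. dist y z < d \<longrightarrow> dist (g y) (g z) < \<epsilon>" if "smooth_on S g" for g :: "'u \<Rightarrow> real"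
  proof -
    have "isCont g z"
      using smooth_on_continuous_on[OF that] assms(2,3) by (simp add: continuous_on_eq_continuous_at)
    then have "(g \<longlongrightarrow> g z) (nhds z)" by (simp add: isCont_def tendsto_at_iff_tendsto_nhds)
    from tendstoD[OF this \<open>\<epsilon> > 0\<close>] show ?thesis unfolding eventually_nhds_metric .
  qed
  have "smooth_on S A" "smooth_on S B"
    unfolding A_def B_def by (intro smooth_on_partial assms(1))+
  then obtain r1 r2 where r: "r1 > 0" "r2 > 0"
    "\<And>y. dist y z < r1 \<Longrightarrow> dist (A y) (A z) < \<epsilon>" "\<And>y. dist y z < r2 \<Longrightarrow> dist (B y) (B z) < \<epsilon>"
    using near_value[of A] near_value[of B] by blast
  obtain r3 where r3: "r3 > 0" "ball z r3 \<subseteq> S" using assms(2,3) openE by blast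
  define r where "r = min r1 (min r2 r3)"
  have "r > 0" using r r3 by (simp add: r_def)
  \<comment> \<open>The summand \<open>1\<close> keeps the denominator positive when \<open>v\<close> and \<open>w\<close> vanish.\<close>
  define h where "h = r / (2 * (norm v + norm w + 1))"
  have "h > 0" using \<open>r > 0\<close> by (simp add: h_def add_nonneg_pos)
  have hr: "h * (norm v + norm w) < r"
  proof -
    have "h * (norm v + norm w) \<le> h * (norm v + norm w + 1)" using \<open>h > 0\<close> by simp
    also have "\<dots> = r / 2"
      unfolding h_def using norm_ge_zero[of v] norm_ge_zero[of w] by (simp add: field_simps add_nonneg_eq_0_iff)
    also have "\<dots> < r" using \<open>r > 0\<close> by simp
    finally show ?thesis .
  qed
  have sub: "ball z r \<subseteq> S" using r3 by (auto simp: r_def)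
  obtain s t where st: "0 < s" "s < h" "0 < t" "t < h"
    "f (z + h *\<^sub>R v + h *\<^sub>R w) - f (z + h *\<^sub>R v) - f (z + h *\<^sub>R w) + f z = h * h * B (z + s *\<^sub>R v + t *\<^sub>R w)"
    using second_difference_mean_value[OF assms(1) sub \<open>h > 0\<close> hr] unfolding B_def by blast
  have hr': "h * (norm w + norm v) < r" using hr by (simp add: add.commute)
  obtain s' t' where st': "0 < s'" "s' < h" "0 < t'" "t' < h"
    "f (z + h *\<^sub>R w + h *\<^sub>R v) - f (z + h *\<^sub>R w) - f (z + h *\<^sub>R v) + f z = h * h * A (z + s' *\<^sub>R w + t' *\<^sub>R v)"
    using second_difference_mean_value[OF assms(1) sub \<open>h > 0\<close> hr'] unfolding A_def by blast
  have "h * h * A (z + s' *\<^sub>R w + t' *\<^sub>R v) = h * h * B (z + s *\<^sub>R v + t *\<^sub>R w)"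
    using st(5) st'(5) unfolding add.assoc add.commute[of "h *\<^sub>R w" "h *\<^sub>R v"] by linarith
  then have eq: "A (z + s' *\<^sub>R w + t' *\<^sub>R v) = B (z + s *\<^sub>R v + t *\<^sub>R w)"
    using \<open>h > 0\<close> by simp
  have near: "dist (z + a *\<^sub>R v' + b *\<^sub>R w') z < r"
    if "0 < a" "a < h" "0 < b" "b < h" "h * (norm v' + norm w') < r" for a b v' w'
  proof -
    have "norm (a *\<^sub>R v' + b *\<^sub>R w') \<le> a * norm v' + b * norm w'"
      using norm_triangle_ineq[of "a *\<^sub>R v'" "b *\<^sub>R w'"] that by simp
    also have "\<dots> \<le> h * norm v' + h * norm w'"
      using that by (intro add_mono mult_right_mono) auto
    finally show ?thesis using that(5) by (simp add: dist_norm add.assoc algebra_simps)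
  qed
  have "dist (A (z + s' *\<^sub>R w + t' *\<^sub>R v)) (A z) < \<epsilon>"
    using near[OF st'(1-4) hr'] r(3) by (simp add: r_def)
  moreover have "dist (B (z + s *\<^sub>R v + t *\<^sub>R w)) (B z) < \<epsilon>"
    using near[OF st(1-4) hr] r(4) by (simp add: r_def)
  ultimately show False
    unfolding eq \<epsilon>_def dist_real_def by (auto simp: abs_if split: if_splits)
qed

lemma partial_commute:
  fixes f :: "'u::real_normed_vector \<Rightarrow> 'e::real_normed_vector"
  assumes "finite_dim TYPE('e)" "smooth_on S f" "open S" "z \<in> S"
  shows "partial v (partial w f) z = partial w (partial v f) z"
proof -
  obtain B :: "'e set" and c where B: "finite B" "\<And>b. bounded_linear (c b)" "\<And>x. (\<Sum>b\<in>B. c b x *\<^sub>R b) = x"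
    using finite_dim_coordinates[OF assms(1)] by blast
  have c: "c b (partial v (partial w f) z) = partial v (partial w (\<lambda>z. c b (f z))) z" for b v w
  proof -
    have "partial v (partial w (\<lambda>z. c b (f z))) z = partial v (\<lambda>z. c b (partial w f z)) z"
      by (rule partial_cong_open[OF assms(3,4)])
         (rule partial_bounded_linear[OF B(2) smooth_on_differentiable[OF assms(2)]])
    also have "\<dots> = c b (partial v (partial w f) z)"
      by (rule partial_bounded_linear[OF B(2) smooth_on_differentiable[OF smooth_on_partial[OF assms(2)] assms(4)]])
    finally show ?thesis by simp
  qed
  have "c b (partial v (partial w f) z) = c b (partial w (partial v f) z)" for b
    unfolding c
    by (rule partial_commute_real[OF smooth_on_bounded_linear[OF B(2) assms(3,2)] assms(3,4)])
  then have "(\<Sum>b\<in>B. c b (partial v (partial w f) z) *\<^sub>R b) = (\<Sum>b\<in>B. c b (partial w (partial v f) z) *\<^sub>R b)"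
    by simp
  then show ?thesis unfolding B(3) .
qed

section \<open>Smooth atlases\<close>

text \<open>
  A manifold without the two axioms on its topology, so that the properties of charts can be used
  while these axioms are being proved for a space of jets.
\<close>

locale smooth_atlas =
  fixes N :: "('a, 'e::real_normed_vector) manifold"
  assumes finite_dim_model: "finite_dim TYPE('e)"
    and cover: "(\<Union>(U, x)\<in>atlas N. U) = points N"
    and inj: "(U, x) \<in> atlas N \<Longrightarrow> inj_on x U"
    and open_image: "(U, x) \<in> atlas N \<Longrightarrow> open (x ` U)"
    and open_overlap: "(U, x) \<in> atlas N \<Longrightarrow> (V, y) \<in> atlas N \<Longrightarrow> open (x ` (U \<inter> V))"
    and smooth_transition:
      "(U, x) \<in> atlas N \<Longrightarrow> (V, y) \<in> atlas N \<Longrightarrow> smooth_on (x ` (U \<inter> V)) (y \<circ> inv_into U x)"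

lemma smooth_manifold_iff:
  fixes N :: "('a, 'e::real_normed_vector) manifold"
  shows
  "smooth_manifold N \<longleftrightarrow>
   smooth_atlas N \<and> Hausdorff_space (mtopology_of N) \<and> second_countable (mtopology_of N)"
proof
  assume L: "smooth_manifold N"
  have "smooth_atlas N"
  proof
    show "finite_dim TYPE('e)" "(\<Union>(U, x)\<in>atlas N. U) = points N"
      using L unfolding smooth_manifold_def by blast+
    fix U x assume U: "(U, x) \<in> atlas N"
    show "inj_on x U" "open (x ` U)" using L U unfolding smooth_manifold_def by blast+
    fix V y assume V: "(V, y) \<in> atlas N"
    show "open (x ` (U \<inter> V))" "smooth_on (x ` (U \<inter> V)) (y \<circ> inv_into U x)"
      using L U V unfolding smooth_manifold_def by blast+
  qed
  then show "smooth_atlas N \<and> Hausdorff_space (mtopology_of N) \<and> second_countable (mtopology_of N)"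
    using L unfolding smooth_manifold_def by blast
next
  assume R: "smooth_atlas N \<and> Hausdorff_space (mtopology_of N) \<and> second_countable (mtopology_of N)"
  then interpret smooth_atlas N by blast
  show "smooth_manifold N"
    unfolding smooth_manifold_def
  proof (intro conjI)
    show "\<forall>(U, x)\<in>atlas N. inj_on x U \<and> open (x ` U)" using inj open_image by blast
    show "\<forall>(U, x)\<in>atlas N. \<forall>(V, y)\<in>atlas N.
        open (x ` (U \<inter> V)) \<and> smooth_on (x ` (U \<inter> V)) (y \<circ> inv_into U x)"
      using open_overlap smooth_transition by blast
  qed (use R finite_dim_model cover in auto)
qed

context smooth_atlas
begin

lemma chart_subset: "(U, x) \<in> atlas N \<Longrightarrow> U \<subseteq> points N"
  using cover by blast

lemma chart_around: "a \<in> points N \<Longrightarrow> \<exists>U x. (U, x) \<in> atlas N \<and> a \<in> U"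
  using cover by blast

lemma openin_iff:
  "openin (mtopology_of N) W \<longleftrightarrow> W \<subseteq> points N \<and> (\<forall>(U, x)\<in>atlas N. open (x ` (W \<inter> U)))"
  by (rule openin_mtopology_of) (use inj in blast)

lemma topspace_mtopology: "topspace (mtopology_of N) = points N"
proof
  show "topspace (mtopology_of N) \<subseteq> points N"
    using openin_topspace[of "mtopology_of N"] unfolding openin_iff by blast
  have "openin (mtopology_of N) (points N)"
    unfolding openin_iff using chart_subset open_image by (auto simp: Int_absorb1)
  then show "points N \<subseteq> topspace (mtopology_of N)" by (rule openin_subset)
qed

text \<open>
  Coordinate maps are continuous: openness in the topology is tested in every chart, and seen from
  another chart the set is a preimage of \<open>D\<close> under a transition map.
\<close>

lemma openin_chart_preimage:
  assumes "(U, x) \<in> atlas N" "open D"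
  shows "openin (mtopology_of N) {a \<in> U. x a \<in> D}"
  unfolding openin_iff
proof (intro conjI ballI)
  show "{a \<in> U. x a \<in> D} \<subseteq> points N" using chart_subset[OF assms(1)] by blast
  fix c assume c: "c \<in> atlas N"
  obtain V y where cV: "c = (V, y)" by (cases c)
  with c have V: "(V, y) \<in> atlas N" by simp
  have "y ` ({a \<in> U. x a \<in> D} \<inter> V) = y ` (V \<inter> U) \<inter> (x \<circ> inv_into V y) -` D"
    using inj[OF V] by (auto simp: inv_into_f_f)
  moreover have "open (y ` (V \<inter> U) \<inter> (x \<circ> inv_into V y) -` D)"
    by (rule continuous_open_preimage[OF smooth_on_continuous_on[OF smooth_transition[OF V assms(1)]]
          open_overlap[OF V assms(1)] assms(2)])
  ultimately show "case c of (V, y) \<Rightarrow> open (y ` ({a \<in> U. x a \<in> D} \<inter> V))" by (simp add: cV)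
qed

lemma openin_chart: "(U, x) \<in> atlas N \<Longrightarrow> openin (mtopology_of N) U"
  using openin_chart_preimage[of U x UNIV] by simp

lemma second_countable_if_countable_subatlas:
  assumes "countable A" "A \<subseteq> atlas N" "points N \<subseteq> (\<Union>(U, x)\<in>A. U)"
  shows "second_countable (mtopology_of N)"
proof -
  obtain \<D> :: "'e set set" where \<D>: "countable \<D>" "\<And>D. D \<in> \<D> \<Longrightarrow> open D"
    "\<And>S x. open S \<Longrightarrow> x \<in> S \<Longrightarrow> \<exists>D\<in>\<D>. x \<in> D \<and> D \<subseteq> S"
    using finite_dim_countable_basis[OF finite_dim_model] by blast
  define \<B> where "\<B> = (\<lambda>(c, D). {a \<in> fst c. snd c a \<in> D}) ` (A \<times> \<D>)"
  show ?thesis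
    unfolding second_countable_def
  proof (intro exI conjI allI impI)
    show "countable \<B>" unfolding \<B>_def using assms(1) \<D>(1) by (intro countable_image countable_SIGMA) auto
    show "\<forall>V\<in>\<B>. openin (mtopology_of N) V"
    proof
      fix V assume "V \<in> \<B>"
      then obtain U x D where "(U, x) \<in> A" "D \<in> \<D>" "V = {a \<in> U. x a \<in> D}" unfolding \<B>_def by auto
      then show "openin (mtopology_of N) V" using assms(2) \<D>(2) openin_chart_preimage by blast
    qed
    fix W a assume W: "openin (mtopology_of N) W \<and> a \<in> W"
    then have "a \<in> points N" unfolding openin_iff by blast
    then obtain U x where Ux: "(U, x) \<in> A" "a \<in> U" using assms(3) by blast
    then have at: "(U, x) \<in> atlas N" using assms(2) by blast
    have "open (x ` (W \<inter> U))" using W at unfolding openin_iff by blast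
    moreover have "x a \<in> x ` (W \<inter> U)" using W Ux by blast
    ultimately obtain D where D: "D \<in> \<D>" "x a \<in> D" "D \<subseteq> x ` (W \<inter> U)" using \<D>(3) by blast
    have "{b \<in> U. x b \<in> D} \<subseteq> W"
    proof
      fix b assume b: "b \<in> {b \<in> U. x b \<in> D}"
      then obtain b' where "b' \<in> W" "b' \<in> U" "x b = x b'" using D(3) by blast
      with b inj_onD[OF inj[OF at]] show "b \<in> W" by blast
    qed
    moreover have "{b \<in> U. x b \<in> D} \<in> \<B>"
      unfolding \<B>_def using Ux(1) D(1) by (auto intro: rev_image_eqI[of "((U, x), D)"])
    ultimately show "\<exists>V\<in>\<B>. a \<in> V \<and> V \<subseteq> W"
      by (intro bexI[of _ "{b \<in> U. x b \<in> D}"]) (simp_all add: Ux(2) D(2))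
  qed
qed

lemma countable_subatlas:
  assumes "second_countable (mtopology_of N)"
  shows "\<exists>A. countable A \<and> A \<subseteq> atlas N \<and> points N \<subseteq> (\<Union>(U, x)\<in>A. U)"
proof -
  have "\<exists>\<V>. countable \<V> \<and> \<V> \<subseteq> fst ` atlas N \<and> \<Union>\<V> = topspace (mtopology_of N)"
  proof (rule Lindelof_spaceD[OF second_countable_imp_Lindelof_space[OF assms]])
    show "openin (mtopology_of N) U" if "U \<in> fst ` atlas N" for U using that openin_chart by auto
    show "\<Union>(fst ` atlas N) = topspace (mtopology_of N)"
      unfolding topspace_mtopology cover[symmetric] by force
  qed
  then obtain \<V> where \<V>: "countable \<V>" "\<V> \<subseteq> fst ` atlas N" "\<Union>\<V> = points N"
    unfolding topspace_mtopology by (elim exE conjE) (rule that)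
  have "\<forall>U\<in>\<V>. \<exists>x. (U, x) \<in> atlas N" using \<V>(2) by force
  then obtain ch where ch: "\<And>U. U \<in> \<V> \<Longrightarrow> (U, ch U) \<in> atlas N" by metis
  show ?thesis
    by (intro exI[of _ "(\<lambda>U. (U, ch U)) ` \<V>"] conjI) (use \<V> ch in auto)
qed

end

text \<open>
  Continuity is a consequence of smooth coordinate representations on open domains, since the
  preimage of an open set is covered by its preimages under these representations.
\<close>

lemma smooth_mapI:
  assumes "smooth_atlas N" "smooth_atlas Q" "f ` points N \<subseteq> points Q"
    and dom: "\<And>U x V y. (U, x) \<in> atlas N \<Longrightarrow> (V, y) \<in> atlas Q \<Longrightarrow> open (x ` (U \<inter> f -` V))"
    and rep: "\<And>U x V y. (U, x) \<in> atlas N \<Longrightarrow> (V, y) \<in> atlas Q \<Longrightarrow>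
      smooth_on (x ` (U \<inter> f -` V)) (y \<circ> f \<circ> inv_into U x)"
  shows "smooth_map N Q f"
  unfolding smooth_map_def
proof (intro conjI)
  interpret N: smooth_atlas N by fact
  interpret Q: smooth_atlas Q by fact
  show "continuous_map (mtopology_of N) (mtopology_of Q) f"
    unfolding continuous_map_def N.topspace_mtopology Q.topspace_mtopology
  proof (intro conjI allI impI)
    show "f \<in> points N \<rightarrow> points Q" using assms(3) by blast
    fix W assume W: "openin (mtopology_of Q) W"
    show "openin (mtopology_of N) {a \<in> points N. f a \<in> W}"
      unfolding N.openin_iff
    proof (intro conjI ballI)
      fix c assume c: "c \<in> atlas N"
      obtain U x where cU: "c = (U, x)" by (cases c)
      with c have U: "(U, x) \<in> atlas N" by simp
      let ?P = "\<lambda>V y. x ` (U \<inter> f -` V) \<inter> (y \<circ> f \<circ> inv_into U x) -` (y ` (W \<inter> V))"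
      have "x ` ({a \<in> points N. f a \<in> W} \<inter> U) = (\<Union>(V, y)\<in>atlas Q. ?P V y)"
      proof
        show "x ` ({a \<in> points N. f a \<in> W} \<inter> U) \<subseteq> (\<Union>(V, y)\<in>atlas Q. ?P V y)"
        proof
          fix p assume "p \<in> x ` ({a \<in> points N. f a \<in> W} \<inter> U)"
          then obtain a where a: "p = x a" "a \<in> U" "f a \<in> W" by blast
          then have "f a \<in> points Q" using W unfolding Q.openin_iff by blast
          then obtain V y where V: "(V, y) \<in> atlas Q" "f a \<in> V" using Q.chart_around by blast
          have "p \<in> ?P V y" using a V N.inj[OF U] by (auto simp: inv_into_f_f)
          with V show "p \<in> (\<Union>(V, y)\<in>atlas Q. ?P V y)" by blast
        qed
        show "(\<Union>(V, y)\<in>atlas Q. ?P V y) \<subseteq> x ` ({a \<in> points N. f a \<in> W} \<inter> U)"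
        proof
          fix p assume "p \<in> (\<Union>(V, y)\<in>atlas Q. ?P V y)"
          then obtain V y where V: "(V, y) \<in> atlas Q" and p: "p \<in> ?P V y" by blast
          then obtain a where a: "p = x a" "a \<in> U" "f a \<in> V" by blast
          then have "y (f a) \<in> y ` (W \<inter> V)" using p N.inj[OF U] by (auto simp: inv_into_f_f)
          then obtain b where "b \<in> W" "b \<in> V" "y (f a) = y b" by blast
          with a(3) inj_onD[OF Q.inj[OF V]] have "f a \<in> W" by blast
          then show "p \<in> x ` ({a \<in> points N. f a \<in> W} \<inter> U)" using a N.chart_subset[OF U] by blast
        qed
      qed
      moreover have "open (?P V y)" if V: "(V, y) \<in> atlas Q" for V y
      proof (rule continuous_open_preimage[OF smooth_on_continuous_on[OF rep[OF U V]] dom[OF U V]])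
        show "open (y ` (W \<inter> V))" using W V unfolding Q.openin_iff by blast
      qed
      ultimately show "case c of (U, x) \<Rightarrow> open (x ` ({a \<in> points N. f a \<in> W} \<inter> U))"
        unfolding cU by (auto intro!: open_UN)
    qed blast
  qed
  show "\<forall>(U, x)\<in>atlas N. \<forall>(V, y)\<in>atlas Q. smooth_on (x ` (U \<inter> f -` V)) (y \<circ> f \<circ> inv_into U x)"
    using rep by blast
qed

lemma smooth_map_open:
  assumes "smooth_atlas N" "smooth_atlas Q" "smooth_map N Q f" "(U, x) \<in> atlas N" "(V, y) \<in> atlas Q"
  shows "open (x ` (U \<inter> f -` V))"
proof -
  interpret N: smooth_atlas N by fact
  interpret Q: smooth_atlas Q by fact
  have "openin (mtopology_of N) {a \<in> points N. f a \<in> V}"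
    using assms(3) Q.openin_chart[OF assms(5)]
    unfolding smooth_map_def continuous_map_def N.topspace_mtopology by blast
  then have "open (x ` ({a \<in> points N. f a \<in> V} \<inter> U))"
    using assms(4) unfolding N.openin_iff by blast
  moreover have "{a \<in> points N. f a \<in> V} \<inter> U = U \<inter> f -` V"
    using N.chart_subset[OF assms(4)] by blast
  ultimately show ?thesis by simp
qed

lemma smooth_atlas_vector_space:
  "smooth_atlas (vector_space_manifold :: ('u, 'u::euclidean_space) manifold)"
  unfolding vector_space_manifold_def
  by unfold_locales (auto simp: finite_dim_euclidean id_def smooth_on_id o_def)

lemma smooth_param_iff:
  fixes \<phi> :: "'u::euclidean_space \<Rightarrow> 'a"
  assumes "smooth_atlas N"
  shows "smooth_param N \<phi> \<longleftrightarrow>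
    (\<forall>u. \<phi> u \<in> points N) \<and>
    (\<forall>U x. (U, x) \<in> atlas N \<longrightarrow> open (\<phi> -` U) \<and> smooth_on (\<phi> -` U) (x \<circ> \<phi>))"
    (is "?L \<longleftrightarrow> ?R")
proof
  interpret N: smooth_atlas N by fact
  interpret E: smooth_atlas "vector_space_manifold :: ('u, 'u) manifold" by (rule smooth_atlas_vector_space)
  have E: "atlas (vector_space_manifold :: ('u, 'u) manifold) = {(UNIV, id)}"
    "points (vector_space_manifold :: ('u, 'u) manifold) = UNIV"
    by (simp_all add: vector_space_manifold_def)
  {
    assume L: ?L
    have "\<phi> u \<in> points N" for u
      using L unfolding smooth_map_def continuous_map_def E.topspace_mtopology N.topspace_mtopology E by blast
    moreover have "open (\<phi> -` U)" "smooth_on (\<phi> -` U) (x \<circ> \<phi>)" if "(U, x) \<in> atlas N" for U x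
      using smooth_map_open[OF smooth_atlas_vector_space assms L _ that] L that unfolding smooth_map_def E by auto
    ultimately show ?R by blast
  }
  assume R: ?R
  show ?L
    by (rule smooth_mapI[OF smooth_atlas_vector_space assms]) (use R in \<open>auto simp: E\<close>)
qed

section \<open>Jet manifolds\<close>

text \<open>
  The coordinates of a jet at the origin for maps into a vector space: the value, and an element of
  a fibre \<open>'f\<close> that collects derivatives up to some order. Coordinates depend only on the germ and
  transform under a change of variables \<open>\<tau>\<close> in the target by \<open>prolong \<tau>\<close>. The assumption
  \<open>jet_coords_realize\<close> asks for globally defined maps with arbitrarily small image, because a jet on a
  manifold is represented by a map on the whole of \<open>'u\<close>.
\<close>

locale jet_functor =
  fixes jet_coords :: "('u::euclidean_space \<Rightarrow> 'e::real_normed_vector) \<Rightarrow> 'e \<times> 'f::real_normed_vector"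
    and prolong :: "('e \<Rightarrow> 'e) \<Rightarrow> 'e \<times> 'f \<Rightarrow> 'e \<times> 'f"
  assumes jet_coords_base: "fst (jet_coords f) = f 0"
    and jet_coords_local: "open S \<Longrightarrow> 0 \<in> S \<Longrightarrow> (\<And>u. u \<in> S \<Longrightarrow> f u = g u) \<Longrightarrow> jet_coords f = jet_coords g"
    and jet_coords_compose: "open S \<Longrightarrow> 0 \<in> S \<Longrightarrow> smooth_on S f \<Longrightarrow> open T \<Longrightarrow> f 0 \<in> T \<Longrightarrow> smooth_on T \<tau> \<Longrightarrow>
      jet_coords (\<lambda>u. \<tau> (f u)) = prolong \<tau> (jet_coords f)"
    and smooth_prolong: "open T \<Longrightarrow> smooth_on T \<tau> \<Longrightarrow> smooth_on (T \<times> UNIV) (prolong \<tau>)"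
    and jet_coords_realize: "r > 0 \<Longrightarrow> \<exists>f. smooth_on UNIV f \<and> (\<forall>u. dist e (f u) < r) \<and> jet_coords f = (e, w)"
    and finite_dim_fibre: "finite_dim TYPE('f)"

locale jet_bundle = jet_functor jet_coords prolong + smooth_atlas N
  for jet_coords :: "('u::euclidean_space \<Rightarrow> 'e::real_normed_vector) \<Rightarrow> 'e \<times> 'f::real_normed_vector"
    and prolong and N :: "('a, 'e) manifold"
begin

definition jet :: "('u \<Rightarrow> 'a) \<Rightarrow> ('u \<Rightarrow> 'a) set" where
  "jet \<phi> = {\<xi>. smooth_param N \<xi> \<and> \<phi> 0 = \<xi> 0 \<and>
                 (\<forall>(U, x)\<in>atlas N. \<phi> 0 \<in> U \<longrightarrow> jet_coords (x \<circ> \<phi>) = jet_coords (x \<circ> \<xi>))}"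

definition coord :: "('a \<Rightarrow> 'e) \<Rightarrow> ('u \<Rightarrow> 'a) set \<Rightarrow> 'e \<times> 'f" where
  "coord x J = jet_coords (x \<circ> (SOME \<phi>. \<phi> \<in> J))"

text \<open>
  The jets with base point in \<open>W\<close>, that is, the preimage of \<open>W\<close> under the projection to the base.
\<close>

definition over :: "'a set \<Rightarrow> ('u \<Rightarrow> 'a) set set" where
  "over W = {jet \<phi> | \<phi>. smooth_param N \<phi> \<and> \<phi> 0 \<in> W}"

definition jets :: "(('u \<Rightarrow> 'a) set, 'e \<times> 'f) manifold" where
  "jets = \<lparr>points = {jet \<phi> | \<phi>. smooth_param N \<phi>},
           atlas = {(over U, coord x) | U x. (U, x) \<in> atlas N}\<rparr>"

lemma smooth_paramD:
  fixes \<phi> :: "'u \<Rightarrow> 'a"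
  assumes "smooth_param N \<phi>"
  shows "\<phi> u \<in> points N" "(U, x) \<in> atlas N \<Longrightarrow> open (\<phi> -` U)" "(U, x) \<in> atlas N \<Longrightarrow> smooth_on (\<phi> -` U) (x \<circ> \<phi>)"
  using assms unfolding smooth_param_iff[OF smooth_atlas_axioms] by blast+

lemma self_in_jet: "smooth_param N \<phi> \<Longrightarrow> \<phi> \<in> jet \<phi>"
  unfolding jet_def by blast

lemma coord_jet:
  assumes "smooth_param N \<phi>" "(U, x) \<in> atlas N" "\<phi> 0 \<in> U"
  shows "coord x (jet \<phi>) = jet_coords (x \<circ> \<phi>)"
proof -
  have "(SOME \<xi>. \<xi> \<in> jet \<phi>) \<in> jet \<phi>"
    by (rule someI[of "\<lambda>\<xi>. \<xi> \<in> jet \<phi>", OF self_in_jet[OF assms(1)]])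
  then show ?thesis unfolding coord_def using assms(2,3) by (auto simp: jet_def)
qed

lemma jet_coords_change_chart:
  assumes "smooth_param N \<phi>" "(U, x) \<in> atlas N" "(V, y) \<in> atlas N" "\<phi> 0 \<in> U" "\<phi> 0 \<in> V"
  shows "jet_coords (y \<circ> \<phi>) = prolong (y \<circ> inv_into U x) (jet_coords (x \<circ> \<phi>))"
proof -
  let ?S = "\<phi> -` U \<inter> \<phi> -` V"
  have S: "open ?S" "0 \<in> ?S" using smooth_paramD[OF assms(1)] assms by auto
  have "jet_coords (y \<circ> \<phi>) = jet_coords (\<lambda>u. (y \<circ> inv_into U x) ((x \<circ> \<phi>) u))"
    by (rule jet_coords_local[OF S]) (simp add: inv_into_f_f[OF inj[OF assms(2)]])
  also have "\<dots> = prolong (y \<circ> inv_into U x) (jet_coords (x \<circ> \<phi>))"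
  proof (rule jet_coords_compose[OF S _ open_overlap[OF assms(2,3)] _ smooth_transition[OF assms(2,3)]])
    show "smooth_on ?S (x \<circ> \<phi>)" using smooth_paramD(3)[OF assms(1,2)] smooth_on_subset by blast
    show "(x \<circ> \<phi>) 0 \<in> x ` (U \<inter> V)" using assms by simp
  qed
  finally show ?thesis .
qed

text \<open>
  Equality of coordinates in one chart suffices, because the coordinates in any other chart are
  obtained from them by the prolonged transition map.
\<close>

lemma jet_eqI:
  assumes "smooth_param N \<phi>" "smooth_param N \<xi>" "(U, x) \<in> atlas N" "\<phi> 0 \<in> U" "\<xi> 0 \<in> U"
    "jet_coords (x \<circ> \<phi>) = jet_coords (x \<circ> \<xi>)"
  shows "jet \<phi> = jet \<xi>"
proof -
  have "x (\<phi> 0) = x (\<xi> 0)" using arg_cong[OF assms(6), of fst] by (simp add: jet_coords_base)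
  then have 0: "\<phi> 0 = \<xi> 0" using inj_onD[OF inj[OF assms(3)]] assms(4,5) by blast
  have "jet_coords (y \<circ> \<phi>) = jet_coords (y \<circ> \<xi>)" if "(V, y) \<in> atlas N" "\<phi> 0 \<in> V" for V y
    using jet_coords_change_chart[OF assms(1,3) that(1) assms(4) that(2)]
      jet_coords_change_chart[OF assms(2,3) that(1) assms(5)] that(2) 0 assms(6) by simp
  with 0 show ?thesis unfolding jet_def by fastforce
qed

lemma jet_mem_over: "smooth_param N \<phi> \<Longrightarrow> jet \<phi> \<in> over W \<longleftrightarrow> \<phi> 0 \<in> W"
proof
  assume \<phi>: "smooth_param N \<phi>" and "jet \<phi> \<in> over W"
  then obtain \<xi> where \<xi>: "jet \<phi> = jet \<xi>" "\<xi> 0 \<in> W" unfolding over_def by blast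
  have "\<phi> \<in> jet \<xi>" using self_in_jet[OF \<phi>] \<xi>(1) by simp
  then show "\<phi> 0 \<in> W" using \<xi>(2) unfolding jet_def by simp
next
  assume "smooth_param N \<phi>" "\<phi> 0 \<in> W"
  then show "jet \<phi> \<in> over W" unfolding over_def by blast
qed

lemma over_Int: "over U \<inter> over V = over (U \<inter> V)"
proof
  show "over U \<inter> over V \<subseteq> over (U \<inter> V)"
  proof
    fix j assume j: "j \<in> over U \<inter> over V"
    then obtain \<phi> where "j = jet \<phi>" "smooth_param N \<phi>" unfolding over_def by blast
    with j show "j \<in> over (U \<inter> V)" by (simp add: jet_mem_over)
  qed
qed (auto simp: over_def)

lemma points_jets: "points jets = over (points N)"
  unfolding jets_def over_def using smooth_paramD(1) by auto

lemma atlas_jets: "atlas jets = {(over U, coord x) | U x. (U, x) \<in> atlas N}"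
  by (simp add: jets_def)

lemma inj_coord:
  assumes "(U, x) \<in> atlas N"
  shows "inj_on (coord x) (over U)"
proof (rule inj_onI)
  fix j k assume "j \<in> over U" "k \<in> over U" and eq: "coord x j = coord x k"
  then obtain \<phi> \<xi> where "j = jet \<phi>" "smooth_param N \<phi>" "\<phi> 0 \<in> U" "k = jet \<xi>" "smooth_param N \<xi>" "\<xi> 0 \<in> U"
    unfolding over_def by blast
  then show "j = k" using eq jet_eqI coord_jet assms by metis
qed

text \<open>
  A map with the required coordinates and values in a small ball inside the chart image, transported
  to the manifold by the inverse of the chart. The result is smooth with respect to every chart, as
  it differs from the given map by transition maps.
\<close>

lemma exists_jet:
  assumes "(U, x) \<in> atlas N" "e \<in> x ` U"
  shows "\<exists>\<phi>. smooth_param N \<phi> \<and> \<phi> 0 \<in> U \<and> jet_coords (x \<circ> \<phi>) = (e, w)"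
proof -
  obtain r where r: "r > 0" "ball e r \<subseteq> x ` U" using open_image[OF assms(1)] assms(2) openE by blast
  obtain f where f: "smooth_on UNIV f" "\<And>u. dist e (f u) < r" "jet_coords f = (e, w)"
    using jet_coords_realize[OF r(1)] by blast
  have fU: "f u \<in> x ` U" for u using f(2)[of u] r(2) by auto
  define \<phi> where "\<phi> = (\<lambda>u. inv_into U x (f u))"
  have \<phi>: "\<phi> u \<in> U" "x (\<phi> u) = f u" for u
    unfolding \<phi>_def using fU by (auto intro: inv_into_into f_inv_into_f)
  have "smooth_param N \<phi>"
    unfolding smooth_param_iff[OF smooth_atlas_axioms]
  proof (intro conjI allI impI)
    show "\<phi> u \<in> points N" for u using \<phi>(1) chart_subset[OF assms(1)] by blast
    fix V y assume V: "(V, y) \<in> atlas N"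
    have eq: "\<phi> -` V = f -` (x ` (U \<inter> V))"
    proof (intro set_eqI iffI; unfold vimage_eq)
      fix u assume "\<phi> u \<in> V"
      then have "x (\<phi> u) \<in> x ` (U \<inter> V)" using \<phi>(1) by blast
      then show "f u \<in> x ` (U \<inter> V)" by (simp add: \<phi>(2))
    next
      fix u assume "f u \<in> x ` (U \<inter> V)"
      then obtain b where "b \<in> U" "b \<in> V" "x b = x (\<phi> u)" using \<phi>(2) by auto
      then show "\<phi> u \<in> V" using inj_onD[OF inj[OF assms(1)]] \<phi>(1) by metis
    qed
    show op: "open (\<phi> -` V)"
      unfolding eq using continuous_open_preimage[OF smooth_on_continuous_on[OF f(1)] open_UNIV open_overlap[OF assms(1) V]]
      by simp
    have "smooth_on (\<phi> -` V) (\<lambda>u. (y \<circ> inv_into U x) (f u))"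
      by (rule smooth_on_compose[OF finite_dim_model op open_overlap[OF assms(1) V] _
            smooth_on_subset[OF f(1) subset_UNIV] smooth_transition[OF assms(1) V]])
         (auto simp: eq)
    then show "smooth_on (\<phi> -` V) (y \<circ> \<phi>)" by (simp add: \<phi>_def o_def)
  qed
  moreover have "jet_coords (x \<circ> \<phi>) = (e, w)" using f(3) \<phi>(2) by (simp add: o_def)
  ultimately show ?thesis using \<phi>(1) by blast
qed

lemma coord_image:
  assumes "(U, x) \<in> atlas N"
  shows "coord x ` over (U \<inter> W) = x ` (U \<inter> W) \<times> UNIV"
proof
  show "coord x ` over (U \<inter> W) \<subseteq> x ` (U \<inter> W) \<times> UNIV"
  proof
    fix p assume "p \<in> coord x ` over (U \<inter> W)"
    then obtain \<phi> where \<phi>: "smooth_param N \<phi>" "\<phi> 0 \<in> U \<inter> W" "p = coord x (jet \<phi>)" unfolding over_def by blast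
    then have "p = jet_coords (x \<circ> \<phi>)" using coord_jet[OF \<phi>(1) assms] by blast
    then have "fst p = x (\<phi> 0)" by (simp add: jet_coords_base)
    then show "p \<in> x ` (U \<inter> W) \<times> UNIV" using \<phi>(2) by (cases p) auto
  qed
  show "x ` (U \<inter> W) \<times> UNIV \<subseteq> coord x ` over (U \<inter> W)"
  proof
    fix p :: "'e \<times> 'f" assume "p \<in> x ` (U \<inter> W) \<times> UNIV"
    then obtain a w where p: "p = (x a, w)" "a \<in> U" "a \<in> W" by blast
    obtain \<phi> where \<phi>: "smooth_param N \<phi>" "\<phi> 0 \<in> U" "jet_coords (x \<circ> \<phi>) = (x a, w)"
      using exists_jet[OF assms] p(2) by blast
    have "x (\<phi> 0) = x a" using arg_cong[OF \<phi>(3), of fst] by (simp add: jet_coords_base)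
    then have "\<phi> 0 = a" using inj_onD[OF inj[OF assms]] \<phi>(2) p(2) by blast
    then have "jet \<phi> \<in> over (U \<inter> W)" using \<phi>(1) p by (simp add: jet_mem_over)
    moreover have "coord x (jet \<phi>) = p" using coord_jet[OF \<phi>(1) assms \<phi>(2)] \<phi>(3) p(1) by simp
    ultimately show "p \<in> coord x ` over (U \<inter> W)" by blast
  qed
qed

lemma coord_transition:
  assumes "(U, x) \<in> atlas N" "(V, y) \<in> atlas N" "p \<in> x ` (U \<inter> V) \<times> UNIV"
  shows "(coord y \<circ> inv_into (over U) (coord x)) p = prolong (y \<circ> inv_into U x) p"
proof -
  have "p \<in> coord x ` over (U \<inter> V)" using assms coord_image by blast
  then obtain \<phi> where \<phi>: "smooth_param N \<phi>" "\<phi> 0 \<in> U" "\<phi> 0 \<in> V" "p = coord x (jet \<phi>)"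
    unfolding over_def by blast
  have "jet \<phi> \<in> over U" using \<phi> by (simp add: jet_mem_over)
  then have "inv_into (over U) (coord x) p = jet \<phi>"
    unfolding \<phi>(4) by (rule inv_into_f_f[OF inj_coord[OF assms(1)]])
  then show ?thesis
    using \<phi> coord_jet[OF \<phi>(1) assms(1)] coord_jet[OF \<phi>(1) assms(2)]
      jet_coords_change_chart[OF \<phi>(1) assms(1,2)] by simp
qed

lemma smooth_atlas_jets: "smooth_atlas jets"
proof
  show "finite_dim TYPE('e \<times> 'f)" by (rule finite_dim_prod[OF finite_dim_model finite_dim_fibre])
  show "(\<Union>(U, x)\<in>atlas jets. U) = points jets"
  proof -
    have "(\<Union>(U, x)\<in>atlas jets. U) = (\<Union>c\<in>atlas N. over (fst c))"
      unfolding atlas_jets by force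
    also have "\<dots> = over (\<Union>c\<in>atlas N. fst c)" unfolding over_def by blast
    also have "(\<Union>c\<in>atlas N. fst c) = points N" unfolding cover[symmetric] by force
    finally show ?thesis by (simp add: points_jets)
  qed
  fix U' x' assume "(U', x') \<in> atlas jets"
  then obtain U x where U: "(U, x) \<in> atlas N" "U' = over U" "x' = coord x" unfolding atlas_jets by blast
  show "inj_on x' U'" using U inj_coord by simp
  show "open (x' ` U')"
    using coord_image[OF U(1), of U] open_image[OF U(1)] U by (simp add: open_Times)
  fix V' y' assume "(V', y') \<in> atlas jets"
  then obtain V y where V: "(V, y) \<in> atlas N" "V' = over V" "y' = coord y" unfolding atlas_jets by blast
  have im: "x' ` (U' \<inter> V') = x ` (U \<inter> V) \<times> UNIV" using coord_image[OF U(1)] U V by (simp add: over_Int)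
  show op: "open (x' ` (U' \<inter> V'))" unfolding im using open_overlap[OF U(1) V(1)] by (simp add: open_Times)
  have "smooth_on (x ` (U \<inter> V) \<times> UNIV) (prolong (y \<circ> inv_into U x))"
    by (rule smooth_prolong[OF open_overlap[OF U(1) V(1)] smooth_transition[OF U(1) V(1)]])
  moreover have "smooth_on (x' ` (U' \<inter> V')) (y' \<circ> inv_into U' x') \<longleftrightarrow>
      smooth_on (x' ` (U' \<inter> V')) (prolong (y \<circ> inv_into U x))"
    by (rule smooth_on_cong[OF op]) (use coord_transition[OF U(1) V(1)] im U V in auto)
  ultimately show "smooth_on (x' ` (U' \<inter> V')) (y' \<circ> inv_into U' x')" by (simp add: im)
qed

lemma openin_over:
  assumes "openin (mtopology_of N) W"
  shows "openin (mtopology_of jets) (over W)"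
proof -
  interpret J: smooth_atlas jets by (rule smooth_atlas_jets)
  show ?thesis
    unfolding J.openin_iff
  proof (intro conjI ballI)
    have "W \<subseteq> points N" using assms unfolding openin_iff by blast
    then show "over W \<subseteq> points jets" unfolding points_jets over_def by blast
    fix c assume "c \<in> atlas jets"
    then obtain U x where U: "(U, x) \<in> atlas N" "c = (over U, coord x)" unfolding atlas_jets by blast
    have "coord x ` (over W \<inter> over U) = x ` (W \<inter> U) \<times> UNIV"
      using coord_image[OF U(1), of W] by (simp add: over_Int Int_commute)
    moreover have "open (x ` (W \<inter> U))" using assms U unfolding openin_iff by blast
    ultimately show "case c of (U, x) \<Rightarrow> open (x ` (over W \<inter> U))" by (simp add: U open_Times)
  qed
qed

text \<open>
  Jets with different base points are separated by preimages of open sets of the base; jets with the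
  same base point lie in a common chart domain and are separated there.
\<close>

lemma Hausdorff_jets:
  assumes "Hausdorff_space (mtopology_of N)"
  shows "Hausdorff_space (mtopology_of jets)"
proof -
  interpret J: smooth_atlas jets by (rule smooth_atlas_jets)
  show ?thesis
    unfolding Hausdorff_space_def J.topspace_mtopology
  proof (intro allI impI)
    fix j k assume jk: "j \<in> points jets \<and> k \<in> points jets \<and> j \<noteq> k"
    then obtain \<phi> \<xi> where \<phi>: "j = jet \<phi>" "smooth_param N \<phi>" and \<xi>: "k = jet \<xi>" "smooth_param N \<xi>"
      unfolding points_jets over_def by blast
    show "\<exists>U V. openin (mtopology_of jets) U \<and> openin (mtopology_of jets) V \<and> j \<in> U \<and> k \<in> V \<and> disjnt U V"
    proof (cases "\<phi> 0 = \<xi> 0")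
      case False
      then obtain W1 W2 where W: "openin (mtopology_of N) W1" "openin (mtopology_of N) W2"
        "\<phi> 0 \<in> W1" "\<xi> 0 \<in> W2" "disjnt W1 W2"
        using assms smooth_paramD(1)[OF \<phi>(2)] smooth_paramD(1)[OF \<xi>(2)]
        unfolding Hausdorff_space_def topspace_mtopology by meson
      have "over W1 \<inter> over W2 = {}" using W(5) unfolding over_Int disjnt_def by (simp add: over_def)
      then show ?thesis
        by (intro exI[of _ "over W1"] exI[of _ "over W2"] conjI openin_over W(1,2))
           (simp_all add: \<phi> \<xi> jet_mem_over W disjnt_def)
    next
      case True
      obtain U x where U: "(U, x) \<in> atlas N" "\<phi> 0 \<in> U" using chart_around smooth_paramD(1)[OF \<phi>(2)] by blast
      have mem: "j \<in> over U" "k \<in> over U" using U True \<phi> \<xi> by (simp_all add: jet_mem_over)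
      then have "coord x j \<noteq> coord x k" using jk inj_onD[OF inj_coord[OF U(1)]] by blast
      then obtain D1 D2 where D: "open D1" "open D2" "coord x j \<in> D1" "coord x k \<in> D2" "D1 \<inter> D2 = {}"
        using hausdorff[of "coord x j" "coord x k"] by blast
      have c: "(over U, coord x) \<in> atlas jets" unfolding atlas_jets using U by blast
      show ?thesis
        by (intro exI[of _ "{i \<in> over U. coord x i \<in> D1}"] exI[of _ "{i \<in> over U. coord x i \<in> D2}"] conjI
              J.openin_chart_preimage[OF c] D(1,2))
           (use mem D in \<open>auto simp: disjnt_def\<close>)
    qed
  qed
qed

text \<open>
  Countably many charts of the base cover it by the Lindelof property, and the induced charts cover
  the space of jets.
\<close>

lemma second_countable_jets:
  assumes "second_countable (mtopology_of N)"
  shows "second_countable (mtopology_of jets)"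
proof -
  interpret J: smooth_atlas jets by (rule smooth_atlas_jets)
  obtain A where A: "countable A" "A \<subseteq> atlas N" "points N \<subseteq> (\<Union>(U, x)\<in>A. U)"
    using countable_subatlas[OF assms] by blast
  show ?thesis
  proof (rule J.second_countable_if_countable_subatlas)
    show "countable ((\<lambda>(U, x). (over U, coord x)) ` A)" using A(1) by simp
    show "(\<lambda>(U, x). (over U, coord x)) ` A \<subseteq> atlas jets" unfolding atlas_jets using A(2) by auto
    show "points jets \<subseteq> (\<Union>(U, x)\<in>(\<lambda>(U, x). (over U, coord x)) ` A. U)"
    proof
      fix j assume "j \<in> points jets"
      then obtain \<phi> where \<phi>: "j = jet \<phi>" "smooth_param N \<phi>" "\<phi> 0 \<in> points N"
        unfolding points_jets over_def by blast
      then obtain c where "c \<in> A" "\<phi> 0 \<in> fst c" using A(3) by auto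
      with \<phi> show "j \<in> (\<Union>(U, x)\<in>(\<lambda>(U, x). (over U, coord x)) ` A. U)"
        by (intro UN_I[of "(over (fst c), coord (snd c))"]) (auto simp: jet_mem_over intro: rev_image_eqI)
    qed
  qed
qed

lemma smooth_manifold_jets: "smooth_manifold N \<Longrightarrow> smooth_manifold jets"
  unfolding smooth_manifold_iff[of N] smooth_manifold_iff[of jets]
  using smooth_atlas_jets Hausdorff_jets second_countable_jets by blast

end

section \<open>Prescribing derivatives by globally small maps\<close>

text \<open>
  Multiplication of \<open>Q\<close> by the rational function \<open>s(u) = 1 / (1 + C |u|\<^sup>2)\<close> makes it as small as desired
  when \<open>C\<close> is large, since \<open>Q\<close> grows at most quadratically. It does not change the first and second
  derivatives at \<open>0\<close>, because there \<open>s = 1\<close>, the first derivative of \<open>s\<close> vanishes, and the second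
  derivative of \<open>s\<close> is multiplied by \<open>Q(0) = 0\<close>.
\<close>

lemma exists_small_map_with_derivatives:
  fixes Q :: "'u::euclidean_space \<Rightarrow> 'e::real_normed_vector"
  assumes Q: "smooth_on UNIV Q" "Q 0 = 0" and K: "K \<ge> 0" "\<And>u. norm (Q u) \<le> K * (norm u + (norm u)\<^sup>2)"
    and "r > 0"
  shows "\<exists>f. smooth_on UNIV f \<and> (\<forall>u. dist e (f u) < r) \<and> f 0 = e \<and>
    (\<forall>v. partial v f 0 = partial v Q 0) \<and> (\<forall>v w. partial v (partial w f) 0 = partial v (partial w Q) 0)"
proof -
  \<comment> \<open>The value of \<open>C\<close> comes from \<open>K t \<le> r/2 + K\<^sup>2 t\<^sup>2 / (2 r)\<close>, which gives
    \<open>K (t + t\<^sup>2) < r (1 + C t\<^sup>2)\<close>.\<close>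
  define C where "C = K\<^sup>2 / (2 * r\<^sup>2) + K / r"
  have "C \<ge> 0" using K(1) \<open>r > 0\<close> by (simp add: C_def)
  define s where "s u = inverse (1 + C * (u \<bullet> u))" for u :: 'u
  define f where "f u = e + s u *\<^sub>R Q u" for u
  have pos: "1 + C * (u \<bullet> u) > 0" for u :: 'u using \<open>C \<ge> 0\<close> by (simp add: add_pos_nonneg)
  have s: "smooth_on UNIV s"
    unfolding s_def
  proof (rule smooth_on_inverse)
    show "smooth_on UNIV (\<lambda>u::'u. 1 + C * (u \<bullet> u))"
      by (intro smooth_on_add smooth_on_const open_UNIV smooth_on_bounded_linear[OF bounded_linear_mult_right]
          smooth_on_bilinear[OF bounded_bilinear_inner] smooth_on_id)
    show "1 + C * (u \<bullet> u) \<noteq> 0" for u :: 'u using pos[of u] by simp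
  qed simp
  have s0: "s 0 = 1" by (simp add: s_def)
  have ds0: "partial v s 0 = 0" for v
  proof -
    have "((\<lambda>u. 1 + C * (u \<bullet> u)) has_derivative (\<lambda>h. 0)) (at (0::'u))"
      by (auto intro!: derivative_eq_intros)
    from Deriv.has_derivative_inverse[OF _ this] show ?thesis
      unfolding s_def by (intro partial_eqI[where D = "\<lambda>h. 0"]) simp
  qed
  have f: "smooth_on UNIV f"
    unfolding f_def by (intro smooth_on_add smooth_on_const open_UNIV smooth_on_bilinear[OF bounded_bilinear_scaleR] s Q)
  have ds: "s differentiable (at z)" "partial w s differentiable (at z)" for z w
    using smooth_on_differentiable[OF s] smooth_on_differentiable[OF smooth_on_partial[OF s]] by auto
  have dQ: "Q differentiable (at z)" "partial w Q differentiable (at z)" for z w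
    using smooth_on_differentiable[OF Q(1)] smooth_on_differentiable[OF smooth_on_partial[OF Q(1)]] by auto
  have df: "partial w f = (\<lambda>z. s z *\<^sub>R partial w Q z + partial w s z *\<^sub>R Q z)" for w
  proof
    fix z
    have "partial w f z = partial w (\<lambda>z. e) z + partial w (\<lambda>z. s z *\<^sub>R Q z) z"
      unfolding f_def by (rule partial_add) (auto intro: differentiable_bilinear[OF bounded_bilinear_scaleR] ds dQ)
    then show "partial w f z = s z *\<^sub>R partial w Q z + partial w s z *\<^sub>R Q z"
      by (simp add: partial_bilinear[OF bounded_bilinear_scaleR ds(1) dQ(1)] partial_eqI[OF has_derivative_const])
  qed
  have d1: "partial v f 0 = partial v Q 0" for v by (simp add: df s0 Q(2))
  have d2: "partial v (partial w f) 0 = partial v (partial w Q) 0" for v w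
  proof -
    have "partial v (partial w f) 0
        = partial v (\<lambda>z. s z *\<^sub>R partial w Q z) 0 + partial v (\<lambda>z. partial w s z *\<^sub>R Q z) 0"
      unfolding df by (rule partial_add) (auto intro: differentiable_bilinear[OF bounded_bilinear_scaleR] ds dQ)
    also have "\<dots> = partial v (partial w Q) 0"
      by (simp add: partial_bilinear[OF bounded_bilinear_scaleR] ds dQ s0 ds0 Q(2))
    finally show ?thesis .
  qed
  have small: "dist e (f u) < r" for u
  proof -
    let ?t = "norm u"
    have "0 \<le> (r - K * ?t)\<^sup>2 / (2 * r)" using \<open>r > 0\<close> by simp
    also have "\<dots> = r / 2 + K\<^sup>2 * ?t\<^sup>2 / (2 * r) - K * ?t"
      using \<open>r > 0\<close> by (simp add: field_simps power2_eq_square)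
    finally have "K * ?t \<le> r / 2 + K\<^sup>2 * ?t\<^sup>2 / (2 * r)" by simp
    then have "K * (?t + ?t\<^sup>2) \<le> r / 2 + (K\<^sup>2 * ?t\<^sup>2 / (2 * r) + K * ?t\<^sup>2)"
      by (simp add: distrib_left)
    also have "K\<^sup>2 * ?t\<^sup>2 / (2 * r) + K * ?t\<^sup>2 = r * (C * (u \<bullet> u))"
      unfolding C_def power2_norm_eq_inner[symmetric] using \<open>r > 0\<close> by (simp add: field_simps power2_eq_square)
    finally have "K * (?t + ?t\<^sup>2) < r * (1 + C * (u \<bullet> u))"
      using \<open>r > 0\<close> by (simp add: distrib_left)
    then have "norm (Q u) < r * (1 + C * (u \<bullet> u))" using K(2)[of u] by linarith
    then have "s u * norm (Q u) < r" using pos[of u] by (simp add: s_def field_simps)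
    moreover have "s u > 0" using pos[of u] by (simp add: s_def)
    ultimately show ?thesis by (simp add: f_def dist_norm)
  qed
  have "f 0 = e" by (simp add: f_def Q(2))
  then show ?thesis using f small d1 d2 by blast
qed

section \<open>First-order jets\<close>

definition jet1_at_0 :: "(real^'p \<Rightarrow> 'e::real_normed_vector) \<Rightarrow> 'e \<times> ('e^'p)" where
  "jet1_at_0 f = (f 0, \<chi> \<alpha>. partial (axis \<alpha> 1) f 0)"

definition prolong1 :: "('e::real_normed_vector \<Rightarrow> 'e) \<Rightarrow> 'e \<times> ('e^'p) \<Rightarrow> 'e \<times> ('e^'p)" where
  "prolong1 \<tau> p = (\<tau> (fst p), \<chi> \<alpha>. partial (snd p $ \<alpha>) \<tau> (fst p))"

text \<open>
  Realization damps the linear map with matrix \<open>w\<close>; the other properties are the chain rule.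
\<close>

lemma jet_functor_jet1:
  assumes fin: "finite_dim TYPE('e::real_normed_vector)"
  shows "jet_functor (jet1_at_0 :: (real^'p \<Rightarrow> 'e) \<Rightarrow> _) prolong1"
proof
  fix f g :: "real^'p \<Rightarrow> 'e" and \<tau> :: "'e \<Rightarrow> 'e" and S T e and w :: "'e^'p" and r :: real
  show "fst (jet1_at_0 f) = f 0" by (simp add: jet1_at_0_def)
  show "jet1_at_0 f = jet1_at_0 g" if "open S" "0 \<in> S" "\<And>u. u \<in> S \<Longrightarrow> f u = g u"
    using partial_cong_open[OF that] that(2,3) by (simp add: jet1_at_0_def)
  show "jet1_at_0 (\<lambda>u. \<tau> (f u)) = prolong1 \<tau> (jet1_at_0 f)"
    if "open S" "0 \<in> S" "smooth_on S f" "open T" "f 0 \<in> T" "smooth_on T \<tau>"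
    using partial_compose[OF smooth_on_differentiable[OF that(3,2)] smooth_on_differentiable[OF that(6,5)]]
    by (simp add: jet1_at_0_def prolong1_def)
  show "smooth_on (T \<times> UNIV) (prolong1 \<tau> :: 'e \<times> ('e^'p) \<Rightarrow> _)" if "open T" "smooth_on T \<tau>"
  proof -
    have op: "open (T \<times> (UNIV :: ('e^'p) set))" using that(1) by (simp add: open_Times)
    have fst: "smooth_on (T \<times> (UNIV :: ('e^'p) set)) fst"
      by (rule smooth_on_linear[OF bounded_linear_fst op])
    have im: "fst ` (T \<times> (UNIV :: ('e^'p) set)) \<subseteq> T" by auto
    have comp: "smooth_on (T \<times> (UNIV :: ('e^'p) set)) (\<lambda>p. snd p $ \<alpha>)" for \<alpha>
      by (rule smooth_on_bounded_linear[OF bounded_linear_vec_nth op smooth_on_linear[OF bounded_linear_snd op]])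
    show ?thesis
      unfolding prolong1_def
      by (intro smooth_on_Pair smooth_on_vec smooth_on_partial_along[OF fin op that fst im]
          smooth_on_compose[OF fin op that(1) im fst that(2)] comp op)
  qed
  show "\<exists>f. smooth_on UNIV f \<and> (\<forall>u. dist e (f u) < r) \<and> jet1_at_0 f = (e, w)" if r: "r > 0"
  proof -
    define Q where "Q u = (\<Sum>\<alpha>\<in>UNIV. (u $ \<alpha>) *\<^sub>R (w $ \<alpha>))" for u :: "real^'p"
    have bl: "bounded_linear Q"
      unfolding Q_def by (intro bounded_linear_sum bounded_linear_compose[OF bounded_linear_scaleR_left] bounded_linear_vec_nth)
    obtain K where K: "K \<ge> 0" "\<And>u. norm (Q u) \<le> norm u * K"
      using bounded_linear.nonneg_bounded[OF bl] by blast
    have "norm (Q u) \<le> K * (norm u + (norm u)\<^sup>2)" for u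
      using K(2)[of u] mult_nonneg_nonneg[OF K(1), of "(norm u)\<^sup>2"] by (simp add: algebra_simps)
    then obtain f where f: "smooth_on UNIV f" "\<forall>u. dist e (f u) < r" "f 0 = e" "\<And>v. partial v f 0 = partial v Q 0"
      using exists_small_map_with_derivatives[OF smooth_on_linear[OF bl open_UNIV] _ K(1) _ r, of e]
        linear_0[OF bounded_linear.linear[OF bl]] by blast
    have "partial (axis \<alpha> 1) f 0 = w $ \<alpha>" for \<alpha>
    proof -
      have "partial (axis \<alpha> 1) f 0 = Q (axis \<alpha> 1)"
        unfolding f(4) by (rule partial_eqI[OF bounded_linear_imp_has_derivative[OF bl]])
      also have "\<dots> = (\<Sum>\<beta>\<in>UNIV. if \<beta> = \<alpha> then w $ \<beta> else 0)"
        unfolding Q_def by (intro sum.cong) (auto simp: axis_def)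
      finally show ?thesis by simp
    qed
    then show ?thesis using f by (intro exI[of _ f]) (simp add: jet1_at_0_def)
  qed
  show "finite_dim TYPE('e^'p)" by (rule finite_dim_vec[OF fin])
qed

lemma jet_bundle_jet1:
  fixes N :: "('a, 'e::real_normed_vector) manifold"
  assumes "smooth_atlas N"
  shows "jet_bundle (jet1_at_0 :: (real^'p \<Rightarrow> 'e) \<Rightarrow> _) prolong1 N"
  unfolding jet_bundle_def using jet_functor_jet1[OF smooth_atlas.finite_dim_model[OF assms]] assms by blast

lemma jet1_eq:
  fixes N :: "('a, 'e::real_normed_vector) manifold" and \<phi> :: "real^'p \<Rightarrow> 'a"
  assumes "smooth_atlas N"
  shows "jet1 N \<phi> = jet_bundle.jet jet1_at_0 N \<phi>"
proof -
  interpret jet_bundle "jet1_at_0 :: (real^'p \<Rightarrow> 'e) \<Rightarrow> _" prolong1 N by (rule jet_bundle_jet1[OF assms])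
  show ?thesis
    unfolding jet1_def jet_def same_1jet_def jet1_at_0_def by (auto simp: vec_eq_iff)
qed

lemma jet1_coord_eq:
  fixes N :: "('a, 'e::real_normed_vector) manifold"
  assumes "smooth_atlas N"
  shows "(jet1_coord :: ('a \<Rightarrow> 'e) \<Rightarrow> _) = jet_bundle.coord (jet1_at_0 :: (real^'p \<Rightarrow> 'e) \<Rightarrow> _)"
proof (intro ext)
  fix x :: "'a \<Rightarrow> 'e" and J
  show "jet1_coord x J = jet_bundle.coord (jet1_at_0 :: (real^'p \<Rightarrow> 'e) \<Rightarrow> _) x J"
    unfolding jet_bundle.coord_def[OF jet_bundle_jet1[OF assms]]
    by (simp add: jet1_coord_def jet1_at_0_def Let_def)
qed

lemma J1_eq:
  fixes N :: "('a, 'e::real_normed_vector) manifold"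
  assumes "smooth_atlas N"
  shows "(J1 N :: ((real^'p \<Rightarrow> 'a) set, _) manifold) = jet_bundle.jets jet1_at_0 N"
proof -
  interpret jet_bundle "jet1_at_0 :: (real^'p \<Rightarrow> 'e) \<Rightarrow> _" prolong1 N by (rule jet_bundle_jet1[OF assms])
  show ?thesis
    unfolding J1_def jets_def over_def jet1_eq[OF assms] jet1_coord_eq[OF assms] by simp
qed

section \<open>Second-order jets\<close>

abbreviation sb_apply :: "('u::real_normed_vector, 'e::real_normed_vector) sym_bilinear \<Rightarrow> 'u \<Rightarrow> 'u \<Rightarrow> 'e" where
  "sb_apply B v w \<equiv> blinfun_apply (blinfun_apply (Rep_sym_bilinear B) v) w"

lemma sb_apply_commute: "sb_apply B v w = sb_apply B w v"
  using Rep_sym_bilinear[of B] by blast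

lemma sym_bilinear_eqI: "(\<And>v w. sb_apply A v w = sb_apply B v w) \<Longrightarrow> A = B"
  by (simp add: Rep_sym_bilinear_inject[symmetric] blinfun_eqI)

lemma linear_sb_apply: "linear (\<lambda>B. sb_apply B v w)"
  by (rule linearI) (simp_all add: plus_sym_bilinear.rep_eq scaleR_sym_bilinear.rep_eq blinfun.add_left blinfun.scaleR_left)

lemma bounded_linear_sb_apply: "bounded_linear (\<lambda>B. sb_apply B v w)"
proof (rule bounded_linear_intro[of _ "norm v * norm w"])
  fix B :: "('a, 'b) sym_bilinear"
  have "norm (sb_apply B v w) \<le> norm (blinfun_apply (Rep_sym_bilinear B) v) * norm w" by (rule norm_blinfun)
  also have "\<dots> \<le> (norm (Rep_sym_bilinear B) * norm v) * norm w"
    by (intro mult_right_mono norm_blinfun norm_ge_zero)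
  finally show "norm (sb_apply B v w) \<le> norm B * (norm v * norm w)"
    by (simp add: norm_sym_bilinear.rep_eq mult.assoc)
qed (simp_all add: linear_add[OF linear_sb_apply] linear_scale[OF linear_sb_apply])

lemma bounded_bilinear_sb_apply: "bounded_bilinear (sb_apply B)"
  by (rule bounded_bilinear.comp1[OF bounded_bilinear_blinfun_apply blinfun.bounded_linear_right])

text \<open>
  In finite dimension the conversions to bounded linear maps are harmless, and symmetry turns
  linearity in one argument into linearity in both.
\<close>

lemma sb_apply_Abs:
  fixes b :: "'u::euclidean_space \<Rightarrow> 'u \<Rightarrow> 'e::real_normed_vector"
  assumes right: "\<And>v. linear (b v)" and sym: "\<And>v w. b v w = b w v"
  shows "sb_apply (Abs_sym_bilinear (Blinfun (\<lambda>v. Blinfun (\<lambda>w. b v w)))) v w = b v w"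
proof -
  have bl: "bounded_linear (b v)" for v using right linear_conv_bounded_linear by blast
  have left: "linear (\<lambda>v. b v w)" for w using right[of w] by (subst sym)
  have "linear (\<lambda>v. Blinfun (b v))"
    by (rule linearI; rule blinfun_eqI)
       (simp_all add: bounded_linear_Blinfun_apply[OF bl] blinfun.add_left blinfun.scaleR_left
          linear_add[OF left] linear_scale[OF left])
  then have "bounded_linear (\<lambda>v. Blinfun (b v))" using linear_conv_bounded_linear by blast
  then have ap: "blinfun_apply (blinfun_apply (Blinfun (\<lambda>v. Blinfun (b v))) v) w = b v w" for v w
    by (simp add: bounded_linear_Blinfun_apply bl)
  have "Blinfun (\<lambda>v. Blinfun (b v)) \<in> {B. \<forall>v w. blinfun_apply (blinfun_apply B v) w = blinfun_apply (blinfun_apply B w) v}"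
    using sym by (simp add: ap)
  then show ?thesis by (simp add: Abs_sym_bilinear_inverse ap)
qed

lemma first_deriv_apply:
  assumes "f differentiable (at z)"
  shows "blinfun_apply (first_deriv f z) v = partial v f z"
  unfolding first_deriv_def
  by (rule bounded_linear_Blinfun_apply[THEN fun_cong])
     (rule has_derivative_bounded_linear[OF partial_has_derivative[OF assms]])

text \<open>
  Symmetry of second derivatives is what makes \<open>second_deriv\<close> meaningful: it provides the
  representation as a symmetric bilinear map.
\<close>

lemma second_deriv_apply:
  fixes f :: "'u::euclidean_space \<Rightarrow> 'e::real_normed_vector"
  assumes "finite_dim TYPE('e)" "open S" "z \<in> S" "smooth_on S f"
  shows "sb_apply (second_deriv f z) v w = partial v (partial w f) z"
  unfolding second_deriv_def
  by (rule sb_apply_Abs) (rule linear_partial_partial[OF assms(2,4,3)] partial_commute[OF assms(1,4,2,3)])+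

definition linear_unit :: "'u::euclidean_space \<Rightarrow> 'e::real_normed_vector \<Rightarrow> ('u \<Rightarrow>\<^sub>L 'e)" where
  "linear_unit i x = Blinfun (\<lambda>v. (v \<bullet> i) *\<^sub>R x)"

text \<open>
  The symmetrized elementary bilinear map, so that it is an element of the type for all \<open>i\<close> and \<open>j\<close>.
\<close>

definition bilinear_unit :: "'u::euclidean_space \<times> 'u \<Rightarrow> 'e::real_normed_vector \<Rightarrow> ('u, 'e) sym_bilinear" where
  "bilinear_unit = (\<lambda>(i, j) x. Abs_sym_bilinear (Blinfun (\<lambda>v. Blinfun (\<lambda>w.
     (((v \<bullet> i) * (w \<bullet> j) + (w \<bullet> i) * (v \<bullet> j)) / 2) *\<^sub>R x))))"

lemma linear_unit_apply: "blinfun_apply (linear_unit i x) v = (v \<bullet> i) *\<^sub>R x"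
  unfolding linear_unit_def
  by (subst bounded_linear_Blinfun_apply)
     (auto intro: bounded_linear_compose[OF bounded_linear_scaleR_left bounded_linear_inner_left])

lemma bilinear_unit_apply:
  "sb_apply (bilinear_unit (i, j) x) v w = (((v \<bullet> i) * (w \<bullet> j) + (w \<bullet> i) * (v \<bullet> j)) / 2) *\<^sub>R x"
  unfolding bilinear_unit_def prod.case
proof (rule sb_apply_Abs)
  show "linear (\<lambda>w. (((v \<bullet> i) * (w \<bullet> j) + (w \<bullet> i) * (v \<bullet> j)) / 2) *\<^sub>R x)" for v
    by (rule linearI) (simp_all add: inner_add_left algebra_simps add_divide_distrib)
qed (simp add: ac_simps)

lemma linear_linear_unit: "linear (linear_unit i)"
  by (rule linearI; rule blinfun_eqI)
     (simp_all add: linear_unit_apply blinfun.add_left blinfun.scaleR_left scaleR_add_right)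

lemma linear_bilinear_unit: "linear (bilinear_unit ij)"
  by (cases ij, rule linearI; rule sym_bilinear_eqI)
     (simp_all add: bilinear_unit_apply linear_add[OF linear_sb_apply] linear_scale[OF linear_sb_apply] scaleR_add_right)

lemma linear_expansion: "(\<Sum>i\<in>Basis. linear_unit i (blinfun_apply L i)) = L"
proof (rule blinfun_eqI)
  fix v
  have "blinfun_apply (\<Sum>i\<in>Basis. linear_unit i (blinfun_apply L i)) v = blinfun_apply L (\<Sum>i\<in>Basis. (v \<bullet> i) *\<^sub>R i)"
    by (simp add: blinfun.sum_left blinfun.sum_right blinfun.scaleR_right linear_unit_apply)
  then show "blinfun_apply (\<Sum>i\<in>Basis. linear_unit i (blinfun_apply L i)) v = blinfun_apply L v"
    by (simp add: euclidean_representation)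
qed

text \<open>
  Each unordered pair of distinct indices occurs twice in the sum, which compensates for the factor
  \<open>1/2\<close> of the symmetrization.
\<close>

lemma bilinear_expansion:
  fixes B :: "('u::euclidean_space, 'e::real_normed_vector) sym_bilinear"
  shows "(\<Sum>ij\<in>Basis \<times> Basis. bilinear_unit ij (sb_apply B (fst ij) (snd ij))) = B"
proof (rule sym_bilinear_eqI)
  fix v w :: 'u
  interpret bb: bounded_bilinear "sb_apply B" by (rule bounded_bilinear_sb_apply)
  have exp: "(\<Sum>ij\<in>Basis \<times> Basis. ((v \<bullet> fst ij) * (w \<bullet> snd ij)) *\<^sub>R sb_apply B (fst ij) (snd ij)) = sb_apply B v w" for v w
  proof -
    have "sb_apply B v w = sb_apply B (\<Sum>i\<in>Basis. (v \<bullet> i) *\<^sub>R i) (\<Sum>j\<in>Basis. (w \<bullet> j) *\<^sub>R j)"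
      by (simp only: euclidean_representation)
    also have "\<dots> = (\<Sum>i\<in>Basis. \<Sum>j\<in>Basis. ((v \<bullet> i) * (w \<bullet> j)) *\<^sub>R sb_apply B i j)"
      by (subst bb.sum_left)
         (simp only: bb.sum_right bb.scaleR_left bb.scaleR_right scaleR_scaleR scaleR_sum_right mult.commute)
    finally show ?thesis by (simp add: sum.cartesian_product case_prod_unfold)
  qed
  have "sb_apply (\<Sum>ij\<in>Basis \<times> Basis. bilinear_unit ij (sb_apply B (fst ij) (snd ij))) v w
      = (\<Sum>ij\<in>Basis \<times> Basis. sb_apply (bilinear_unit (fst ij, snd ij) (sb_apply B (fst ij) (snd ij))) v w)"
    by (simp add: linear_sum[OF linear_sb_apply])
  also have "\<dots> = (\<Sum>ij\<in>Basis \<times> Basis. (1/2) *\<^sub>R (((v \<bullet> fst ij) * (w \<bullet> snd ij)) *\<^sub>R sb_apply B (fst ij) (snd ij)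
      + ((w \<bullet> fst ij) * (v \<bullet> snd ij)) *\<^sub>R sb_apply B (fst ij) (snd ij)))"
    unfolding bilinear_unit_apply by (simp add: scaleR_add_left[symmetric])
  also have "\<dots> = (1/2) *\<^sub>R (sb_apply B v w + sb_apply B w v)"
    unfolding scaleR_sum_right[symmetric] sum.distrib exp ..
  also have "\<dots> = sb_apply B v w"
    by (simp add: sb_apply_commute[of B w v] scaleR_2[symmetric])
  finally show "sb_apply (\<Sum>ij\<in>Basis \<times> Basis. bilinear_unit ij (sb_apply B (fst ij) (snd ij))) v w = sb_apply B v w" .
qed

lemma finite_dim_blinfun:
  assumes "finite_dim TYPE('e::real_normed_vector)"
  shows "finite_dim TYPE('u::euclidean_space \<Rightarrow>\<^sub>L 'e)"
  by (rule finite_dim_if_sum_of_images[where I = Basis and T = linear_unit, OF assms finite_Basis linear_linear_unit]) (rule exI, rule linear_expansion)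

lemma finite_dim_sym_bilinear:
  assumes "finite_dim TYPE('e::real_normed_vector)"
  shows "finite_dim TYPE(('u::euclidean_space, 'e) sym_bilinear)"
  by (rule finite_dim_if_sum_of_images[where I = "Basis \<times> Basis" and T = bilinear_unit,
      OF assms finite_cartesian_product[OF finite_Basis finite_Basis] linear_bilinear_unit])
     (rule exI, rule bilinear_expansion)

definition jet2_at_0 ::
  "('u::euclidean_space \<Rightarrow> 'e::real_normed_vector) \<Rightarrow> 'e \<times> ('u \<Rightarrow>\<^sub>L 'e) \<times> ('u, 'e) sym_bilinear" where
  "jet2_at_0 f = (f 0, first_deriv f 0, second_deriv f 0)"

text \<open>
  The chain rule of second order, \<open>(e, L, B) \<mapsto> (\<tau>(e), D\<tau>(e) \<circ> L, D\<tau>(e) \<circ> B + D\<^sup>2\<tau>(e)(L, L))\<close>. Both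
  derivatives are written through their values on basis vectors, so that smoothness in \<open>(e, L, B)\<close>
  reduces to smoothness of functions with values in \<open>'e\<close>.
\<close>

definition prolong2 ::
  "('e::real_normed_vector \<Rightarrow> 'e) \<Rightarrow> 'e \<times> ('u::euclidean_space \<Rightarrow>\<^sub>L 'e) \<times> ('u, 'e) sym_bilinear
    \<Rightarrow> 'e \<times> ('u \<Rightarrow>\<^sub>L 'e) \<times> ('u, 'e) sym_bilinear" where
  "prolong2 \<tau> p =
     (\<tau> (fst p),
      (\<Sum>i\<in>Basis. linear_unit i (partial (blinfun_apply (fst (snd p)) i) \<tau> (fst p))),
      (\<Sum>ij\<in>Basis \<times> Basis. bilinear_unit ij
        (partial (sb_apply (snd (snd p)) (fst ij) (snd ij)) \<tau> (fst p) +
         partial (blinfun_apply (fst (snd p)) (fst ij)) (partial (blinfun_apply (fst (snd p)) (snd ij)) \<tau>) (fst p))))"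

lemma jet2_at_0_local:
  assumes "open S" "0 \<in> S" "\<And>u. u \<in> S \<Longrightarrow> f u = g u"
  shows "jet2_at_0 f = jet2_at_0 g"
proof -
  have 1: "partial v f u = partial v g u" if "u \<in> S" for u v
    by (rule partial_cong_open[OF assms(1) that assms(3)])
  have "partial v (partial w f) 0 = partial v (partial w g) 0" for v w
    by (rule partial_cong_open[OF assms(1,2) 1])
  then show ?thesis
    using 1[OF assms(2)] assms(2,3) by (simp add: jet2_at_0_def first_deriv_def second_deriv_def)
qed

lemma jet2_at_0_compose:
  fixes f :: "'u::euclidean_space \<Rightarrow> 'e::real_normed_vector" and \<tau> :: "'e \<Rightarrow> 'e"
  assumes fin: "finite_dim TYPE('e)" and S: "open S" "0 \<in> S" "smooth_on S f" and T: "open T" "f 0 \<in> T" "smooth_on T \<tau>"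
  shows "jet2_at_0 (\<lambda>u. \<tau> (f u)) = prolong2 \<tau> (jet2_at_0 f)"
proof -
  define S' where "S' = S \<inter> f -` T"
  have S': "open S'" "0 \<in> S'"
    unfolding S'_def using continuous_open_preimage[OF smooth_on_continuous_on[OF S(3)] S(1) T(1)] S T by auto
  have "smooth_on S' f" using S(3) smooth_on_subset unfolding S'_def by blast
  then have comp: "smooth_on S' (\<lambda>u. \<tau> (f u))"
    by (intro smooth_on_compose[OF fin S'(1) T(1) _ _ T(3)]) (auto simp: S'_def)
  have f0: "f differentiable (at 0)" "\<tau> differentiable (at (f 0))"
    using smooth_on_differentiable S T by blast+
  have "first_deriv (\<lambda>u. \<tau> (f u)) 0
      = (\<Sum>i\<in>Basis. linear_unit i (partial (blinfun_apply (first_deriv f 0) i) \<tau> (f 0)))"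
    by (subst linear_expansion[symmetric])
       (simp add: first_deriv_apply[OF smooth_on_differentiable[OF comp S'(2)]] first_deriv_apply[OF f0(1)] partial_compose[OF f0])
  moreover have "second_deriv (\<lambda>u. \<tau> (f u)) 0
      = (\<Sum>ij\<in>Basis \<times> Basis. bilinear_unit ij
          (partial (sb_apply (second_deriv f 0) (fst ij) (snd ij)) \<tau> (f 0) +
           partial (blinfun_apply (first_deriv f 0) (fst ij)) (partial (blinfun_apply (first_deriv f 0) (snd ij)) \<tau>) (f 0)))"
    by (subst bilinear_expansion[symmetric])
       (simp add: second_deriv_apply[OF fin S' comp] second_deriv_apply[OF fin S] first_deriv_apply[OF f0(1)]
          partial_partial_compose[OF fin S T])
  ultimately show ?thesis by (simp add: jet2_at_0_def prolong2_def)
qed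

lemma smooth_on_prolong2:
  fixes \<tau> :: "'e::real_normed_vector \<Rightarrow> 'e"
  assumes fin: "finite_dim TYPE('e)" and T: "open T" "smooth_on T \<tau>"
  shows "smooth_on (T \<times> UNIV) (prolong2 \<tau> :: 'e \<times> ('u::euclidean_space \<Rightarrow>\<^sub>L 'e) \<times> ('u, 'e) sym_bilinear \<Rightarrow> _)"
proof -
  let ?D = "T \<times> (UNIV :: (('u \<Rightarrow>\<^sub>L 'e) \<times> ('u, 'e) sym_bilinear) set)"
  have op: "open ?D" using T(1) by (simp add: open_Times)
  have fst: "smooth_on ?D fst" by (rule smooth_on_linear[OF bounded_linear_fst op])
  have im: "fst ` ?D \<subseteq> T" by auto
  have snd: "smooth_on ?D snd" by (rule smooth_on_linear[OF bounded_linear_snd op])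
  have L: "smooth_on ?D (\<lambda>p. blinfun_apply (fst (snd p)) v)" for v
    by (rule smooth_on_bounded_linear[OF blinfun.bounded_linear_left op smooth_on_bounded_linear[OF bounded_linear_fst op snd]])
  have B: "smooth_on ?D (\<lambda>p. sb_apply (snd (snd p)) v w)" for v w
    by (rule smooth_on_bounded_linear[OF bounded_linear_sb_apply op smooth_on_bounded_linear[OF bounded_linear_snd op snd]])
  have unit: "bounded_linear (linear_unit i :: 'e \<Rightarrow> 'u \<Rightarrow>\<^sub>L 'e)" "bounded_linear (bilinear_unit ij :: 'e \<Rightarrow> ('u, 'e) sym_bilinear)" for i ij
    using finite_dim_linear_bounded[OF fin] linear_linear_unit linear_bilinear_unit by blast+
  show ?thesis
    unfolding prolong2_def
    by (intro smooth_on_Pair smooth_on_sum smooth_on_bounded_linear[OF unit(1)] smooth_on_bounded_linear[OF unit(2)]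
        smooth_on_add smooth_on_compose[OF fin op T(1) im fst T(2)] smooth_on_partial_along[OF fin op T fst im]
        smooth_on_partial_partial_along[OF fin op T fst im] L B op)
qed

text \<open>
  The polynomial \<open>L u + B(u, u) / 2\<close> has the required derivatives at the origin and grows at most
  quadratically, so it can be damped.
\<close>

lemma jet2_at_0_realize:
  fixes e :: "'e::real_normed_vector" and L :: "'u::euclidean_space \<Rightarrow>\<^sub>L 'e" and B :: "('u, 'e) sym_bilinear"
  assumes fin: "finite_dim TYPE('e)" and "r > 0"
  shows "\<exists>f. smooth_on UNIV f \<and> (\<forall>u. dist e (f u) < r) \<and> jet2_at_0 f = (e, L, B)"
proof -
  define Q where "Q u = blinfun_apply L u + (1/2) *\<^sub>R sb_apply B u u" for u
  note bb = bounded_bilinear_sb_apply[of B]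
  have bl: "bounded_linear (blinfun_apply L)" "bounded_linear (\<lambda>z. sb_apply B z w)" for w
    by (rule blinfun.bounded_linear_right) (rule bounded_bilinear.bounded_linear_left[OF bb])
  have Q: "smooth_on UNIV Q"
    unfolding Q_def
    by (intro smooth_on_add open_UNIV smooth_on_linear[OF bl(1)] smooth_on_bounded_linear[OF bounded_linear_scaleR_right]
        smooth_on_bilinear[OF bb] smooth_on_id)
  have dQ: "partial w Q = (\<lambda>z. blinfun_apply L w + sb_apply B z w)" for w
  proof
    fix z
    have "(Q has_derivative (\<lambda>h. blinfun_apply L h + (1/2) *\<^sub>R (sb_apply B z h + sb_apply B h z))) (at z)"
      unfolding Q_def
      by (intro has_derivative_add bounded_linear_imp_has_derivative[OF bl(1)] has_derivative_scaleR_right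
          bounded_bilinear.FDERIV[OF bb] has_derivative_ident)
    from partial_eqI[OF this] show "partial w Q z = blinfun_apply L w + sb_apply B z w"
      by (simp add: sb_apply_commute[of B w z] scaleR_2[symmetric])
  qed
  have ddQ: "partial v (partial w Q) z = sb_apply B v w" for v w z
    unfolding dQ
    by (rule partial_eqI) (auto intro!: derivative_eq_intros bounded_linear_imp_has_derivative[OF bl(2)])
  have "norm (Q u) \<le> (norm L + norm B) * (norm u + (norm u)\<^sup>2)" for u
  proof -
    have "norm (sb_apply B u u) \<le> norm (blinfun_apply (Rep_sym_bilinear B) u) * norm u" by (rule norm_blinfun)
    also have "\<dots> \<le> (norm B * norm u) * norm u"
      unfolding norm_sym_bilinear.rep_eq by (intro mult_right_mono norm_blinfun norm_ge_zero)
    finally have "norm (sb_apply B u u) / 2 \<le> norm B * (norm u)\<^sup>2"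
      using norm_ge_zero[of "sb_apply B u u"] unfolding power2_eq_square mult.assoc by linarith
    moreover have "norm (Q u) \<le> norm (blinfun_apply L u) + norm (sb_apply B u u) / 2"
      unfolding Q_def using norm_triangle_ineq[of "blinfun_apply L u" "(1/2) *\<^sub>R sb_apply B u u"] by simp
    ultimately have "norm (Q u) \<le> norm L * norm u + norm B * (norm u)\<^sup>2"
      using norm_blinfun[of L u] by linarith
    also have "\<dots> \<le> (norm L + norm B) * (norm u + (norm u)\<^sup>2)"
      by (simp add: algebra_simps)
    finally show ?thesis .
  qed
  then obtain f where f: "smooth_on UNIV f" "\<forall>u. dist e (f u) < r" "f 0 = e" "\<And>v. partial v f 0 = partial v Q 0"
    "\<And>v w. partial v (partial w f) 0 = partial v (partial w Q) 0"
    using exists_small_map_with_derivatives[OF Q _ _ _ assms(2), of "norm L + norm B" e]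
    by (auto simp: Q_def blinfun.zero_right bounded_bilinear.zero_left[OF bb])
  have "first_deriv f 0 = L"
    by (rule blinfun_eqI)
       (simp add: first_deriv_apply[OF smooth_on_differentiable[OF f(1) UNIV_I]] f(4) dQ bounded_bilinear.zero_left[OF bb])
  moreover have "second_deriv f 0 = B"
    by (rule sym_bilinear_eqI) (simp add: second_deriv_apply[OF fin open_UNIV UNIV_I f(1)] f(5) ddQ)
  ultimately show ?thesis using f by (intro exI[of _ f]) (simp add: jet2_at_0_def)
qed

lemma jet_functor_jet2:
  assumes fin: "finite_dim TYPE('e::real_normed_vector)"
  shows "jet_functor (jet2_at_0 :: ('u::euclidean_space \<Rightarrow> 'e) \<Rightarrow> _) prolong2"
proof
  fix f g :: "'u \<Rightarrow> 'e" and \<tau> :: "'e \<Rightarrow> 'e" and S T e and w :: "('u \<Rightarrow>\<^sub>L 'e) \<times> ('u, 'e) sym_bilinear" and r :: real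
  show "fst (jet2_at_0 f) = f 0" by (simp add: jet2_at_0_def)
  show "\<exists>f. smooth_on UNIV f \<and> (\<forall>u. dist e (f u) < r) \<and> jet2_at_0 f = (e, w)" if "r > 0"
    using jet2_at_0_realize[OF fin that, of e "fst w" "snd w"] by simp
  show "finite_dim TYPE(('u \<Rightarrow>\<^sub>L 'e) \<times> ('u, 'e) sym_bilinear)"
    by (intro finite_dim_prod finite_dim_blinfun finite_dim_sym_bilinear fin)
qed (rule jet2_at_0_local jet2_at_0_compose[OF fin] smooth_on_prolong2[OF fin]; assumption)+

lemma jet_bundle_jet2:
  fixes N :: "('a, 'e::real_normed_vector) manifold"
  assumes "smooth_atlas N"
  shows "jet_bundle (jet2_at_0 :: ('u::euclidean_space \<Rightarrow> 'e) \<Rightarrow> _) prolong2 N"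
  unfolding jet_bundle_def using jet_functor_jet2[OF smooth_atlas.finite_dim_model[OF assms]] assms by blast

text \<open>
  Links the coordinates to the comparison of partial derivatives along basis vectors in the
  definition of 2-jets.
\<close>

lemma jet2_at_0_eq_iff:
  fixes f g :: "'u::euclidean_space \<Rightarrow> 'e::real_normed_vector"
  assumes fin: "finite_dim TYPE('e)" and S: "open S" "0 \<in> S" "smooth_on S f" and T: "open T" "0 \<in> T" "smooth_on T g"
  shows "jet2_at_0 f = jet2_at_0 g \<longleftrightarrow>
    f 0 = g 0 \<and> (\<forall>i\<in>Basis. partial i f 0 = partial i g 0) \<and>
    (\<forall>i\<in>Basis. \<forall>j\<in>Basis. partial i (partial j f) 0 = partial i (partial j g) 0)"
proof -
  note df = first_deriv_apply[OF smooth_on_differentiable[OF S(3,2)]] first_deriv_apply[OF smooth_on_differentiable[OF T(3,2)]]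
    and ddf = second_deriv_apply[OF fin S] second_deriv_apply[OF fin T]
  have "first_deriv f 0 = first_deriv g 0 \<longleftrightarrow> (\<forall>i\<in>Basis. partial i f 0 = partial i g 0)" (is "?l \<longleftrightarrow> ?r")
  proof
    assume ?l then show ?r using df by metis
  next
    assume r: ?r
    have "(\<Sum>i\<in>Basis. linear_unit i (blinfun_apply (first_deriv f 0) i)) = (\<Sum>i\<in>Basis. linear_unit i (blinfun_apply (first_deriv g 0) i))"
      by (rule sum.cong) (simp_all add: df r)
    then show ?l unfolding linear_expansion .
  qed
  moreover have "second_deriv f 0 = second_deriv g 0 \<longleftrightarrow>
      (\<forall>i\<in>Basis. \<forall>j\<in>Basis. partial i (partial j f) 0 = partial i (partial j g) 0)" (is "?l \<longleftrightarrow> ?r")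
  proof
    assume ?l then show ?r using ddf by metis
  next
    assume r: ?r
    have "(\<Sum>ij\<in>Basis \<times> Basis. bilinear_unit ij (sb_apply (second_deriv f 0) (fst ij) (snd ij)))
        = (\<Sum>ij\<in>Basis \<times> Basis. bilinear_unit ij (sb_apply (second_deriv g 0) (fst ij) (snd ij)))"
      by (rule sum.cong) (use r in \<open>auto simp: ddf\<close>)
    then show ?l unfolding bilinear_expansion .
  qed
  ultimately show ?thesis by (simp add: jet2_at_0_def)
qed

lemma jet2_eq:
  fixes N :: "('a, 'e::real_normed_vector) manifold" and \<phi> :: "'u::euclidean_space \<Rightarrow> 'a"
  assumes "smooth_atlas N" "smooth_param N \<phi>"
  shows "jet2 N \<phi> = jet_bundle.jet jet2_at_0 N \<phi>"
proof -
  interpret jet_bundle "jet2_at_0 :: ('u \<Rightarrow> 'e) \<Rightarrow> _" prolong2 N by (rule jet_bundle_jet2[OF assms(1)])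
  have iff: "jet2_at_0 (x \<circ> \<phi>) = jet2_at_0 (x \<circ> \<xi>) \<longleftrightarrow>
      (\<forall>i\<in>Basis. partial i (x \<circ> \<phi>) 0 = partial i (x \<circ> \<xi>) 0) \<and>
      (\<forall>i\<in>Basis. \<forall>j\<in>Basis. partial i (partial j (x \<circ> \<phi>)) 0 = partial i (partial j (x \<circ> \<xi>)) 0)"
    if "smooth_param N \<xi>" "\<phi> 0 = \<xi> 0" "(U, x) \<in> atlas N" "\<phi> 0 \<in> U" for \<xi> U x
    using jet2_at_0_eq_iff[OF finite_dim_model smooth_paramD(2)[OF assms(2) that(3)] _ smooth_paramD(3)[OF assms(2) that(3)]
        smooth_paramD(2)[OF that(1,3)] _ smooth_paramD(3)[OF that(1,3)]] that(2,4) by simp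
  show ?thesis
    unfolding jet2_def jet_def same_2jet_def
    by (rule Collect_cong) (use iff in blast)
qed

lemma J2_eq:
  fixes N :: "('a, 'e::real_normed_vector) manifold"
  assumes "smooth_atlas N"
  shows "(J2 N :: (('u::euclidean_space \<Rightarrow> 'a) set, _) manifold) = jet_bundle.jets jet2_at_0 N"
proof -
  interpret jet_bundle "jet2_at_0 :: ('u \<Rightarrow> 'e) \<Rightarrow> _" prolong2 N by (rule jet_bundle_jet2[OF assms])
  have "(jet2_coord x :: ('u \<Rightarrow> 'a) set \<Rightarrow> _) = coord x" for x :: "'a \<Rightarrow> 'e"
    by (simp add: fun_eq_iff jet2_coord_def coord_def jet2_at_0_def Let_def)
  moreover have sets: "{jet2 N \<phi> | \<phi> :: 'u \<Rightarrow> 'a. smooth_param N \<phi> \<and> P \<phi>} = {jet \<phi> | \<phi>. smooth_param N \<phi> \<and> P \<phi>}" for P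
    using jet2_eq[OF assms] by metis
  ultimately show ?thesis
    using sets[of "\<lambda>_. True"] unfolding J2_def jets_def over_def by simp
qed

section \<open>The quotient map\<close>

text \<open>
  The derivative of the opposite transition map is a right inverse, by the chain rule.
\<close>

lemma (in smooth_atlas) surj_transition_derivative:
  assumes "(U, x) \<in> atlas N" "(V, y) \<in> atlas N" "a \<in> U" "a \<in> V"
  shows "surj (frechet_derivative (y \<circ> inv_into U x) (at (x a)))"
proof (rule surjI)
  let ?\<tau> = "y \<circ> inv_into U x" and ?\<sigma> = "x \<circ> inv_into V y"
  have \<sigma>: "?\<sigma> (y a) = x a" using inj[OF assms(2)] assms(4) by (simp add: inv_into_f_f)
  have d: "?\<sigma> differentiable (at (y a))" "?\<tau> differentiable (at (?\<sigma> (y a)))"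
    unfolding \<sigma>
    using smooth_on_differentiable[OF smooth_transition[OF assms(2,1)]]
      smooth_on_differentiable[OF smooth_transition[OF assms(1,2)]] assms(3,4) by blast+
  fix v
  have "partial (partial v ?\<sigma> (y a)) ?\<tau> (x a) = partial v (\<lambda>p. ?\<tau> (?\<sigma> p)) (y a)"
    using partial_compose[OF d, of v, symmetric] unfolding \<sigma> .
  also have "\<dots> = partial v (\<lambda>p. p) (y a)"
  proof (rule partial_cong_open[OF open_overlap[OF assms(2,1)]])
    show "?\<tau> (?\<sigma> p) = p" if "p \<in> y ` (V \<inter> U)" for p
      using that inj[OF assms(1)] inj[OF assms(2)] by (auto simp: inv_into_f_f)
  qed (use assms in blast)
  also have "\<dots> = v" by (simp add: partial_def)
  finally show "frechet_derivative ?\<tau> (at (x a)) (partial v ?\<sigma> (y a)) = v" by (simp only: partial_def)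
qed

lemma smooth_param_reparametrize:
  fixes \<phi> :: "'u::euclidean_space \<Rightarrow> 'a" and g :: "'w::euclidean_space \<Rightarrow> 'u"
  assumes "smooth_atlas N" "smooth_param N \<phi>" "smooth_on UNIV g"
  shows "smooth_param N (\<lambda>u. \<phi> (g u))"
  unfolding smooth_param_iff[OF assms(1)]
proof (intro conjI allI impI)
  note \<phi> = assms(2)[unfolded smooth_param_iff[OF assms(1)]]
  show "\<phi> (g u) \<in> points N" for u using \<phi> by blast
  fix U x assume U: "(U, x) \<in> atlas N"
  then have op: "open (\<phi> -` U)" and sm: "smooth_on (\<phi> -` U) (x \<circ> \<phi>)" using \<phi> by blast+
  have "open (g -` (\<phi> -` U))"
    using continuous_open_preimage[OF smooth_on_continuous_on[OF assms(3)] open_UNIV op] by simp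
  then show op': "open ((\<lambda>u. \<phi> (g u)) -` U)" by (simp add: vimage_def)
  have "smooth_on ((\<lambda>u. \<phi> (g u)) -` U) (\<lambda>u. (x \<circ> \<phi>) (g u))"
    by (rule smooth_on_compose[OF finite_dim_euclidean op' op _ smooth_on_subset[OF assms(3) subset_UNIV] sm]) auto
  then show "smooth_on ((\<lambda>u. \<phi> (g u)) -` U) (x \<circ> (\<lambda>u. \<phi> (g u)))" by (simp add: o_def)
qed

lemma smooth_on_insert_left: "smooth_on S (\<lambda>v. (u, v))"
  by (rule smooth_on_subset[OF smooth_on_Pair[OF open_UNIV smooth_on_const smooth_on_id] subset_UNIV])

lemma smooth_on_insert_right: "smooth_on S (\<lambda>u. (u, v))"
  by (rule smooth_on_subset[OF smooth_on_Pair[OF open_UNIV smooth_on_id smooth_on_const] subset_UNIV])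

lemma partial_slice_right:
  assumes "g differentiable (at (u, v))"
  shows "partial a (\<lambda>v. g (u, v)) v = partial (0, a) g (u, v)"
proof -
  have "((\<lambda>v. (u, v)) has_derivative (\<lambda>h. (0, h))) (at v)"
    by (intro has_derivative_Pair has_derivative_const has_derivative_ident)
  from partial_eqI[OF has_derivative_compose[OF this partial_has_derivative[OF assms]]]
  show ?thesis .
qed

lemma partial_slice_left:
  assumes "g differentiable (at (u, v))"
  shows "partial a (\<lambda>u. g (u, v)) u = partial (a, 0) g (u, v)"
proof -
  have "((\<lambda>u. (u, v)) has_derivative (\<lambda>h. (h, 0))) (at u)"
    by (intro has_derivative_Pair has_derivative_const has_derivative_ident)
  from partial_eqI[OF has_derivative_compose[OF this partial_has_derivative[OF assms]]]
  show ?thesis .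
qed

text \<open>
  Partial derivatives of the slice \<open>v \<mapsto> \<phi>(u,v)\<close> at \<open>0\<close> are partial derivatives of \<open>\<phi>\<close> at \<open>(u,0)\<close>. The
  right-hand side is therefore visibly smooth in \<open>u\<close>.
\<close>

lemma coord_partial_jet:
  fixes M :: "('a, 'e::real_normed_vector) manifold" and \<phi> :: "(real^'p) \<times> (real^'p) \<Rightarrow> 'a"
  assumes M: "smooth_atlas M" and \<phi>: "smooth_param M \<phi>" and U: "(U, x) \<in> atlas M" and u: "\<phi> (u, 0) \<in> U"
  shows "jet1_coord x (partial_jet M \<phi> u) =
    ((x \<circ> \<phi>) (u, 0), \<chi> \<alpha>. partial (0, axis \<alpha> 1) (x \<circ> \<phi>) (u, 0))"
proof -
  interpret A: jet_bundle "jet1_at_0 :: (real^'p \<Rightarrow> 'e) \<Rightarrow> _" prolong1 M by (rule jet_bundle_jet1[OF M])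
  have "smooth_param M (\<lambda>v. \<phi> (u, v))"
    by (rule smooth_param_reparametrize[OF M \<phi> smooth_on_insert_left])
  then have "jet1_coord x (partial_jet M \<phi> u) = jet1_at_0 (\<lambda>v. (x \<circ> \<phi>) (u, v))"
    unfolding partial_jet_def jet1_eq[OF M] jet1_coord_eq[OF M]
    by (subst A.coord_jet[OF _ U]) (simp_all add: u o_def)
  moreover have "(x \<circ> \<phi>) differentiable (at (u, 0))"
    using \<phi> U u smooth_on_differentiable unfolding smooth_param_iff[OF M] by blast
  ultimately show ?thesis by (simp only: jet1_at_0_def partial_slice_right)
qed

lemma smooth_on_partial_jet_coords:
  fixes g :: "(real^'p) \<times> (real^'p) \<Rightarrow> 'e::real_normed_vector"
  assumes "open W" "smooth_on W g"
  shows "smooth_on ((\<lambda>u. (u, 0)) -` W) (\<lambda>u. (g (u, 0), \<chi> \<alpha>. partial (0, axis \<alpha> 1) g (u, 0)))"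
proof -
  have op: "open ((\<lambda>u. (u, 0)) -` W :: (real^'p) set)"
    using continuous_open_preimage[OF smooth_on_continuous_on[OF smooth_on_insert_right] open_UNIV assms(1)] by simp
  have comp: "smooth_on ((\<lambda>u. (u, 0)) -` W) (\<lambda>u. h (u, 0))" if "smooth_on W h"
    for h :: "(real^'p) \<times> (real^'p) \<Rightarrow> 'e"
    by (rule smooth_on_compose[OF finite_dim_euclidean op assms(1) _ smooth_on_insert_right that]) auto
  show ?thesis
    by (intro smooth_on_Pair smooth_on_vec op comp smooth_on_partial assms(2))
qed

lemma smooth_param_partial_jet:
  fixes M :: "('a, 'e::real_normed_vector) manifold" and \<phi> :: "(real^'p) \<times> (real^'p) \<Rightarrow> 'a"
  assumes M: "smooth_atlas M" and \<phi>: "smooth_param M \<phi>"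
  shows "smooth_param (J1 M) (partial_jet M \<phi>)"
proof -
  interpret A: jet_bundle "jet1_at_0 :: (real^'p \<Rightarrow> 'e) \<Rightarrow> _" prolong1 M by (rule jet_bundle_jet1[OF M])
  have slice: "smooth_param M (\<lambda>v. \<phi> (u, v))" for u
    by (rule smooth_param_reparametrize[OF M \<phi> smooth_on_insert_left])
  have pj: "partial_jet M \<phi> u = A.jet (\<lambda>v. \<phi> (u, v))" for u
    by (simp add: partial_jet_def jet1_eq[OF M])
  have "smooth_param A.jets (partial_jet M \<phi>)"
    unfolding smooth_param_iff[OF A.smooth_atlas_jets]
  proof (intro conjI allI impI)
    show "partial_jet M \<phi> u \<in> points A.jets" for u
      unfolding A.points_jets pj using A.jet_mem_over[OF slice] A.smooth_paramD(1)[OF slice] by blast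
    fix U' x' assume "(U', x') \<in> atlas A.jets"
    then obtain U x where U: "(U, x) \<in> atlas M" "U' = A.over U" "x' = A.coord x" unfolding A.atlas_jets by blast
    have W: "open (\<phi> -` U)" "smooth_on (\<phi> -` U) (x \<circ> \<phi>)"
      using \<phi> U(1) unfolding smooth_param_iff[OF M] by blast+
    have dom: "partial_jet M \<phi> -` U' = (\<lambda>u. (u, 0)) -` (\<phi> -` U)"
      unfolding U(2) vimage_def pj by (simp add: A.jet_mem_over[OF slice])
    show op: "open (partial_jet M \<phi> -` U')"
      unfolding dom
      using continuous_open_preimage[OF smooth_on_continuous_on[OF smooth_on_insert_right] open_UNIV W(1)] by simp
    show "smooth_on (partial_jet M \<phi> -` U') (x' \<circ> partial_jet M \<phi>)"
    proof (subst smooth_on_cong[OF op])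
      show "(x' \<circ> partial_jet M \<phi>) u = ((x \<circ> \<phi>) (u, 0), \<chi> \<alpha>. partial (0, axis \<alpha> 1) (x \<circ> \<phi>) (u, 0))"
        if "u \<in> partial_jet M \<phi> -` U'" for u
        using coord_partial_jet[OF M \<phi> U(1)] that
        unfolding dom U(3) jet1_coord_eq[OF M, symmetric] by simp
    qed (unfold dom, rule smooth_on_partial_jet_coords[OF W])
  qed
  then show ?thesis by (simp add: J1_eq[OF M])
qed

text \<open>
  The coordinate representation of \<open>\<Lambda>\<close> over a single chart of \<open>M\<close>. The outer index \<open>\<beta>\<close> belongs to the
  jet in \<open>u\<close>, the inner index \<open>\<alpha>\<close> to the jet in \<open>v\<close>.
\<close>

definition iterated_coords ::
  "'e \<times> (((real^'p) \<times> (real^'p)) \<Rightarrow>\<^sub>L 'e) \<times> ((real^'p) \<times> (real^'p), 'e::real_normed_vector) sym_bilinear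
    \<Rightarrow> ('e \<times> ('e^'p)) \<times> (('e \<times> ('e^'p))^'p)" where
  "iterated_coords = (\<lambda>(e, L, B).
     ((e, \<chi> \<alpha>. blinfun_apply L (0, axis \<alpha> 1)),
      \<chi> \<beta>. (blinfun_apply L (axis \<beta> 1, 0), \<chi> \<alpha>. sb_apply B (axis \<beta> 1, 0) (0, axis \<alpha> 1))))"

lemma linear_iterated_coords: "linear iterated_coords"
  by (rule linearI)
     (auto simp: iterated_coords_def vec_eq_iff blinfun.add_left blinfun.scaleR_left
        linear_add[OF linear_sb_apply] linear_scale[OF linear_sb_apply])

text \<open>
  The preimage is explicit: \<open>L\<close> has the prescribed values on the two coordinate subspaces, and \<open>B\<close> is
  the symmetric bilinear map with the prescribed mixed part that vanishes on pairs from the same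
  coordinate subspace.
\<close>

lemma surj_iterated_coords:
  "surj (iterated_coords :: _ \<Rightarrow> ('e::real_normed_vector \<times> ('e^'p)) \<times> (('e \<times> ('e^'p))^'p))"
proof (unfold surj_def, rule allI)
  fix q :: "('e \<times> ('e^'p)) \<times> (('e \<times> ('e^'p))^'p)"
  obtain e w z where q: "q = ((e, w), z)" by (metis surj_pair)
  define l where "l p = (\<Sum>\<alpha>\<in>UNIV. (snd p $ \<alpha>) *\<^sub>R (w $ \<alpha>)) + (\<Sum>\<beta>\<in>UNIV. (fst p $ \<beta>) *\<^sub>R fst (z $ \<beta>))"
    for p :: "(real^'p) \<times> (real^'p)"
  define b where "b p p' = (\<Sum>\<beta>\<in>UNIV. \<Sum>\<alpha>\<in>UNIV.
      ((fst p $ \<beta>) * (snd p' $ \<alpha>) + (fst p' $ \<beta>) * (snd p $ \<alpha>)) *\<^sub>R (snd (z $ \<beta>) $ \<alpha>))"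
    for p p' :: "(real^'p) \<times> (real^'p)"
  have "linear l"
    by (rule linearI) (simp_all add: l_def algebra_simps sum.distrib scaleR_sum_right)
  then have l: "blinfun_apply (Blinfun l) = l"
    by (simp add: bounded_linear_Blinfun_apply linear_conv_bounded_linear)
  have "linear (b p)" for p
    by (rule linearI) (simp_all add: b_def algebra_simps sum.distrib scaleR_sum_right)
  moreover have "b p p' = b p' p" for p p' by (simp add: b_def add.commute)
  ultimately have b: "sb_apply (Abs_sym_bilinear (Blinfun (\<lambda>p. Blinfun (\<lambda>p'. b p p')))) p p' = b p p'" for p p'
    by (rule sb_apply_Abs)
  have delta: "(\<Sum>\<alpha>\<in>UNIV. (axis \<beta> (1::real) $ \<alpha>) *\<^sub>R h \<alpha>) = h \<beta>" for h :: "'p \<Rightarrow> 'e" and \<beta>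
  proof -
    have "(\<Sum>\<alpha>\<in>UNIV. (axis \<beta> (1::real) $ \<alpha>) *\<^sub>R h \<alpha>) = (\<Sum>\<alpha>\<in>UNIV. if \<alpha> = \<beta> then h \<alpha> else 0)"
      by (intro sum.cong) (auto simp: axis_def)
    then show ?thesis by simp
  qed
  have "b (axis \<beta> 1, 0) (0, axis \<alpha> 1) = snd (z $ \<beta>) $ \<alpha>" for \<alpha> \<beta>
  proof -
    have "b (axis \<beta> 1, 0) (0, axis \<alpha> 1) = (\<Sum>\<beta>'\<in>UNIV. (axis \<beta> (1::real) $ \<beta>') *\<^sub>R (\<Sum>\<alpha>'\<in>UNIV. (axis \<alpha> (1::real) $ \<alpha>') *\<^sub>R (snd (z $ \<beta>') $ \<alpha>')))"
      by (simp add: b_def scaleR_sum_right)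
    then show ?thesis by (simp only: delta)
  qed
  moreover have "l (0, axis \<alpha> 1) = w $ \<alpha>" "l (axis \<alpha> 1, 0) = fst (z $ \<alpha>)" for \<alpha>
    by (simp_all add: l_def delta)
  ultimately have "q = iterated_coords
      (e, Blinfun l, Abs_sym_bilinear (Blinfun (\<lambda>p. Blinfun (\<lambda>p'. b p p'))))"
    by (simp add: iterated_coords_def q l b vec_eq_iff prod_eq_iff)
  then show "\<exists>p. q = iterated_coords p" ..
qed

text \<open>
  In coordinates \<open>\<Phi>\<close> is \<open>u \<mapsto> (g(u,0), (\<partial>\<^sub>(\<^sub>0\<^sub>,\<^sub>\<alpha>\<^sub>) g(u,0))\<^sub>\<alpha>)\<close> with \<open>g = x \<circ> \<phi>\<close>, and its
  derivatives at \<open>0\<close> along \<open>\<beta>\<close> are derivatives of \<open>g\<close> along \<open>(\<beta>,0)\<close>.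
\<close>

lemma jet1_at_0_partial_jet:
  fixes M :: "('a, 'e::real_normed_vector) manifold" and \<phi> :: "(real^'p) \<times> (real^'p) \<Rightarrow> 'a"
  assumes M: "smooth_atlas M" and \<phi>: "smooth_param M \<phi>" and U: "(U, x) \<in> atlas M" "\<phi> 0 \<in> U"
  shows "jet1_at_0 (jet1_coord x \<circ> partial_jet M \<phi>) = iterated_coords (jet2_at_0 (x \<circ> \<phi>))"
proof -
  define g where "g = x \<circ> \<phi>"
  define S where "S = (\<lambda>u. (u, 0)) -` (\<phi> -` U)"
  define h where "h u = (g (u, 0), \<chi> \<alpha>. partial (0, axis \<alpha> 1) g (u, 0))" for u :: "real^'p"
  have fin: "finite_dim TYPE('e)" using M by (rule smooth_atlas.finite_dim_model)
  have W: "open (\<phi> -` U)" "0 \<in> \<phi> -` U" "smooth_on (\<phi> -` U) g"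
    using \<phi> U unfolding smooth_param_iff[OF M] g_def by auto
  have S: "open S" "0 \<in> S"
    unfolding S_def
    using continuous_open_preimage[OF smooth_on_continuous_on[OF smooth_on_insert_right] open_UNIV W(1)] W(2)
    by (simp_all add: zero_prod_def)
  have h: "(jet1_coord x \<circ> partial_jet M \<phi>) u = h u" if "u \<in> S" for u
    using that coord_partial_jet[OF M \<phi> U(1)] by (simp add: S_def h_def g_def)
  have "h differentiable (at 0)"
    unfolding h_def
    by (rule smooth_on_differentiable[OF smooth_on_partial_jet_coords[OF W(1,3)] S(2)[unfolded S_def]])
  note comp = partial_bounded_linear[OF _ this]
  have d: "g differentiable (at (0, 0))" "partial w g differentiable (at (0, 0))" for w
    using smooth_on_differentiable[OF W(3,2)] smooth_on_differentiable[OF smooth_on_partial[OF W(3)] W(2)]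
    by (simp_all add: zero_prod_def)
  have "fst (partial (axis \<beta> 1) h 0) = partial (axis \<beta> 1, 0) g (0, 0)" for \<beta>
    using comp[OF bounded_linear_fst] partial_slice_left[OF d(1)] by (simp add: h_def)
  moreover have "snd (partial (axis \<beta> 1) h 0) $ \<alpha> = partial (axis \<beta> 1, 0) (partial (0, axis \<alpha> 1) g) (0, 0)" for \<alpha> \<beta>
    using comp[OF bounded_linear_compose[OF bounded_linear_vec_nth bounded_linear_snd]] partial_slice_left[OF d(2)]
    by (simp add: h_def)
  ultimately have "jet1_at_0 h =
      ((g 0, \<chi> \<alpha>. partial (0, axis \<alpha> 1) g 0),
        \<chi> \<beta>. (partial (axis \<beta> 1, 0) g 0, \<chi> \<alpha>. partial (axis \<beta> 1, 0) (partial (0, axis \<alpha> 1) g) 0))"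
    by (simp add: jet1_at_0_def h_def[of 0] vec_eq_iff prod_eq_iff zero_prod_def)
  also have "\<dots> = iterated_coords (jet2_at_0 g)"
    by (simp add: iterated_coords_def jet2_at_0_def first_deriv_apply[OF smooth_on_differentiable[OF W(3,2)]]
        second_deriv_apply[OF fin W])
  moreover have "jet1_at_0 (jet1_coord x \<circ> partial_jet M \<phi>) = jet1_at_0 h"
    using jet_functor.jet_coords_local[OF jet_functor_jet1[OF finite_dim_prod[OF fin finite_dim_vec[OF fin]]] S] h by blast
  ultimately show ?thesis by (simp add: g_def)
qed

theorem proposition7:
  fixes M :: "('a, 'e::real_normed_vector) manifold"
  assumes "smooth_manifold M"
  shows "\<exists>\<Lambda> :: ((real^'p) \<times> (real^'p) \<Rightarrow> 'a) set \<Rightarrow> (real^'p \<Rightarrow> (real^'p \<Rightarrow> 'a) set) set.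
           (\<forall>\<phi>. smooth_param M \<phi> \<longrightarrow>
              smooth_param (J1 M) (partial_jet M \<phi>) \<and>
              \<Lambda> (jet2 M \<phi>) = jet1 (J1 M) (partial_jet M \<phi>)) \<and>
           quotient_manifold (J2 M) (J1 (J1 M)) \<Lambda>"
proof -
  have M: "smooth_atlas M" using assms unfolding smooth_manifold_iff by blast
  interpret A: jet_bundle "jet1_at_0 :: (real^'p \<Rightarrow> 'e) \<Rightarrow> _" prolong1 M by (rule jet_bundle_jet1[OF M])
  note J1M = J1_eq[OF M, where 'p = 'p] and coordA = jet1_coord_eq[OF M, where 'p = 'p]
  interpret I: jet_bundle "jet1_at_0 :: (real^'p \<Rightarrow> 'e \<times> ('e^'p)) \<Rightarrow> _" prolong1 A.jets
    by (rule jet_bundle_jet1[OF A.smooth_atlas_jets])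
  interpret B: jet_bundle "jet2_at_0 :: ((real^'p) \<times> (real^'p) \<Rightarrow> 'e) \<Rightarrow> _" prolong2 M by (rule jet_bundle_jet2[OF M])
  interpret BJ: smooth_atlas B.jets by (rule B.smooth_atlas_jets)
  have J1J1M: "J1 (J1 M) = I.jets" unfolding J1M by (rule J1_eq[OF A.smooth_atlas_jets])
  have J2M: "J2 M = B.jets" by (rule J2_eq[OF M])

  have pj: "smooth_param A.jets (partial_jet M \<phi>)" if "smooth_param M \<phi>" for \<phi> :: "(real^'p) \<times> (real^'p) \<Rightarrow> 'a"
    using smooth_param_partial_jet[OF M that] by (simp add: J1M)
  have pj0: "partial_jet M \<phi> 0 \<in> A.over V \<longleftrightarrow> \<phi> 0 \<in> V" if "smooth_param M \<phi>" for \<phi> V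
  proof -
    have "partial_jet M \<phi> 0 = A.jet (\<lambda>v. \<phi> (0, v))" by (simp add: partial_jet_def jet1_eq[OF M])
    then show ?thesis
      using A.jet_mem_over[OF smooth_param_reparametrize[OF M that smooth_on_insert_left]] by (simp add: zero_prod_def)
  qed
  have chartI: "(A.over U, A.coord x) \<in> atlas A.jets" if "(U, x) \<in> atlas M" for U x
    using that unfolding A.atlas_jets by blast
  have coords: "jet1_at_0 (A.coord x \<circ> partial_jet M \<phi>) = iterated_coords (jet2_at_0 (x \<circ> \<phi>))"
    if "smooth_param M \<phi>" "(U, x) \<in> atlas M" "\<phi> 0 \<in> U" for \<phi> U x
    using jet1_at_0_partial_jet[OF M that] by (simp add: coordA)

  \<comment> \<open>An arbitrary representative of the 2-jet is used; independence of the choice follows.\<close>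
  define \<Lambda> :: "((real^'p) \<times> (real^'p) \<Rightarrow> 'a) set \<Rightarrow> (real^'p \<Rightarrow> (real^'p \<Rightarrow> 'a) set) set"
    where "\<Lambda> J = I.jet (partial_jet M (SOME \<phi>. \<phi> \<in> J))" for J
  have \<Lambda>: "\<Lambda> (B.jet \<phi>) = I.jet (partial_jet M \<phi>)" if \<phi>: "smooth_param M \<phi>" for \<phi>
  proof -
    define \<xi> where "\<xi> = (SOME \<xi>. \<xi> \<in> B.jet \<phi>)"
    have "\<xi> \<in> B.jet \<phi>"
      unfolding \<xi>_def by (rule someI[of "\<lambda>\<xi>. \<xi> \<in> B.jet \<phi>", OF B.self_in_jet[OF \<phi>]])
    then have \<xi>: "smooth_param M \<xi>" "\<phi> 0 = \<xi> 0"
      "\<And>U x. (U, x) \<in> atlas M \<Longrightarrow> \<phi> 0 \<in> U \<Longrightarrow> jet2_at_0 (x \<circ> \<phi>) = jet2_at_0 (x \<circ> \<xi>)"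
      unfolding B.jet_def by blast+
    obtain U x where U: "(U, x) \<in> atlas M" "\<phi> 0 \<in> U" using A.chart_around B.smooth_paramD(1)[OF \<phi>] by blast
    have "I.jet (partial_jet M \<phi>) = I.jet (partial_jet M \<xi>)"
    proof (rule I.jet_eqI[OF pj[OF \<phi>] pj[OF \<xi>(1)] chartI[OF U(1)]])
      show "partial_jet M \<phi> 0 \<in> A.over U" "partial_jet M \<xi> 0 \<in> A.over U"
        using U(2) \<xi>(2) by (simp_all add: pj0 \<phi> \<xi>(1))
      show "jet1_at_0 (A.coord x \<circ> partial_jet M \<phi>) = jet1_at_0 (A.coord x \<circ> partial_jet M \<xi>)"
        using coords[OF \<phi> U] coords[OF \<xi>(1) U(1)] U(2) \<xi>(2) \<xi>(3)[OF U] by simp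
    qed
    then show ?thesis unfolding \<Lambda>_def \<xi>_def by simp
  qed

  \<comment> \<open>\<open>\<Lambda>\<close> preserves base points.\<close>
  have dom: "B.over U \<inter> \<Lambda> -` I.over (A.over V) = B.over (U \<inter> V)" for U V
  proof -
    have "j \<in> B.over U \<inter> \<Lambda> -` I.over (A.over V) \<longleftrightarrow> j \<in> B.over (U \<inter> V)" if j: "j \<in> B.over UNIV" for j
    proof -
      obtain \<phi> where \<phi>: "j = B.jet \<phi>" "smooth_param M \<phi>" using j unfolding B.over_def by blast
      show ?thesis
        by (simp add: \<phi> \<Lambda> B.jet_mem_over I.jet_mem_over pj pj0)
    qed
    moreover have "B.over W \<subseteq> B.over UNIV" for W unfolding B.over_def by blast
    ultimately show ?thesis by blast
  qed

  define transition where "transition U x y = B.coord y \<circ> inv_into (B.over U) (B.coord x)" for U and x y :: "'a \<Rightarrow> 'e"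
  have chartB: "(B.over U, B.coord x) \<in> atlas B.jets" if "(U, x) \<in> atlas M" for U x
    using that unfolding B.atlas_jets by blast
  \<comment> \<open>In charts of \<open>M\<close> that may differ, \<open>\<Lambda>\<close> is represented by the linear map after a transition map of
    \<open>J2 M\<close>.\<close>
  have rep: "(I.coord (A.coord y) \<circ> \<Lambda> \<circ> inv_into (B.over U) (B.coord x)) p = iterated_coords (transition U x y p)"
    if U: "(U, x) \<in> atlas M" and V: "(V, y) \<in> atlas M" and p: "p \<in> B.coord x ` B.over (U \<inter> V)" for U x V y p
  proof -
    obtain \<phi> where \<phi>: "smooth_param M \<phi>" "\<phi> 0 \<in> U" "\<phi> 0 \<in> V" "p = B.coord x (B.jet \<phi>)"
      using p unfolding B.over_def by blast
    have inv: "inv_into (B.over U) (B.coord x) p = B.jet \<phi>"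
      unfolding \<phi>(4) by (rule inv_into_f_f[OF B.inj_coord[OF U]]) (simp add: B.jet_mem_over \<phi>)
    have "I.coord (A.coord y) (I.jet (partial_jet M \<phi>)) = jet1_at_0 (A.coord y \<circ> partial_jet M \<phi>)"
      by (rule I.coord_jet[OF pj[OF \<phi>(1)] chartI[OF V]]) (simp add: pj0 \<phi>)
    then show ?thesis
      by (simp add: inv \<Lambda>[OF \<phi>(1)] transition_def coords[OF \<phi>(1) V \<phi>(3)] B.coord_jet[OF \<phi>(1) V \<phi>(3)])
  qed
  have fin2: "finite_dim TYPE('e \<times> (((real^'p) \<times> (real^'p)) \<Rightarrow>\<^sub>L 'e) \<times> ((real^'p) \<times> (real^'p), 'e) sym_bilinear)"
    by (rule BJ.finite_dim_model)
  have bl: "bounded_linear (iterated_coords :: _ \<Rightarrow> ('e \<times> ('e^'p)) \<times> (('e \<times> ('e^'p))^'p))"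
    by (rule finite_dim_linear_bounded[OF fin2 linear_iterated_coords])
  have domain_open: "open (B.coord x ` B.over (U \<inter> V))" if "(U, x) \<in> atlas M" "(V, y) \<in> atlas M" for U x V y
    using BJ.open_overlap[OF chartB[OF that(1)] chartB[OF that(2)]] by (simp add: B.over_Int)
  have smooth_rep: "smooth_on (B.coord x ` B.over (U \<inter> V)) (transition U x y)"
    if "(U, x) \<in> atlas M" "(V, y) \<in> atlas M" for U x V y
    using BJ.smooth_transition[OF chartB[OF that(1)] chartB[OF that(2)]] by (simp add: B.over_Int transition_def)

  have smooth: "smooth_map B.jets I.jets \<Lambda>"
  proof (rule smooth_mapI[OF B.smooth_atlas_jets I.smooth_atlas_jets])
    show "\<Lambda> ` points B.jets \<subseteq> points I.jets"
      by (auto simp: B.jets_def I.jets_def \<Lambda> intro: pj)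
    fix U' x' V' y' assume "(U', x') \<in> atlas B.jets" "(V', y') \<in> atlas I.jets"
    then obtain U x V y where U: "(U, x) \<in> atlas M" "U' = B.over U" "x' = B.coord x"
      and V: "(V, y) \<in> atlas M" "V' = I.over (A.over V)" "y' = I.coord (A.coord y)"
      unfolding B.atlas_jets I.atlas_jets A.atlas_jets by blast
    show op: "open (x' ` (U' \<inter> \<Lambda> -` V'))"
      unfolding U(2,3) V(2) dom by (rule domain_open[OF U(1) V(1)])
    show "smooth_on (x' ` (U' \<inter> \<Lambda> -` V')) (y' \<circ> \<Lambda> \<circ> inv_into U' x')"
      unfolding U(2,3) V(2,3) dom
      by (subst smooth_on_cong[OF domain_open[OF U(1) V(1)] rep[OF U(1) V(1)]])
         (assumption, rule smooth_on_bounded_linear[OF bl domain_open[OF U(1) V(1)] smooth_rep[OF U(1) V(1)]])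
  qed

  have rank: "surj (frechet_derivative (y' \<circ> \<Lambda> \<circ> inv_into U' x') (at (x' a)))"
    if c: "(U', x') \<in> atlas B.jets" "(V', y') \<in> atlas I.jets" and a': "a \<in> U' \<inter> \<Lambda> -` V'" for U' x' V' y' a
  proof -
    obtain U x V y where U: "(U, x) \<in> atlas M" "U' = B.over U" "x' = B.coord x"
      and V: "(V, y) \<in> atlas M" "V' = I.over (A.over V)" "y' = I.coord (A.coord y)"
      using c unfolding B.atlas_jets I.atlas_jets A.atlas_jets by blast
    have a: "a \<in> B.over (U \<inter> V)" using a' unfolding U V dom .
    let ?q = "B.coord x a"
    have q: "?q \<in> B.coord x ` B.over (U \<inter> V)" using a by blast
    have "transition U x y differentiable (at ?q)"
      by (rule smooth_on_differentiable[OF smooth_rep[OF U(1) V(1)] q])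
    then have "partial v (y' \<circ> \<Lambda> \<circ> inv_into U' x') ?q = iterated_coords (partial v (transition U x y) ?q)" for v
      using partial_cong_open[OF domain_open[OF U(1) V(1)] q rep[OF U(1) V(1)]]
      by (simp only: U V partial_bounded_linear[OF bl])
    then have "frechet_derivative (y' \<circ> \<Lambda> \<circ> inv_into U' x') (at ?q)
        = iterated_coords \<circ> frechet_derivative (transition U x y) (at ?q)"
      by (simp add: partial_def fun_eq_iff)
    moreover have "surj (frechet_derivative (transition U x y) (at ?q))"
      unfolding transition_def
      using BJ.surj_transition_derivative[OF chartB[OF U(1)] chartB[OF V(1)]] a
      by (simp add: B.over_Int[symmetric])
    ultimately show ?thesis
      using comp_surj[OF _ surj_iterated_coords] by (simp add: U)
  qed

  have onto: "\<Lambda> ` points B.jets = points I.jets"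
  proof
    show "\<Lambda> ` points B.jets \<subseteq> points I.jets"
      by (auto simp: B.jets_def I.jets_def \<Lambda> intro: pj)
    show "points I.jets \<subseteq> \<Lambda> ` points B.jets"
    proof
      fix J assume "J \<in> points I.jets"
      then obtain \<Psi> where \<Psi>: "J = I.jet \<Psi>" "smooth_param A.jets \<Psi>" unfolding I.jets_def by auto
      obtain U x where U: "(U, x) \<in> atlas M" "\<Psi> 0 \<in> A.over U"
        using I.chart_around[OF I.smooth_paramD(1)[OF \<Psi>(2)]] unfolding A.atlas_jets by blast
      obtain e L B where p: "iterated_coords (e, L, B) = jet1_at_0 (A.coord x \<circ> \<Psi>)"
        using surj_iterated_coords by (metis surjD surj_pair)
      have "fst (fst (iterated_coords (e, L, B))) = fst (A.coord x (\<Psi> 0))"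
        unfolding p by (simp add: I.jet_coords_base)
      then have "e = fst (A.coord x (\<Psi> 0))" by (simp add: iterated_coords_def)
      moreover have "A.coord x (\<Psi> 0) \<in> x ` U \<times> UNIV"
        using A.coord_image[OF U(1), of U] U(2) by auto
      ultimately have "e \<in> x ` U" by auto
      then obtain \<phi> where \<phi>: "smooth_param M \<phi>" "\<phi> 0 \<in> U" "jet2_at_0 (x \<circ> \<phi>) = (e, L, B)"
        using B.exists_jet[OF U(1)] by blast
      have "I.jet (partial_jet M \<phi>) = I.jet \<Psi>"
        by (rule I.jet_eqI[OF pj[OF \<phi>(1)] \<Psi>(2) chartI[OF U(1)] _ U(2)])
           (simp_all add: pj0 \<phi> coords[OF \<phi>(1) U(1) \<phi>(2)] p)
      then have "J = \<Lambda> (B.jet \<phi>)" by (simp add: \<Lambda> \<phi>(1) \<Psi>(1))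
      moreover have "B.jet \<phi> \<in> points B.jets" using \<phi>(1) by (auto simp: B.jets_def)
      ultimately show "J \<in> \<Lambda> ` points B.jets" by blast
    qed
  qed

  have "quotient_manifold B.jets I.jets \<Lambda>"
    unfolding quotient_manifold_def submersion_def
    using B.smooth_manifold_jets[OF assms] I.smooth_manifold_jets[OF A.smooth_manifold_jets[OF assms]]
      smooth rank onto by blast
  moreover have "\<Lambda> (jet2 M \<phi>) = jet1 (J1 M) (partial_jet M \<phi>)" if "smooth_param M \<phi>" for \<phi>
    by (simp only: jet2_eq[OF M that] \<Lambda>[OF that] J1M jet1_eq[OF A.smooth_atlas_jets])
  ultimately show ?thesis
    unfolding J2M J1J1M using smooth_param_partial_jet[OF M] by blast
qed

end
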